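(* Let $A$ be a $\sigma$-unital C*-algebra such that for every separable C*-subalgebra $B$ of $M(A)$ there is an approximate unit for $A$ consisting of projections which is $B$-quasicentral. Then the corona $C(A)=M(A)/A$ is countably quantifier-free saturated.
   Context: $M(A)$ is the multiplier algebra of $A$. An approximate unit $(e_n)$ of $A$ is $B$-quasicentral if $\lim_n\|e_nb-be_n\|=0$ for all $b\in B$. For $F\subseteq\mathbb R$, $\varepsilon>0$, $F_\varepsilon=\{x:\operatorname{dist}(x,F)\le\varepsilon\}$. A C*-algebra $M$ is countably quantifier-free saturated if for every sequence $P_n(\bar x)$ ($n\in\mathbb N$) of *-polynomials (arbitrary degree) with coefficients in $M$ in variables $x_k$ ($k\in\mathbb N$) and every sequence of compact $K_n\subseteq\mathbb R$, the following are equivalent: (i) there are $b_k$ in the unit ball of $M$ with $\|P_n(\bar b)\|\in K_n$ for all $n$; (ii) for every $m$ there are $b_k$ in the unit ball of $M$ with $\|P_n(\bar b)\|\in(K_n)_{1/m}$ for all $n\le m$. *)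

theory Defs
  imports Complex_Main "HOL-Library.FuncSet" "HOL-Library.Countable_Set"
begin

record 'a cstar =
  cs_carrier :: "'a set"
  cs_zero :: 'a
  cs_add :: "'a \<Rightarrow> 'a \<Rightarrow> 'a"
  cs_smult :: "complex \<Rightarrow> 'a \<Rightarrow> 'a"
  cs_mult :: "'a \<Rightarrow> 'a \<Rightarrow> 'a"
  cs_star :: "'a \<Rightarrow> 'a"
  cs_nrm :: "'a \<Rightarrow> real"

definition cs_minus :: "'a cstar \<Rightarrow> 'a \<Rightarrow> 'a \<Rightarrow> 'a" where
  "cs_minus S x y = cs_add S x (cs_smult S (-1) y)"

definition is_cstar :: "'a cstar \<Rightarrow> bool" where
  "is_cstar S \<longleftrightarrow>
    (let C = cs_carrier S; z = cs_zero S; ad = cs_add S; sm = cs_smult S;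
         mu = cs_mult S; st = cs_star S; n = cs_nrm S in
     z \<in> C \<and>
     (\<forall>x\<in>C. \<forall>y\<in>C. ad x y \<in> C \<and> mu x y \<in> C) \<and>
     (\<forall>c. \<forall>x\<in>C. sm c x \<in> C) \<and> (\<forall>x\<in>C. st x \<in> C) \<and>
     \<comment> \<open>complex vector space\<close>
     (\<forall>x\<in>C. \<forall>y\<in>C. \<forall>w\<in>C. ad (ad x y) w = ad x (ad y w)) \<and>
     (\<forall>x\<in>C. \<forall>y\<in>C. ad x y = ad y x) \<and>
     (\<forall>x\<in>C. ad z x = x) \<and>
     (\<forall>x\<in>C. ad x (sm (-1) x) = z) \<and>
     (\<forall>c. \<forall>x\<in>C. \<forall>y\<in>C. sm c (ad x y) = ad (sm c x) (sm c y)) \<and>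
     (\<forall>c d. \<forall>x\<in>C. sm (c + d) x = ad (sm c x) (sm d x)) \<and>
     (\<forall>c d. \<forall>x\<in>C. sm c (sm d x) = sm (c * d) x) \<and>
     (\<forall>x\<in>C. sm 1 x = x) \<and>
     \<comment> \<open>associative algebra\<close>
     (\<forall>x\<in>C. \<forall>y\<in>C. \<forall>w\<in>C. mu (mu x y) w = mu x (mu y w)) \<and>
     (\<forall>x\<in>C. \<forall>y\<in>C. \<forall>w\<in>C. mu x (ad y w) = ad (mu x y) (mu x w)) \<and>
     (\<forall>x\<in>C. \<forall>y\<in>C. \<forall>w\<in>C. mu (ad x y) w = ad (mu x w) (mu y w)) \<and>
     (\<forall>c. \<forall>x\<in>C. \<forall>y\<in>C. sm c (mu x y) = mu (sm c x) y \<and> sm c (mu x y) = mu x (sm c y)) \<and>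
     \<comment> \<open>involution\<close>
     (\<forall>x\<in>C. st (st x) = x) \<and>
     (\<forall>x\<in>C. \<forall>y\<in>C. st (ad x y) = ad (st x) (st y)) \<and>
     (\<forall>c. \<forall>x\<in>C. st (sm c x) = sm (cnj c) (st x)) \<and>
     (\<forall>x\<in>C. \<forall>y\<in>C. st (mu x y) = mu (st y) (st x)) \<and>
     \<comment> \<open>norm, submultiplicativity, C*-identity\<close>
     (\<forall>x\<in>C. n x \<ge> 0 \<and> (n x = 0 \<longleftrightarrow> x = z)) \<and>
     (\<forall>x\<in>C. \<forall>y\<in>C. n (ad x y) \<le> n x + n y) \<and>
     (\<forall>c. \<forall>x\<in>C. n (sm c x) = cmod c * n x) \<and>
     (\<forall>x\<in>C. \<forall>y\<in>C. n (mu x y) \<le> n x * n y) \<and>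
     (\<forall>x\<in>C. n (mu (st x) x) = (n x)\<^sup>2) \<and>
     \<comment> \<open>completeness\<close>
     (\<forall>X. (\<forall>k. X k \<in> C) \<and>
          (\<forall>e>0. \<exists>N. \<forall>p\<ge>N. \<forall>q\<ge>N. n (cs_minus S (X p) (X q)) < e) \<longrightarrow>
          (\<exists>l\<in>C. (\<lambda>k. n (cs_minus S (X k) l)) \<longlonglongrightarrow> 0)))"

definition cs_positive :: "'a cstar \<Rightarrow> 'a \<Rightarrow> bool" where
  "cs_positive S x \<longleftrightarrow> x \<in> cs_carrier S \<and> (\<exists>y\<in>cs_carrier S. x = cs_mult S (cs_star S y) y)"

definition cs_le :: "'a cstar \<Rightarrow> 'a \<Rightarrow> 'a \<Rightarrow> bool" where
  "cs_le S x y \<longleftrightarrow> cs_positive S (cs_minus S y x)"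

definition cs_projection :: "'a cstar \<Rightarrow> 'a \<Rightarrow> bool" where
  "cs_projection S p \<longleftrightarrow> p \<in> cs_carrier S \<and> p = cs_star S p \<and> p = cs_mult S p p"

definition approx_unit :: "'a cstar \<Rightarrow> (nat \<Rightarrow> 'a) \<Rightarrow> bool" where
  "approx_unit S e \<longleftrightarrow>
     (\<forall>k. cs_positive S (e k) \<and> cs_nrm S (e k) \<le> 1 \<and> cs_le S (e k) (e (Suc k))) \<and>
     (\<forall>a\<in>cs_carrier S. (\<lambda>k. cs_nrm S (cs_minus S (cs_mult S (e k) a) a)) \<longlonglongrightarrow> 0 \<and>
                         (\<lambda>k. cs_nrm S (cs_minus S (cs_mult S a (e k)) a)) \<longlonglongrightarrow> 0)"

definition sigma_unital :: "'a cstar \<Rightarrow> bool" where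
  "sigma_unital S \<longleftrightarrow> (\<exists>e. approx_unit S e)"

definition separable_subalg :: "'a cstar \<Rightarrow> 'a set \<Rightarrow> bool" where
  "separable_subalg S B \<longleftrightarrow>
     B \<subseteq> cs_carrier S \<and> cs_zero S \<in> B \<and>
     (\<forall>x\<in>B. \<forall>y\<in>B. cs_add S x y \<in> B \<and> cs_mult S x y \<in> B) \<and>
     (\<forall>c. \<forall>x\<in>B. cs_smult S c x \<in> B) \<and> (\<forall>x\<in>B. cs_star S x \<in> B) \<and>
     (\<forall>X l. (\<forall>k. X k \<in> B) \<and> l \<in> cs_carrier S \<and>
            (\<lambda>k. cs_nrm S (cs_minus S (X k) l)) \<longlonglongrightarrow> 0 \<longrightarrow> l \<in> B) \<and>
     (\<exists>D. countable D \<and> D \<subseteq> B \<and> (\<forall>b\<in>B. \<forall>e>0. \<exists>d\<in>D. cs_nrm S (cs_minus S b d) < e))"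

type_synonym 'a mult = "('a \<Rightarrow> 'a) \<times> ('a \<Rightarrow> 'a)"

definition bdd_linear_on :: "'a cstar \<Rightarrow> ('a \<Rightarrow> 'a) \<Rightarrow> bool" where
  "bdd_linear_on A T \<longleftrightarrow> T \<in> extensional (cs_carrier A) \<and> T \<in> cs_carrier A \<rightarrow> cs_carrier A \<and>
     (\<forall>x\<in>cs_carrier A. \<forall>y\<in>cs_carrier A. T (cs_add A x y) = cs_add A (T x) (T y)) \<and>
     (\<forall>c. \<forall>x\<in>cs_carrier A. T (cs_smult A c x) = cs_smult A c (T x)) \<and>
     (\<exists>K. \<forall>x\<in>cs_carrier A. cs_nrm A (T x) \<le> K * cs_nrm A x)"

definition double_centralizer :: "'a cstar \<Rightarrow> 'a mult \<Rightarrow> bool" where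
  "double_centralizer A m \<longleftrightarrow> bdd_linear_on A (fst m) \<and> bdd_linear_on A (snd m) \<and>
     (\<forall>x\<in>cs_carrier A. \<forall>y\<in>cs_carrier A. cs_mult A x (fst m y) = cs_mult A (snd m x) y)"

definition mult_alg :: "'a cstar \<Rightarrow> 'a mult cstar" where
  "mult_alg A = (let C = cs_carrier A in
    \<lparr> cs_carrier = {m. double_centralizer A m},
      cs_zero = (restrict (\<lambda>_. cs_zero A) C, restrict (\<lambda>_. cs_zero A) C),
      cs_add = (\<lambda>m1 m2. (restrict (\<lambda>x. cs_add A (fst m1 x) (fst m2 x)) C,
                         restrict (\<lambda>x. cs_add A (snd m1 x) (snd m2 x)) C)),
      cs_smult = (\<lambda>c m. (restrict (\<lambda>x. cs_smult A c (fst m x)) C,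
                         restrict (\<lambda>x. cs_smult A c (snd m x)) C)),
      cs_mult = (\<lambda>m1 m2. (restrict (\<lambda>x. fst m1 (fst m2 x)) C,
                          restrict (\<lambda>x. snd m2 (snd m1 x)) C)),
      cs_star = (\<lambda>m. (restrict (\<lambda>x. cs_star A (snd m (cs_star A x))) C,
                      restrict (\<lambda>x. cs_star A (fst m (cs_star A x))) C)),
      cs_nrm = (\<lambda>m. Sup {cs_nrm A (fst m x) | x. x \<in> C \<and> cs_nrm A x \<le> 1}) \<rparr>)"

definition mult_emb :: "'a cstar \<Rightarrow> 'a \<Rightarrow> 'a mult" where
  "mult_emb A a = (restrict (\<lambda>x. cs_mult A a x) (cs_carrier A),
                   restrict (\<lambda>x. cs_mult A x a) (cs_carrier A))"

definition corona_nrm :: "'a cstar \<Rightarrow> 'a mult \<Rightarrow> real" where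
  "corona_nrm A m = Inf {cs_nrm (mult_alg A) (cs_minus (mult_alg A) m (mult_emb A a)) | a. a \<in> cs_carrier A}"

datatype 'c spoly = PVar nat | PConst 'c | PAdd "'c spoly" "'c spoly" | PMult "'c spoly" "'c spoly"
  | PScal complex "'c spoly" | PStar "'c spoly"

primrec spoly_consts :: "'c spoly \<Rightarrow> 'c set" where
  "spoly_consts (PVar k) = {}"
| "spoly_consts (PConst c) = {c}"
| "spoly_consts (PAdd p q) = spoly_consts p \<union> spoly_consts q"
| "spoly_consts (PMult p q) = spoly_consts p \<union> spoly_consts q"
| "spoly_consts (PScal z p) = spoly_consts p"
| "spoly_consts (PStar p) = spoly_consts p"

primrec spoly_eval :: "'a cstar \<Rightarrow> (nat \<Rightarrow> 'a) \<Rightarrow> 'a spoly \<Rightarrow> 'a" where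
  "spoly_eval S b (PVar k) = b k"
| "spoly_eval S b (PConst c) = c"
| "spoly_eval S b (PAdd p q) = cs_add S (spoly_eval S b p) (spoly_eval S b q)"
| "spoly_eval S b (PMult p q) = cs_mult S (spoly_eval S b p) (spoly_eval S b q)"
| "spoly_eval S b (PScal z p) = cs_smult S z (spoly_eval S b p)"
| "spoly_eval S b (PStar p) = cs_star S (spoly_eval S b p)"

text \<open>F_eps = {x. dist(x,F) \<le> eps}; for compact F this is the following (empty if F is empty).\<close>
definition thicken :: "real set \<Rightarrow> real \<Rightarrow> real set" where
  "thicken F e = {x. \<exists>y\<in>F. \<bar>x - y\<bar> \<le> e}"

text \<open>Elements of C(A) are represented by multipliers; the unit ball of C(A) consists of the
  classes of multipliers of quotient norm \<le> 1; coefficients in C(A) are represented by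
  multipliers; evaluation is compatible with the quotient map since A is an ideal.\<close>
definition corona_ctbl_qf_saturated :: "'a cstar \<Rightarrow> bool" where
  "corona_ctbl_qf_saturated A \<longleftrightarrow>
    (\<forall>(P :: nat \<Rightarrow> 'a mult spoly) (K :: nat \<Rightarrow> real set).
       (\<forall>n. spoly_consts (P n) \<subseteq> cs_carrier (mult_alg A)) \<and> (\<forall>n. compact (K n)) \<longrightarrow>
       ((\<exists>b. (\<forall>k. b k \<in> cs_carrier (mult_alg A) \<and> corona_nrm A (b k) \<le> 1) \<and>
             (\<forall>n. corona_nrm A (spoly_eval (mult_alg A) b (P n)) \<in> K n))
        \<longleftrightarrow>
        (\<forall>m::nat. m \<ge> 1 \<longrightarrow>
           (\<exists>b. (\<forall>k. b k \<in> cs_carrier (mult_alg A) \<and> corona_nrm A (b k) \<le> 1) \<and>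
                (\<forall>n\<le>m. corona_nrm A (spoly_eval (mult_alg A) b (P n)) \<in> thicken (K n) (1 / real m))))))"

end

theory Submission
  imports Defs
begin

text \<open>
  Lift approximate solutions \<open>b\<^sup>m\<close> to multipliers of norm at most \<open>2\<close> and let \<open>(e\<^sub>k)\<close> be an
  approximate unit of projections that is quasicentral for these lifts and the coefficients.
  Along a sparse subsequence the differences \<open>f\<^sub>m = e\<^sub>\<kappa>\<^sub>(\<^sub>m\<^sub>+\<^sub>1\<^sub>) - e\<^sub>\<kappa>\<^sub>(\<^sub>m\<^sub>)\<close> are orthogonal projections which
  almost commute with the data of stage \<open>m\<close> and satisfy \<open>\<parallel>f\<^sub>m x f\<^sub>m\<parallel> \<approx> \<parallel>\<pi>(x)\<parallel>\<close> for the relevant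
  \<open>x\<close>. The block diagonal elements \<open>b = \<Sum> f\<^sub>m b\<^sup>m f\<^sub>m\<close> converge strictly, \<open>P(b)\<close> agrees on the
  \<open>m\<close>-th block with \<open>P(b\<^sup>m)\<close> up to a summable error, and hence \<open>\<parallel>\<pi>(P(b))\<parallel>\<close> is the limit superior
  of \<open>\<parallel>\<pi>(P(b\<^sup>m))\<parallel>\<close>, which lies in the closed set \<open>K\<close>.

  Orthogonality of the \<open>f\<^sub>m\<close> needs that \<open>q - p = y\<^sup>*y\<close> forces \<open>q p = p\<close> for projections. This is
  a case of the positivity of \<open>y\<^sup>*y\<close> and is obtained here from norm estimates for
  \<open>1 + t x\<close> with small \<open>t\<close> instead of the functional calculus.
\<close>

text \<open>Projections matter because their increments are orthogonal: a block sum has the largest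
  block norm as its norm, so no constant grows with the number of blocks. The price lies in the
  order, which is only known as the existence of some \<open>y\<close> with \<open>st y * y\<close>
  equal to the difference.

  At stage m only finitely many data are controlled, those with index at most m. Each datum enters
  from some stage on and the earlier stages merely enlarge constants, so errors of the form constant
  times \<open>(1/2)^m\<close> survive every polynomial. The norm 2 of the lifts keeps these
  constants finite; the bound 1 on the corona norm of the solution is recovered from its blocks, by
  the same limit superior that puts the polynomial values into K.

  The estimates live in a ring with a C*-seminorm \<open>n\<close> instead of a norm, because an
  element of the ring type used later has coordinates in many algebras and \<open>n\<close> sees
  only one of them. A vanishing norm therefore yields an equation only inside the ideal
  \<open>J\<close>, where \<open>n\<close> is faithful, and the arguments are arranged to pass
  through \<open>J\<close>.\<close>

section \<open>Positivity by norm estimates\<close>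

text \<open>If x exceeded c, the powers of x/c would outgrow any linear prefactor. Only dyadic
  exponents appear because the C*-identity computes \<open>n (x ^ (2^k))\<close> for selfadjoint x
  exactly. The lemma takes the place of the spectral radius formula: factors of at most linear
  growth disappear in the root.\<close>

lemma le_of_power_growth:
  fixes x c \<alpha> \<beta> :: real
  assumes "0 \<le> x" "0 \<le> c" and bound: "\<And>k::nat. x ^ (2^k) \<le> (\<alpha> + \<beta> * 2^k) * c ^ (2^k)"
  shows "x \<le> c"
proof (rule ccontr)
  assume "\<not> x \<le> c"
  then have xc: "c < x" by simp
  show False
  proof (cases "c = 0")
    case True
    with bound[of 0] xc show False by simp
  next
    case False
    with assms have c: "0 < c" by simp
    define \<rho> where "\<rho> = x / c"
    have \<rho>: "1 < \<rho>" using c xc by (simp add: \<rho>_def)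
    have b: "\<rho> ^ (2^k) \<le> \<alpha> + \<beta> * real (2^k)" for k :: nat
    proof -
      have "x ^ (2^k) = \<rho> ^ (2^k) * c ^ (2^k)" using c by (simp add: \<rho>_def power_divide)
      with bound[of k] c show ?thesis by simp
    qed
    have 1: "(\<lambda>m. (1/\<rho>) ^ m) \<longlonglongrightarrow> 0"
      using \<rho> by (intro LIMSEQ_power_zero) simp
    have 2: "(\<lambda>m. real m * (1/\<rho>) ^ m) \<longlonglongrightarrow> 0"
      using \<rho> by (intro powser_times_n_limit_0) simp
    have "(\<lambda>m. \<alpha> * (1/\<rho>) ^ m + \<beta> * (real m * (1/\<rho>) ^ m)) \<longlonglongrightarrow> \<alpha> * 0 + \<beta> * 0"
      by (intro tendsto_add tendsto_mult tendsto_const 1 2)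
    then have "\<forall>\<^sub>F m in sequentially. \<alpha> * (1/\<rho>) ^ m + \<beta> * (real m * (1/\<rho>) ^ m) < 1"
      by (auto intro: order_tendstoD)
    then obtain N where N: "\<And>m. m \<ge> N \<Longrightarrow> \<alpha> * (1/\<rho>) ^ m + \<beta> * (real m * (1/\<rho>) ^ m) < 1"
      by (auto simp: eventually_sequentially)
    have "\<alpha> * (1/\<rho>) ^ (2^N) + \<beta> * (real (2^N) * (1/\<rho>) ^ (2^N)) < 1"
      by (rule N) (simp add: less_imp_le)
    then have "(\<alpha> + \<beta> * real (2^N)) / \<rho> ^ (2^N) < 1"
      by (simp add: power_one_over add_divide_distrib)
    then have "\<alpha> + \<beta> * real (2^N) < \<rho> ^ (2^N)" using \<rho> by (simp add: field_simps)
    with b[of N] show False by simp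
  qed
qed

text \<open>Scalars are central ring elements \<open>sc c\<close>, so scalar multiplication is ring
  multiplication and \<open>algebra_simps\<close> applies. Definiteness of \<open>n\<close> is left
  out because the intended \<open>n\<close> reads off a single coordinate.\<close>

locale cstar_seminorm =
  fixes st :: "'b::{ring,monoid_mult} \<Rightarrow> 'b" and sc :: "complex \<Rightarrow> 'b" and n :: "'b \<Rightarrow> real"
  assumes st_st [simp]: "st (st x) = x"
    and st_add [simp]: "st (x + y) = st x + st y"
    and st_mult [simp]: "st (x * y) = st y * st x"
    and sc_add: "sc (c + d) = sc c + sc d"
    and sc_mult: "sc (c * d) = sc c * sc d"
    and sc_1 [simp]: "sc 1 = 1"
    and sc_commute: "sc c * x = x * sc c"
    and st_sc [simp]: "st (sc c) = sc (cnj c)"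
    and n_add: "n (x + y) \<le> n x + n y"
    and n_mult: "n (x * y) \<le> n x * n y"
    and n_sc [simp]: "n (sc c * x) = cmod c * n x"
    and n_cstar: "n (st x * x) = (n x)\<^sup>2"
begin

lemma sc_0 [simp]: "sc 0 = 0"
  using sc_add[of 0 0] by simp

lemma sc_minus: "sc (- c) = - sc c"
  using sc_add[of c "- c"] by (simp add: eq_neg_iff_add_eq_0 add.commute)

lemma sc_sc: "sc c * (sc d * x) = sc (c * d) * x"
  by (simp add: sc_mult mult.assoc)

lemma mult_sc: "x * (sc c * y) = sc c * (x * y)"
  by (metis mult.assoc sc_commute)

lemma sc_mult_sc: "(sc c * x) * (sc d * y) = sc (c * d) * (x * y)"
  by (simp only: mult.assoc mult_sc[of x] sc_sc)

lemma sc_half: "sc (1/2) * (x + x) = x"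
proof -
  have "sc (1/2) * (x + x) = (sc (1/2) + sc (1/2)) * x"
    by (simp add: algebra_simps)
  also have "\<dots> = x" by (simp add: sc_add[symmetric])
  finally show ?thesis .
qed

lemma st_0 [simp]: "st 0 = 0"
  using st_add[of 0 0] by simp

lemma st_minus [simp]: "st (- x) = - st x"
  using st_add[of x "- x"] by (simp add: eq_neg_iff_add_eq_0 add.commute)

lemma st_diff [simp]: "st (x - y) = st x - st y"
  using st_add[of x "- y"] by simp

lemma st_1 [simp]: "st 1 = 1"
  using st_mult[of "st 1" 1] by simp

lemma st_power [simp]: "st (x ^ k) = st x ^ k"
  by (induction k) (simp_all add: power_commutes)

lemma n_0 [simp]: "n 0 = 0"
  using n_sc[of 0 0] by simp

lemma n_minus [simp]: "n (- x) = n x"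
  using n_sc[of "-1" x] by (simp add: sc_minus)

lemma n_nonneg [simp]: "0 \<le> n x"
  using n_add[of x "- x"] by simp

lemma n_diff: "n (x - y) \<le> n x + n y"
  using n_add[of x "- y"] by simp

lemma n_diff_commute: "n (x - y) = n (y - x)"
  using n_minus[of "x - y"] by simp

lemma n_st [simp]: "n (st x) = n x"
proof -
  have zero_le: "0 \<le> n y" for y by simp
  have le: "n x \<le> n (st x)" for x
  proof (cases "n x = 0")
    case False
    have "n x * n x \<le> n (st x) * n x"
      using n_cstar[of x] n_mult[of "st x" x] by (simp add: power2_eq_square)
    then show ?thesis
      by (rule mult_right_le_imp_le) (use False zero_le in \<open>simp add: less_le\<close>)
  qed (simp add: zero_le)
  show ?thesis using le[of x] le[of "st x"] by simp
qed

lemma n_1: "n 1 \<le> 1"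
proof (cases "n 1 = 0")
  case False
  have "n 1 = n 1 * n 1" using n_cstar[of 1] by (simp add: power2_eq_square)
  with False show ?thesis by simp
qed simp

lemma n_mult_mono: "n x \<le> a \<Longrightarrow> n y \<le> b \<Longrightarrow> n (x * y) \<le> a * b"
  by (meson mult_mono n_mult n_nonneg order_trans)

lemma n_power: "n (x ^ k) \<le> n x ^ k"
proof (induction k)
  case (Suc k)
  show ?case using n_mult_mono[OF order_refl[of "n x"] Suc] by simp
qed (simp add: n_1)

lemma n_selfadjoint_power:
  assumes "st x = x"
  shows "n (x ^ (2^k)) = n x ^ (2^k)"
proof (induction k)
  case (Suc k)
  have "n (x ^ (2 ^ Suc k)) = n (st (x ^ (2^k)) * x ^ (2^k))"
    by (simp add: assms power_add[symmetric] mult_2)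
  also have "\<dots> = n x ^ (2 ^ Suc k)"
    by (simp only: n_cstar Suc power_mult[symmetric] power_Suc2)
  finally show ?case .
qed simp

lemma n_projection:
  assumes "st p = p" "p * p = p"
  shows "n p \<le> 1"
proof (cases "n p = 0")
  case False
  have "n p = n p * n p" using n_cstar[of p] assms by (simp add: power2_eq_square)
  with False show ?thesis by simp
qed simp

text \<open>With \<open>x = st a * a\<close> and \<open>y = st b * b\<close> the mixed products
  vanish, so powers of x + y are sums of powers. The dyadic power of the norm is then at most 2
  times that of \<open>c\<^sup>2\<close>, and the factor 2 disappears by
  \<open>le_of_power_growth\<close>.\<close>

lemma n_add_orthogonal:
  assumes "st a * b = 0" "a * st b = 0" "n a \<le> c" "n b \<le> c"
  shows "n (a + b) \<le> c"
proof -
  have c: "0 \<le> c" using assms(3) n_nonneg[of a] by linarith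
  have ba: "st b * a = 0" using assms(1) st_mult[of "st a" b] by simp
  have ab': "b * st a = 0" using assms(2) st_mult[of a "st b"] by simp
  define x y where "x = st a * a" and "y = st b * b"
  have xy: "x * y = 0" "y * x = 0"
    unfolding x_def y_def by (metis mult.assoc assms(2) ab' mult_zero_left mult_zero_right)+
  have pow: "(x + y) ^ Suc k = x ^ Suc k + y ^ Suc k" for k
  proof (induction k)
    case (Suc k)
    have "(x + y) ^ Suc (Suc k) = (x + y) * (x ^ Suc k + y ^ Suc k)"
      by (simp only: power_Suc[of _ "Suc k"] Suc)
    also have "\<dots> = x * x ^ Suc k + (x * y) * y ^ k + (y * x) * x ^ k + y * y ^ Suc k"
      by (simp add: distrib_left distrib_right mult.assoc)
    finally show ?case by (simp add: xy)
  qed simp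
  have sa: "st (x + y) = x + y" by (simp add: x_def y_def)
  have nx: "n x \<le> c\<^sup>2" and ny: "n y \<le> c\<^sup>2"
    unfolding x_def y_def n_cstar using assms(3,4) by (simp_all add: power_mono)
  have "n (x + y) \<le> c\<^sup>2"
  proof (rule le_of_power_growth[where \<alpha>=2 and \<beta>=0])
    fix k :: nat
    obtain j where j: "(2::nat)^k = Suc j" by (metis not0_implies_Suc power_not_zero zero_neq_numeral)
    have "n (x + y) ^ (2^k) = n (x ^ (2^k) + y ^ (2^k))"
      unfolding n_selfadjoint_power[OF sa, symmetric] unfolding j pow ..
    also have "\<dots> \<le> n x ^ (2^k) + n y ^ (2^k)"
      by (rule order_trans[OF n_add add_mono[OF n_power n_power]])
    also have "\<dots> \<le> (c\<^sup>2) ^ (2^k) + (c\<^sup>2) ^ (2^k)"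
      by (intro add_mono power_mono nx ny) auto
    finally show "n (x + y) ^ (2^k) \<le> (2 + 0 * 2^k) * (c\<^sup>2) ^ (2^k)" by simp
  qed simp_all
  also have "x + y = st (a + b) * (a + b)"
    using assms(1) ba by (simp add: x_def y_def algebra_simps)
  finally have "(n (a + b))\<^sup>2 \<le> c\<^sup>2" by (simp only: n_cstar)
  then show ?thesis using c by (rule power2_le_imp_le)
qed

text \<open>The element v = 1 + i s a - t a^2 with s = sqrt(2t) is the second Taylor polynomial of
  the unitary exp(i s a). It satisfies \<open>st v * v = 1 + z * z\<close>, hence is unitary up to
  order t^2, and 1 - t a^2 is its real part.\<close>

lemma n_one_minus_square:
  assumes "st a = a" "0 \<le> t"
  shows "n (1 - sc (complex_of_real t) * (a * a)) \<le> 1 + (n a ^ 4) * t\<^sup>2"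
proof -
  define s where "s = sqrt (2 * t)"
  have s: "s * s = 2 * t" using assms(2) by (simp add: s_def)
  define w where "w = sc (\<i> * complex_of_real s) * a"
  define z where "z = sc (complex_of_real t) * (a * a)"
  have stw: "st w = - w" by (simp add: w_def assms(1) sc_minus sc_commute)
  have stz: "st z = z" by (simp add: z_def assms(1) sc_commute mult.assoc)
  have "\<i> * complex_of_real s * (\<i> * complex_of_real s) = - (complex_of_real (s * s))"
    by (simp add: algebra_simps)
  also have "\<dots> = - (complex_of_real t + complex_of_real t)" by (simp add: s)
  finally have sq: "\<i> * complex_of_real s * (\<i> * complex_of_real s) = - (complex_of_real t + complex_of_real t)" .
  have "w * w = sc (\<i> * complex_of_real s * (\<i> * complex_of_real s)) * (a * a)"
    unfolding w_def by (rule sc_mult_sc)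
  then have ww: "w * w = - (z + z)"
    unfolding sq z_def by (simp only: sc_minus sc_add mult_minus_left distrib_right)
  have wz: "w * z = z * w"
    unfolding w_def z_def sc_mult_sc mult.commute[of "complex_of_real t"] by (simp only: mult.assoc)
  define v where "v = 1 + w - z"
  have stv: "st v = 1 - w - z" by (simp add: v_def stw stz)
  have "st v * v = 1 + z * z"
    unfolding stv unfolding v_def by (simp add: algebra_simps ww wz)
  then have "(n v)\<^sup>2 \<le> 1 + n z * n z"
    unfolding n_cstar[symmetric] using n_add[of 1 "z * z"] n_1 n_mult[of z z] by simp
  also have "\<dots> \<le> (1 + n z * n z)\<^sup>2" by (simp add: power2_eq_square algebra_simps)
  finally have nv: "n v \<le> 1 + n z * n z" by (rule power2_le_imp_le) simp
  have "1 - z = sc (1/2) * ((1 - z) + (1 - z))" by (rule sc_half[symmetric])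
  also have "(1 - z) + (1 - z) = v + st v" unfolding stv unfolding v_def by simp
  finally have "n (1 - z) \<le> 1/2 * n (v + st v)" by (metis n_sc norm_divide norm_numeral norm_one order_refl)
  also have "\<dots> \<le> n v" using n_add[of v "st v"] by simp
  also note nv
  finally have "n (1 - z) \<le> 1 + n z * n z" .
  moreover have "n z \<le> t * (n a * n a)" using n_mult[of a a] assms(2) by (simp add: z_def mult_left_mono)
  then have "n z * n z \<le> (t * (n a * n a)) * (t * (n a * n a))" by (intro mult_mono) (simp_all add: assms(2))
  ultimately show ?thesis by (simp add: z_def power2_eq_square power4_eq_xxxx mult_ac)
qed

text \<open>Replaces the fact that \<open>st x * x\<close> and \<open>x * st x\<close> have the same
  nonzero spectrum. Shifting one factor x past powers gives
  \<open>X ^ N = 1 + sc c * (x * S N * st x)\<close>, where \<open>S N\<close> is a sum of N powers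
  of T. This costs a factor linear in N, which \<open>le_of_power_growth\<close> removes.\<close>

lemma n_one_plus_transfer:
  assumes c: "n (1 + sc (complex_of_real c) * (st x * x)) \<le> 1 + \<delta>" and \<delta>: "0 \<le> \<delta>"
  shows "n (1 + sc (complex_of_real c) * (x * st x)) \<le> 1 + \<delta>"
proof -
  define T where "T = 1 + sc (complex_of_real c) * (st x * x)"
  define X where "X = 1 + sc (complex_of_real c) * (x * st x)"
  define S where "S N = (\<Sum>j<N. T ^ j)" for N
  have S_Suc: "S (Suc N) = 1 + T * S N" for N
    by (simp only: S_def sum.lessThan_Suc_shift sum_distrib_left) simp
  have pow: "X ^ N = 1 + sc (complex_of_real c) * (x * S N * st x)" for N
  proof (induction N)
    case (Suc N)
    define r where "r = sc (complex_of_real c)"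
    have r: "x * (r * y) = r * (x * y)" "st x * (r * y) = r * (st x * y)" for y
      by (simp_all only: r_def mult_sc)
    have "X ^ Suc N = (1 + r * (x * st x)) * (1 + r * (x * S N * st x))"
      by (simp add: Suc r_def) (simp add: X_def)
    then show ?case
      unfolding S_Suc T_def r_def[symmetric]
      by (simp only: distrib_left distrib_right mult.assoc mult_1_left mult_1_right r add_ac)
  qed (simp add: S_def)
  have nS: "n (S N) \<le> real N * (1 + \<delta>) ^ N" for N
  proof (induction N)
    case (Suc N)
    have "n (S (Suc N)) \<le> n (S N) + n (T ^ N)" unfolding S_def by (simp add: n_add)
    also have "n (T ^ N) \<le> (1 + \<delta>) ^ N"
      using n_power[of T N] power_mono[OF c[folded T_def], of N] by simp
    also have "\<dots> \<le> (1 + \<delta>) ^ Suc N" using \<delta> by (intro power_increasing) auto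
    also have "n (S N) \<le> real N * (1 + \<delta>) ^ N" by (rule Suc)
    also have "\<dots> \<le> real N * (1 + \<delta>) ^ Suc N" using \<delta> by (intro mult_left_mono power_increasing) auto
    finally show ?case by (simp add: algebra_simps)
  qed (simp add: S_def)
  have sa: "st X = X" by (simp add: X_def sc_commute mult.assoc)
  have "n X \<le> 1 + \<delta>"
  proof (rule le_of_power_growth)
    fix k :: nat
    let ?N = "2^k :: nat"
    have "n X ^ ?N = n (X ^ ?N)" by (simp add: n_selfadjoint_power[OF sa])
    also have "\<dots> \<le> 1 + \<bar>c\<bar> * (n x * n (S ?N) * n x)"
    proof -
      have "n (x * S ?N * st x) \<le> n x * n (S ?N) * n x"
        using n_mult_mono[OF n_mult[of x "S ?N"] order_refl[of "n (st x)"]] by simp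
      then show ?thesis
        unfolding pow using n_add[of 1 "sc (complex_of_real c) * (x * S ?N * st x)"] n_1
        by (simp add: mult_left_mono order_trans[OF n_add] add_mono)
    qed
    also have "\<dots> \<le> 1 * (1 + \<delta>) ^ ?N + \<bar>c\<bar> * (n x * (real ?N * (1 + \<delta>) ^ ?N) * n x)"
      by (intro add_mono mult_left_mono mult_right_mono nS) (use \<delta> in auto)
    finally show "n X ^ ?N \<le> (1 + (\<bar>c\<bar> * (n x)\<^sup>2) * 2^k) * (1 + \<delta>) ^ ?N"
      by (simp add: algebra_simps power2_eq_square)
  qed (use \<delta> in auto)
  then show ?thesis by (simp add: X_def)
qed


lemma n_sum: "n (\<Sum>i\<in>I. f i) \<le> (\<Sum>i\<in>I. n (f i))"
  by (induction I rule: infinite_finite_induct) (auto intro: order_trans[OF n_add])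

text \<open>In the binomial expansion the coefficient of y^j is multiplied by the sum of the
  (j-1)-st powers of all N-th roots of unity. For j between 0 and K this vanishes unless j = 1, and
  K y occurs N times.\<close>

lemma roots_of_unity_average:
  fixes N K :: nat and y :: 'b
  assumes "K < N" "1 < N"
  defines "\<omega> \<equiv> \<lambda>m::nat. cis (2 * pi * real m / real N)"
  shows "(\<Sum>m<N. sc (inverse (\<omega> m)) * (1 + sc (\<omega> m) * y) ^ K) = sc (of_nat (N * K)) * y"
proof -
  \<comment> \<open>These twisted sums replace the binomial expansion: splitting off one factor
    lowers the power k and raises the twist j, so j + k never grows and stays below N.
    \<open>H\<close> is the case of twist -1.\<close>
  define F where "F j k = (\<Sum>m<N. sc (\<omega> m ^ j) * (1 + sc (\<omega> m) * y) ^ k)" for j k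
  define H where "H k = (\<Sum>m<N. sc (inverse (\<omega> m)) * (1 + sc (\<omega> m) * y) ^ k)" for k
  have N: "N > 0" using assms by simp
  have sc_sum: "sc (\<Sum>m\<in>I. g m) = (\<Sum>m\<in>I. sc (g m))" for I :: "nat set" and g
    by (induction I rule: infinite_finite_induct) (auto simp: sc_add)
  have \<omega>0: "\<omega> m \<noteq> 0" for m by (simp add: \<omega>_def)
  define w where "w = cis (2 * pi / real N)"
  have \<omega>_w: "\<omega> m = w ^ m" for m
    by (simp add: \<omega>_def w_def DeMoivre mult.commute)
  have w1: "w ^ N = 1" using N by (simp add: w_def DeMoivre)
  have wj: "w ^ j \<noteq> 1" if "0 < j" "j < N" for j
  proof
    assume "w ^ j = 1"
    then have "cis (real j * (2 * pi / real N)) = 1" by (simp add: w_def DeMoivre)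
    then have "cos (real j * (2 * pi / real N)) = 1" by (metis cis.sel(1) one_complex.sel(1))
    then obtain i where "real j * (2 * pi / real N) = of_int i * 2 * pi" by (auto simp: cos_one_2pi_int)
    then have "real j = real_of_int i * real N" using N by (simp add: field_simps)
    then have "int j = i * int N" by (metis of_int_eq_iff of_int_mult of_int_of_nat_eq)
    with that show False
      by (metis N dvd_triv_right int_dvd_int_iff nat_dvd_not_less)
  qed
  have geo: "(\<Sum>m<N. (w ^ j) ^ m) = 0" if "0 < j" "j < N" for j
  proof -
    have "(w ^ j) ^ N = 1" by (metis power_mult mult.commute w1 power_one)
    then show ?thesis using wj[OF that] by (simp add: geometric_sum)
  qed
  have geo': "(\<Sum>m<N. \<omega> m ^ j) = 0" if "0 < j" "j < N" for j
  proof -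
    have "\<omega> m ^ j = (w ^ j) ^ m" for m by (simp add: \<omega>_w power_mult[symmetric] mult.commute)
    then show ?thesis using geo[OF that] by simp
  qed
  have step: "sc c * (1 + sc z * y) ^ Suc k = sc c * (1 + sc z * y) ^ k + y * (sc (c * z) * (1 + sc z * y) ^ k)" for c z k
    by (simp only: power_Suc distrib_left distrib_right mult_1_left mult.assoc sc_sc mult_sc[of y])
  have F_Suc: "F j (Suc k) = F j k + y * F (Suc j) k" for j k
    unfolding F_def step by (simp add: sum.distrib sum_distrib_left mult.commute)
  have H_Suc: "H (Suc k) = H k + y * F 0 k" for k
    unfolding F_def H_def step by (simp add: sum.distrib sum_distrib_left \<omega>0)
  have F0: "F j 0 = 0" if "0 < j" "j < N" for j
    using geo'[OF that] by (simp add: F_def sc_sum[symmetric])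
  have F_j: "F j k = 0" if "0 < j" "j + k < N" for j k
    using that by (induction k arbitrary: j) (simp_all add: F0 F_Suc)
  have F_0: "F 0 k = sc (of_nat N)" if "k < N" for k
    using that
  proof (induction k)
    case 0
    have "F 0 0 = sc (\<Sum>m<N. 1)" unfolding sc_sum by (simp add: F_def)
    then show ?case by simp
  qed (simp add: F_Suc F_j)
  have "H k = sc (of_nat (N * k)) * y" if "k < N" for k
    using that
  proof (induction k)
    case 0
    have N2: "0 < N - 1" "N - 1 < N" using assms by auto
    have "inverse (\<omega> m) = \<omega> m ^ (N - 1)" for m
    proof -
      have "\<omega> m ^ N = 1" unfolding \<omega>_w by (metis power_mult mult.commute w1 power_one)
      then have "\<omega> m * \<omega> m ^ (N - 1) = 1" using N by (metis Suc_diff_1 power_Suc)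
      then show ?thesis by (simp add: inverse_unique)
    qed
    then show ?case using geo'[OF N2] by (simp add: H_def sc_sum[symmetric])
  next
    case (Suc k)
    then show ?case
      by (simp add: H_Suc F_0 sc_add sc_commute distrib_left distrib_right)
  qed
  then show ?thesis using assms(1) by (simp add: H_def)
qed

text \<open>The hypotheses give \<open>\<parallel>1 + \<zeta> t y\<parallel> \<le> 1 + O(t\<^sup>2)\<close> for all \<open>\<zeta>\<close> on the unit circle. Averaging
  \<open>\<zeta>\<^sup>-\<^sup>1 (1 + \<zeta> t y)\<^sup>K\<close> over roots of unity leaves \<open>K t y\<close>, and \<open>t = K\<^sup>-\<^sup>1\<^sup>/\<^sup>2\<close> keeps the powers bounded.\<close>

lemma n_eq_0_of_flat:
  assumes sa: "st y = y"
    and plus: "\<And>t. 0 \<le> t \<Longrightarrow> n (1 + sc (complex_of_real t) * y) \<le> 1 + C * t\<^sup>2"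
    and minus: "\<And>t. 0 \<le> t \<Longrightarrow> n (1 - sc (complex_of_real t) * y) \<le> 1 + C * t\<^sup>2"
    and C: "0 \<le> C"
  shows "n y = 0"
proof -
  \<comment> \<open>The first three summands bound the expansion of the product of the real and the
    imaginary estimate, with the fourth-order term reduced by \<open>cmod z <= 1\<close>. The last
    one pays for the cross term in \<open>circle\<close>.\<close>
  define D where "D = C + (n y)\<^sup>2 + C * (n y)\<^sup>2 + (n y)\<^sup>2"
  have D: "0 \<le> D" using C by (simp add: D_def)
  have real: "n (1 + sc (complex_of_real t) * y) \<le> 1 + C * t\<^sup>2" for t
    using plus[of t] minus[of "- t"] by (cases "0 \<le> t") (simp_all add: sc_minus)
  have imag: "n (1 + sc (\<i> * complex_of_real t) * y) \<le> 1 + (n y)\<^sup>2 * t\<^sup>2" for t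
  proof -
    define w where "w = sc (\<i> * complex_of_real t) * y"
    have "st w = - w" by (simp add: w_def sa sc_minus sc_commute)
    then have "st (1 + w) * (1 + w) = 1 - w * w" by (simp add: algebra_simps)
    then have "(n (1 + w))\<^sup>2 \<le> 1 + n w * n w"
      unfolding n_cstar[symmetric] using n_diff[of 1 "w * w"] n_1 n_mult[of w w] by simp
    also have "\<dots> \<le> (1 + n w * n w)\<^sup>2" by (simp add: power2_eq_square algebra_simps)
    finally have "n (1 + w) \<le> 1 + n w * n w" by (rule power2_le_imp_le) simp
    also have "n w = \<bar>t\<bar> * n y" by (simp add: w_def norm_mult)
    finally show ?thesis by (simp add: w_def power2_eq_square mult_ac)
  qed
  \<comment> \<open>The hypotheses cover real directions and selfadjointness gives the imaginary
    ones. A general direction is reached by multiplying the two factors, whose product differs from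
    1 + z y by a second-order term only.\<close>
  have circle: "n (1 + sc z * y) \<le> 1 + D * (cmod z)\<^sup>2" if "cmod z \<le> 1" for z
  proof -
    let ?a = "sc (complex_of_real (Re z))" and ?b = "sc (\<i> * complex_of_real (Im z))"
    have "sc z = ?a + ?b" by (simp add: sc_add[symmetric] complex_eq[symmetric])
    then have "1 + sc z * y = (1 + ?a * y) * (1 + ?b * y) - (?a * y) * (?b * y)"
      by (simp add: distrib_left distrib_right)
    then have "n (1 + sc z * y) \<le> n ((1 + ?a * y) * (1 + ?b * y)) + n ((?a * y) * (?b * y))"
      by (simp only: n_diff)
    also have "\<dots> \<le> (1 + C * (Re z)\<^sup>2) * (1 + (n y)\<^sup>2 * (Im z)\<^sup>2) + (\<bar>Re z\<bar> * n y) * (\<bar>Im z\<bar> * n y)"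
      by (rule add_mono[OF n_mult_mono[OF real imag] n_mult_mono]) (simp_all add: norm_mult)
    also have "\<dots> \<le> (1 + C * (cmod z)\<^sup>2) * (1 + (n y)\<^sup>2 * (cmod z)\<^sup>2) + (cmod z * n y) * (cmod z * n y)"
    proof -
      have "(Re z)\<^sup>2 \<le> (cmod z)\<^sup>2" "(Im z)\<^sup>2 \<le> (cmod z)\<^sup>2" by (simp_all add: cmod_power2)
      then show ?thesis
        using C by (intro add_mono mult_mono mult_left_mono add_left_mono)
          (auto simp: abs_Re_le_cmod abs_Im_le_cmod)
    qed
    also have "\<dots> = 1 + (C + (n y)\<^sup>2 + C * (n y)\<^sup>2 * (cmod z)\<^sup>2 + (n y)\<^sup>2) * (cmod z)\<^sup>2"
      by (simp add: algebra_simps power2_eq_square)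
    also have "\<dots> \<le> 1 + D * (cmod z)\<^sup>2"
    proof -
      have "C * (n y)\<^sup>2 * (cmod z)\<^sup>2 \<le> C * (n y)\<^sup>2 * 1"
        using that C by (intro mult_left_mono) (auto simp: power_le_one)
      then show ?thesis unfolding D_def by (intro add_left_mono mult_right_mono) auto
    qed
    finally show ?thesis .
  qed
  have key: "real L * n y \<le> exp D" if L: "0 < L" for L :: nat
  proof -
    \<comment> \<open>With K = L^2 and t = 1/L one has K t^2 = 1, so the powers stay below exp D,
      while K t = L is as large as desired. N = K + 1 is the least number of roots that the
      averaging admits.\<close>
    let ?K = "L * L" and ?N = "Suc (L * L)" and ?t = "1 / real L"
    let ?\<omega> = "\<lambda>m::nat. cis (2 * pi * real m / real ?N)"
    let ?y = "sc (complex_of_real ?t) * y"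
    have each: "n (sc (inverse (?\<omega> m)) * (1 + sc (?\<omega> m) * ?y) ^ ?K) \<le> exp D" for m
    proof -
      have t: "?t \<le> 1" using L by simp
      have "n (1 + sc (?\<omega> m) * ?y) \<le> 1 + D * ?t\<^sup>2"
        using circle[of "?\<omega> m * complex_of_real ?t"] t by (simp add: sc_sc norm_mult norm_divide)
      then have "n ((1 + sc (?\<omega> m) * ?y) ^ ?K) \<le> (1 + D * ?t\<^sup>2) ^ ?K"
        by (meson n_nonneg n_power order_trans power_mono)
      also have "\<dots> \<le> exp (D * ?t\<^sup>2) ^ ?K"
        using D by (intro power_mono exp_ge_add_one_self) auto
      also have "\<dots> = exp D"
        using L by (simp add: exp_of_nat_mult[symmetric] power2_eq_square)
      finally show ?thesis by (simp add: norm_inverse)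
    qed
    have "real ?N * (real ?K * (?t * n y)) = n (sc (of_nat (?N * ?K)) * ?y)"
      using L by (simp only: n_sc norm_of_nat norm_of_real) (simp add: field_simps)
    also have "\<dots> = n (\<Sum>m<?N. sc (inverse (?\<omega> m)) * (1 + sc (?\<omega> m) * ?y) ^ ?K)"
      by (subst roots_of_unity_average) (use L in auto)
    also have "\<dots> \<le> (\<Sum>m<?N. exp D)"
      by (rule order_trans[OF n_sum sum_mono[OF each]])
    also have "\<dots> = real ?N * exp D" by simp
    finally have "real ?K * (?t * n y) \<le> exp D" by (subst (asm) mult_le_cancel_left_pos) (auto simp: add_pos_nonneg)
    then show ?thesis using L by simp
  qed
  show ?thesis
  proof (rule ccontr)
    assume "n y \<noteq> 0"
    then have "0 < n y" by (simp add: less_le)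
    then obtain L :: nat where "exp D < real L * n y" using reals_Archimedean3 by blast
    with key[of L] show False by (cases "L = 0") (auto simp: not_less[symmetric])
  qed
qed


text \<open>First-order stand-in for the positive cone: a selfadjoint element is positive iff
  \<open>\<parallel>1 - t x\<parallel> \<le> 1 + O(t\<^sup>2)\<close> for \<open>t \<ge> 0\<close>. It is obviously closed under sums, which makes it a
  substitute for spectral theory.\<close>

definition flat_pos :: "'b \<Rightarrow> bool" where
  "flat_pos x \<longleftrightarrow> (\<exists>C\<ge>0. \<forall>t\<ge>0. n (1 - sc (complex_of_real t) * x) \<le> 1 + C * t\<^sup>2)"

lemma flat_pos_square: "st a = a \<Longrightarrow> flat_pos (a * a)"
  unfolding flat_pos_def using n_one_minus_square by (intro exI[of _ "n a ^ 4"]) auto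

text \<open>1 - t(x + y) is the midpoint of 1 - 2t x and 1 - 2t y. Evaluating both bounds at 2t is
  the source of the factor 2 in the constant.\<close>

lemma flat_pos_add:
  assumes "flat_pos x" "flat_pos y"
  shows "flat_pos (x + y)"
proof -
  obtain C D where C: "0 \<le> C" "\<And>t. 0 \<le> t \<Longrightarrow> n (1 - sc (complex_of_real t) * x) \<le> 1 + C * t\<^sup>2"
    and D: "0 \<le> D" "\<And>t. 0 \<le> t \<Longrightarrow> n (1 - sc (complex_of_real t) * y) \<le> 1 + D * t\<^sup>2"
    using assms unfolding flat_pos_def by blast
  have "n (1 - sc (complex_of_real t) * (x + y)) \<le> 1 + (2 * C + 2 * D) * t\<^sup>2" if "0 \<le> t" for t
  proof -
    let ?h = "1 - sc (complex_of_real t) * (x + y)" and ?s = "sc (complex_of_real (2 * t))"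
    have "?s = sc (complex_of_real t) + sc (complex_of_real t)" by (simp add: sc_add[symmetric])
    then have "?h + ?h = (1 - ?s * x) + (1 - ?s * y)" by (simp add: algebra_simps)
    then have "?h = sc (1/2) * ((1 - ?s * x) + (1 - ?s * y))" using sc_half[of ?h] by (simp only:)
    then have "n ?h = 1/2 * n ((1 - ?s * x) + (1 - ?s * y))" using n_sc[of "1/2"] by simp
    also have "\<dots> \<le> 1/2 * ((1 + C * (2 * t)\<^sup>2) + (1 + D * (2 * t)\<^sup>2))"
      using C(2)[of "2 * t"] D(2)[of "2 * t"] that
      by (intro mult_left_mono order_trans[OF n_add] add_mono) auto
    also have "\<dots> = 1 + (2 * C + 2 * D) * t\<^sup>2" by (simp add: power2_eq_square algebra_simps)
    finally show ?thesis .
  qed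
  then show ?thesis unfolding flat_pos_def using C(1) D(1) by (intro exI[of _ "2 * C + 2 * D"]) auto
qed

lemma flat_pos_minus_mult_star:
  assumes "flat_pos (- (st x * x))"
  shows "flat_pos (- (x * st x))"
proof -
  obtain C where C: "0 \<le> C" "\<And>t. 0 \<le> t \<Longrightarrow> n (1 + sc (complex_of_real t) * (st x * x)) \<le> 1 + C * t\<^sup>2"
    using assms unfolding flat_pos_def by auto
  have "n (1 + sc (complex_of_real t) * (x * st x)) \<le> 1 + C * t\<^sup>2" if "0 \<le> t" for t
    using that C(1) by (intro n_one_plus_transfer C(2)) auto
  then show ?thesis unfolding flat_pos_def using C(1) by auto
qed

text \<open>Here \<open>x\<^sup>*x\<close> is minus a square, hence so is \<open>x x\<^sup>*\<close> up to first order, while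
  \<open>x\<^sup>*x + x x\<^sup>*\<close> is a sum of squares; so \<open>x\<^sup>*x\<close> is both positive and negative.\<close>

lemma projection_le_imp_mult:
  assumes p: "st p = p" "p * p = p" and q: "st q = q" "q * q = q" and y: "st y * y = q - p"
  shows "n (q * p - p) = 0"
proof -
  define u where "u = 1 - q"
  have u: "st u = u" "u * u = u" "u * q = 0" "q * u = 0"
    by (simp_all add: u_def q algebra_simps)
  define g where "g = p * u * p"
  have g: "st g = g" by (simp add: g_def p u mult.assoc)
  \<comment> \<open>Compressing \<open>q - p\<close> by u = 1 - q annihilates q and leaves -upu, a
    negative element that ought to be positive. The further compression by p turns
    \<open>st x * x\<close> into exactly -g^2.\<close>
  define x where "x = y * u * p"
  have "st x * x = p * u * (st y * y) * u * p" by (simp add: x_def p u mult.assoc)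
  also have "\<dots> = p * (u * q) * u * p - p * u * p * u * p"
    unfolding y by (simp add: algebra_simps)
  also have "\<dots> = - (p * u * (p * p) * u * p)" by (simp add: u p mult.assoc)
  also have "\<dots> = - (g * g)" by (simp only: g_def mult.assoc)
  finally have xx: "st x * x = - (g * g)" .
  have g2: "flat_pos (g * g)" by (rule flat_pos_square[OF g])
  have neg: "flat_pos (- (x * st x))"
    by (rule flat_pos_minus_mult_star) (simp add: xx g2)
  \<comment> \<open>Up to factors 2 and -2 these are the real and imaginary parts of x. The sum of
    their squares is twice \<open>st x * x + x * st x\<close>, so subtracting
    \<open>x * st x\<close> twice leaves -2 g^2 as a flat positive element.\<close>
  define h where "h = x + st x"
  define k where "k = sc \<i> * (x - st x)"
  have h: "st h = h" by (simp add: h_def add.commute)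
  have k: "st k = k" by (simp add: k_def sc_minus sc_commute algebra_simps)
  have kk: "k * k = - ((x - st x) * (x - st x))" unfolding k_def sc_mult_sc by (simp add: sc_minus)
  have "(h * h + k * k) + (- (x * st x) + - (x * st x)) = st x * x + st x * x"
    unfolding kk h_def by (simp add: algebra_simps)
  moreover have "flat_pos ((h * h + k * k) + (- (x * st x) + - (x * st x)))"
    by (intro flat_pos_add flat_pos_square neg h k)
  ultimately have m: "flat_pos (- (g * g + g * g))" by (simp add: xx)
  have pl: "flat_pos (g * g + g * g)" by (intro flat_pos_add g2)
  obtain C D where C: "0 \<le> C" "\<And>t. 0 \<le> t \<Longrightarrow> n (1 - sc (complex_of_real t) * (g * g + g * g)) \<le> 1 + C * t\<^sup>2"
    and D: "0 \<le> D" "\<And>t. 0 \<le> t \<Longrightarrow> n (1 + sc (complex_of_real t) * (g * g + g * g)) \<le> 1 + D * t\<^sup>2"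
    using m pl unfolding flat_pos_def mult_minus_right diff_minus_eq_add by blast
  have "n (g * g + g * g) = 0"
  proof (rule n_eq_0_of_flat[where C = "C + D"])
    fix t :: real assume t: "0 \<le> t"
    have "C * t\<^sup>2 \<le> (C + D) * t\<^sup>2" "D * t\<^sup>2 \<le> (C + D) * t\<^sup>2"
      using C(1) D(1) by (simp_all add: mult_right_mono)
    with C(2)[OF t] D(2)[OF t]
    show "n (1 + sc (complex_of_real t) * (g * g + g * g)) \<le> 1 + (C + D) * t\<^sup>2"
      "n (1 - sc (complex_of_real t) * (g * g + g * g)) \<le> 1 + (C + D) * t\<^sup>2" by linarith+
  qed (use C(1) D(1) in \<open>simp_all add: g\<close>)
  then have "n (sc (1/2) * (g * g + g * g)) = 0" by simp
  then have "n (st g * g) = 0" unfolding sc_half g .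
  then have "n g = 0" by (simp add: n_cstar)
  \<comment> \<open>The same g is also a square of the form covered by the C*-identity, so
    \<open>n g = 0\<close> forces u p to have norm 0, which is the claim.\<close>
  also have "g = st (u * p) * (u * p)" by (simp add: g_def p u mult.assoc) (metis mult.assoc u(2))
  finally have "n (u * p) = 0" by (simp only: n_cstar) simp
  then show ?thesis unfolding u_def by (simp add: left_diff_distrib n_diff_commute)
qed

end

section \<open>Block diagonal multipliers and the corona norm\<close>

text \<open>The ring models M(A) and \<open>J\<close> models A. \<open>J_essential\<close> says that
  the norm is tested on the unit ball of \<open>J\<close>, as for an operator norm.
  \<open>J_strict\<close> is completeness of bounded sequences in the strict topology, which is what
  an infinite block sum needs.\<close>

locale corona_frame = cstar_seminorm st sc n
  for st :: "'b::{ring,monoid_mult} \<Rightarrow> 'b" and sc :: "complex \<Rightarrow> 'b" and n :: "'b \<Rightarrow> real" +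
  fixes J :: "'b set"
  assumes J_0 [simp]: "0 \<in> J"
    and J_add: "a \<in> J \<Longrightarrow> b \<in> J \<Longrightarrow> a + b \<in> J"
    and J_left: "a \<in> J \<Longrightarrow> x * a \<in> J"
    and J_right: "a \<in> J \<Longrightarrow> a * x \<in> J"
    and J_st: "a \<in> J \<Longrightarrow> st a \<in> J"
    and J_faithful: "a \<in> J \<Longrightarrow> n a = 0 \<Longrightarrow> a = 0"
    and J_essential: "(\<And>a. a \<in> J \<Longrightarrow> n a \<le> 1 \<Longrightarrow> n (x * a) \<le> C) \<Longrightarrow> n x \<le> C"
    and J_strict: "\<lbrakk>\<And>k. n (S k) \<le> C;
      \<And>a \<epsilon>. a \<in> J \<Longrightarrow> 0 < \<epsilon> \<Longrightarrow> \<exists>N. \<forall>i\<ge>N. \<forall>j\<ge>N. n (S i * a - S j * a) < \<epsilon>;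
      \<And>a \<epsilon>. a \<in> J \<Longrightarrow> 0 < \<epsilon> \<Longrightarrow> \<exists>N. \<forall>i\<ge>N. \<forall>j\<ge>N. n (a * S i - a * S j) < \<epsilon>\<rbrakk>
      \<Longrightarrow> \<exists>s. \<forall>a\<in>J. (\<lambda>k. n (S k * a - s * a)) \<longlonglongrightarrow> 0 \<and> (\<lambda>k. n (a * S k - a * s)) \<longlonglongrightarrow> 0"
begin

lemma J_minus: "a \<in> J \<Longrightarrow> - a \<in> J"
  using J_left[of a "sc (- 1)"] by (simp add: sc_minus)

lemma J_diff: "a \<in> J \<Longrightarrow> b \<in> J \<Longrightarrow> a - b \<in> J"
  using J_add[of a "- b"] J_minus[of b] by simp

text \<open>The norm of the image of x in the quotient by \<open>J\<close>; it is identified with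
  \<open>corona_nrm\<close> in the end.\<close>

definition q :: "'b \<Rightarrow> real" where
  "q x = Inf {n (x - a) | a. a \<in> J}"

lemma q_le: "a \<in> J \<Longrightarrow> q x \<le> n (x - a)"
  unfolding q_def by (rule cInf_lower) (auto intro!: bdd_belowI[of _ 0])

lemma q_approx:
  assumes "q x < r"
  obtains a where "a \<in> J" "n (x - a) < r"
proof -
  have "\<exists>y\<in>{n (x - a) | a. a \<in> J}. y < r"
    using assms unfolding q_def by (rule cInf_lessD[rotated]) (auto intro: J_0)
  then show ?thesis using that by auto
qed

lemma q_greatest: "(\<And>a. a \<in> J \<Longrightarrow> r \<le> n (x - a)) \<Longrightarrow> r \<le> q x"
  unfolding q_def by (rule cInf_greatest) (auto intro: J_0)

lemma q_mod_J:
  assumes "x - y \<in> J"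
  shows "q x = q y"
proof -
  have le: "q x \<le> q y" if "x - y \<in> J" for x y
  proof (rule q_greatest)
    fix a assume "a \<in> J"
    then have "q x \<le> n (x - ((x - y) + a))" using that by (intro q_le J_add)
    then show "q x \<le> n (y - a)" by simp
  qed
  show ?thesis using le[OF assms] le[of y x] J_minus[OF assms] by simp
qed

primrec ev :: "(nat \<Rightarrow> 'b) \<Rightarrow> 'b spoly \<Rightarrow> 'b" where
  "ev b (PVar k) = b k"
| "ev b (PConst c) = c"
| "ev b (PAdd P Q) = ev b P + ev b Q"
| "ev b (PMult P Q) = ev b P * ev b Q"
| "ev b (PScal z P) = sc z * ev b P"
| "ev b (PStar P) = st (ev b P)"

lemma ev_mod_J:
  assumes "\<And>k. b k - b' k \<in> J"
  shows "ev b P - ev b' P \<in> J"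
proof (induction P)
  case (PAdd P Q)
  have "ev b (PAdd P Q) - ev b' (PAdd P Q) = (ev b P - ev b' P) + (ev b Q - ev b' Q)" by simp
  with PAdd show ?case by (simp only: J_add)
next
  case (PMult P Q)
  have "ev b (PMult P Q) - ev b' (PMult P Q) = (ev b P - ev b' P) * ev b Q + ev b' P * (ev b Q - ev b' Q)"
    by (simp add: algebra_simps)
  with PMult show ?case by (simp only: J_add J_left J_right)
next
  case (PScal z P)
  then show ?case by (simp add: right_diff_distrib[symmetric] J_left)
next
  case (PStar P)
  then show ?case using J_st by (simp flip: st_diff)
qed (simp_all add: assms)

end

section \<open>Corners and segments of an approximate unit of projections\<close>

locale projection_unit = corona_frame st sc n J
  for st :: "'b::{ring,monoid_mult} \<Rightarrow> 'b" and sc n J +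
  fixes e :: "nat \<Rightarrow> 'b"
  assumes e_J: "e k \<in> J"
    and e_st [simp]: "st (e k) = e k"
    and e_idem [simp]: "e k * e k = e k"
    and e_le: "\<exists>y. st y * y = e (Suc k) - e k"
    and e_unit: "a \<in> J \<Longrightarrow> (\<lambda>k. n (e k * a - a)) \<longlonglongrightarrow> 0"
begin

lemma e_unit_right: "a \<in> J \<Longrightarrow> (\<lambda>k. n (a * e k - a)) \<longlonglongrightarrow> 0"
  using e_unit[OF J_st, of a] n_st[of "a * e k - a" for k] by simp

text \<open>For neighbours, \<open>projection_le_imp_mult\<close> only gives a difference of norm 0.
  The difference lies in \<open>J\<close>, so \<open>J_faithful\<close> makes it an equation;
  induction and adjoints give the rest.\<close>

lemma e_absorb:
  assumes "i \<le> j"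
  shows "e j * e i = e i" "e i * e j = e i"
proof -
  have step: "e (Suc k) * e k = e k" for k
  proof -
    obtain y where "st y * y = e (Suc k) - e k" using e_le by blast
    then have "n (e (Suc k) * e k - e k) = 0" by (intro projection_le_imp_mult) simp_all
    then have "e (Suc k) * e k - e k = 0" by (intro J_faithful J_diff J_left e_J)
    then show ?thesis by simp
  qed
  show l: "e j * e i = e i"
    using assms
  proof (induction j rule: dec_induct)
    case (step k)
    have "e (Suc k) * e i = (e (Suc k) * e k) * e i" by (simp add: step mult.assoc)
    then show ?case by (simp add: \<open>\<And>k. e (Suc k) * e k = e k\<close> step)
  qed simp
  show "e i * e j = e i" using arg_cong[OF l, of st] by simp
qed

abbreviation u :: "nat \<Rightarrow> 'b" where "u k \<equiv> 1 - e k"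

lemma n_u: "n (u k) \<le> 1"
  by (rule n_projection) (simp_all add: algebra_simps)

lemma n_e: "n (e k) \<le> 1"
  by (rule n_projection) simp_all

lemma n_contract: "n f \<le> 1 \<Longrightarrow> n g \<le> 1 \<Longrightarrow> n (f * x * g) \<le> n x"
  using n_mult_mono[OF n_mult_mono[of f 1 x "n x"], of g 1] by simp

lemma n_contract_left: "n f \<le> 1 \<Longrightarrow> n (f * x) \<le> n x"
  using n_mult_mono[of f 1 x "n x"] by simp

lemma n_contract_right: "n f \<le> 1 \<Longrightarrow> n (x * f) \<le> n x"
  using n_mult_mono[of x "n x" f 1] by simp

lemma n_segment: "k \<le> l \<Longrightarrow> n (e l - e k) \<le> 1"
  by (rule n_projection) (simp_all add: algebra_simps e_absorb)

lemma q_le_corner: "q x \<le> n (u k * x * u k)"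
proof -
  have "x - u k * x * u k = e k * x + (x - e k * x) * e k" by (simp add: algebra_simps)
  then have "x - u k * x * u k \<in> J" by (simp only: J_add J_left J_right e_J)
  from q_le[OF this, of x] show ?thesis by simp
qed

text \<open>An element a of \<open>J\<close> that nearly attains the infimum is asymptotically
  annihilated by \<open>u k\<close>. Together with \<open>q_le_corner\<close> this shows that the
  corner norms converge to \<open>q x\<close>.\<close>

lemma corner_le_q:
  assumes "q x < r"
  shows "\<forall>\<^sub>F k in sequentially. n (u k * x * u k) \<le> r"
proof -
  obtain a where a: "a \<in> J" "n (x - a) < r" using q_approx[OF assms] .
  have "\<forall>\<^sub>F k in sequentially. n (e k * a - a) < r - n (x - a)"
    using e_unit[OF a(1)] a(2) by (intro order_tendstoD(2)) auto
  then show ?thesis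
  proof eventually_elim
    case (elim k)
    have "u k * x * u k = u k * (x - a) * u k + (u k * a) * u k" by (simp add: algebra_simps)
    then have "n (u k * x * u k) \<le> n (u k * (x - a) * u k) + n ((u k * a) * u k)"
      by (simp only: n_add)
    also have "\<dots> \<le> n (x - a) + n (u k * a)"
      by (intro add_mono n_contract n_contract_right n_u)
    also have "n (u k * a) = n (e k * a - a)"
      by (simp add: left_diff_distrib n_diff_commute)
    finally show ?case using elim by simp
  qed
qed

lemma segment_mono:
  assumes "k \<le> l" "l \<le> l'"
  shows "n ((e l - e k) * x * (e l - e k)) \<le> n ((e l' - e k) * x * (e l' - e k))"
proof -
  have "(e l - e k) * (e l' - e k) = e l - e k" "(e l' - e k) * (e l - e k) = e l - e k"
    using assms by (simp_all add: algebra_simps e_absorb)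
  then have "(e l - e k) * x * (e l - e k)
      = (e l - e k) * ((e l' - e k) * x * (e l' - e k)) * (e l - e k)"
    by (metis mult.assoc)
  then show ?thesis using n_contract n_segment[OF assms(1)] by metis
qed

text \<open>The corner need not lie in \<open>J\<close>, but \<open>J_essential\<close> tests it on
  elements a of \<open>J\<close>. There it is the limit of its compressions by \<open>e l\<close>,
  and these are the segments.\<close>

lemma corner_le_segments:
  assumes C: "\<And>l. k \<le> l \<Longrightarrow> n ((e l - e k) * x * (e l - e k)) \<le> C"
  shows "n (u k * x * u k) \<le> C"
proof (rule J_essential)
  fix a assume a: "a \<in> J" "n a \<le> 1"
  define z where "z = u k * x * u k"
  have bound: "n (z * a) \<le> C + (n z * n (e l * a - a) + n (e l * (z * a) - z * a))" if l: "k \<le> l" for l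
  proof -
    have eu: "e l * u k = e l - e k" "u k * e l = e l - e k"
      using l by (simp_all add: algebra_simps e_absorb)
    have "e l * z * e l = (e l - e k) * x * (e l - e k)"
      unfolding z_def by (metis eu mult.assoc)
    then have 1: "n ((e l * z * e l) * a) \<le> C * 1"
      using C[OF l] a by (intro n_mult_mono) auto
    have "z * a = (e l * z * e l) * a - (e l * z * (e l * a - a) + (e l * (z * a) - z * a))"
      by (simp add: algebra_simps)
    then have "n (z * a) \<le> n ((e l * z * e l) * a) + n (e l * z * (e l * a - a) + (e l * (z * a) - z * a))"
      by (metis n_diff)
    also have "n (e l * z * (e l * a - a) + (e l * (z * a) - z * a))
        \<le> n (e l * z * (e l * a - a)) + n (e l * (z * a) - z * a)" by (rule n_add)
    also have "n (e l * z * (e l * a - a)) \<le> n z * n (e l * a - a)"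
      by (intro n_mult_mono n_contract_left n_e order_refl)
    finally show ?thesis using 1 by simp
  qed
  have "(\<lambda>l. C + (n z * n (e l * a - a) + n (e l * (z * a) - z * a))) \<longlonglongrightarrow> C + (n z * 0 + 0)"
    by (intro tendsto_intros e_unit a J_left)
  then have "n (z * a) \<le> C + (n z * 0 + 0)"
    by (rule LIMSEQ_le_const) (use bound in blast)
  then show "n (u k * x * u k * a) \<le> C" by (simp add: z_def)
qed

lemma corner_approx_segment:
  assumes "0 < \<epsilon>"
  shows "\<exists>L\<ge>k. \<forall>l\<ge>L. n (u k * x * u k) - \<epsilon> \<le> n ((e l - e k) * x * (e l - e k))"
proof (rule ccontr)
  assume neg: "\<not> ?thesis"
  \<comment> \<open>Segment norms increase with l, so failures at arbitrarily large indices bound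
    every segment, and then the corner too.\<close>
  have "n ((e l - e k) * x * (e l - e k)) \<le> n (u k * x * u k) - \<epsilon>" if l: "k \<le> l" for l
  proof -
    obtain l' where "l' \<ge> l" "n ((e l' - e k) * x * (e l' - e k)) < n (u k * x * u k) - \<epsilon>"
      using neg l unfolding not_le[symmetric] by blast
    with segment_mono[OF l, of l' x] show ?thesis by simp
  qed
  from corner_le_segments[OF this] assms show False by simp
qed

end

section \<open>Orthogonal blocks and block diagonal sums\<close>

locale blocks = projection_unit st sc n J e
  for st :: "'b::{ring,monoid_mult} \<Rightarrow> 'b" and sc n J e +
  fixes \<kappa> :: "nat \<Rightarrow> nat"
  assumes \<kappa>: "strict_mono \<kappa>"
begin

definition f :: "nat \<Rightarrow> 'b" where "f m = e (\<kappa> (Suc m)) - e (\<kappa> m)"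

lemma \<kappa>_le: "i \<le> j \<Longrightarrow> \<kappa> i \<le> \<kappa> j"
  using \<kappa> by (simp add: strict_mono_less_eq)

lemma f_J: "f m \<in> J" by (simp add: f_def J_diff e_J)

lemma f_st [simp]: "st (f m) = f m" by (simp add: f_def)

lemma f_idem [simp]: "f m * f m = f m"
  by (simp add: f_def algebra_simps e_absorb \<kappa>_le)

lemma e_f: "M \<le> m \<Longrightarrow> e (\<kappa> M) * f m = 0" "M \<le> m \<Longrightarrow> f m * e (\<kappa> M) = 0"
  by (simp_all add: f_def algebra_simps e_absorb \<kappa>_le)

lemma f_orth: "i \<noteq> j \<Longrightarrow> f i * f j = 0"
proof (induction i j rule: linorder_wlog)
  case (le i j)
  then show ?case using e_f(1)[of i j] e_f(1)[of "Suc i" j] by (simp add: f_def[of i] left_diff_distrib)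
next
  case (sym i j)
  then have "st (f j * f i) = 0" by simp
  then show ?case by simp
qed

lemma n_f: "n (f m) \<le> 1"
  by (rule n_projection) simp_all

lemma sum_f: "a \<le> b \<Longrightarrow> (\<Sum>m=a..<b. f m) = e (\<kappa> b) - e (\<kappa> a)"
  by (induction b rule: dec_induct) (simp_all add: f_def)

text \<open>Adding a block to an orthogonal sum leaves the common bound unchanged by
  \<open>n_add_orthogonal\<close>, so C does not depend on the size of \<open>I\<close>.\<close>

lemma n_block_sum:
  assumes "\<And>m. m \<in> I \<Longrightarrow> n (f m * X m * f m) \<le> C" "0 \<le> C" "finite I"
  shows "n (\<Sum>m\<in>I. f m * X m * f m) \<le> C"
  using assms(3,1)
proof (induction I)
  case (insert i I)
  define S where "S = (\<Sum>m\<in>I. f m * X m * f m)"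
  have "st S * (f i * X i * f i) = 0"
  proof -
    have "f m * (f i * X i * f i) = 0" if "m \<in> I" for m
      using insert(2) that f_orth[of m i] by (metis mult.assoc mult_zero_left)
    moreover have "st S = (\<Sum>m\<in>I. f m * st (X m) * f m)"
      unfolding S_def by (induction I rule: infinite_finite_induct) (simp_all add: mult.assoc)
    ultimately show ?thesis by (simp add: sum_distrib_right mult.assoc)
  qed
  moreover have "S * st (f i * X i * f i) = 0"
  proof -
    have "f m * st (f i * X i * f i) = 0" if "m \<in> I" for m
      using insert(2) that f_orth[of m i] by (simp add: mult.assoc[symmetric])
        (metis mult_zero_left)
    then show ?thesis by (simp add: S_def sum_distrib_right mult.assoc)
  qed
  ultimately have "n (S + f i * X i * f i) \<le> C"
    using insert by (intro n_add_orthogonal) (simp_all add: S_def)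
  then show ?case using insert by (simp add: S_def add.commute)
qed (simp add: assms)

text \<open>The partial sums are bounded by \<open>n_block_sum\<close>. Multiplied by
  \<open>e (\<kappa> M)\<close> they no longer change from M on, and \<open>e (\<kappa> M)\<close>
  nearly fixes a given element of \<open>J\<close>; so they are strictly Cauchy. The equations pass
  to the limit because \<open>S k * f m\<close> is constant for k > m and the difference lies in
  \<open>J\<close>.\<close>

lemma block_diagonal_exists:
  assumes C: "\<And>m. n (X m) \<le> C"
  shows "\<exists>s. \<forall>m. f m * s = f m * X m * f m \<and> s * f m = f m * X m * f m"
proof -
  have C0: "0 \<le> C" using C[of 0] n_nonneg[of "X 0"] by linarith
  define S where "S N = (\<Sum>m<N. f m * X m * f m)" for N
  have nS: "n (S N) \<le> C" for N
    unfolding S_def by (rule n_block_sum) (use C C0 n_contract n_f order_trans in blast)+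
  have S_tail: "(S i - S M) * e (\<kappa> M) = 0" "e (\<kappa> M) * (S i - S M) = 0" if "M \<le> i" for i M
  proof -
    have "S i - S M = (\<Sum>m=M..<i. f m * X m * f m)"
      using that unfolding S_def by (simp add: sum_diff_nat_ivl lessThan_atLeast0)
    then show "(S i - S M) * e (\<kappa> M) = 0" "e (\<kappa> M) * (S i - S M) = 0"
      by (auto simp: sum_distrib_left sum_distrib_right mult.assoc e_f intro!: sum.neutral)
        (metis e_f(1) mult.assoc mult_zero_left)
  qed
  have S_eq: "(S i - S j) * e (\<kappa> M) = 0" "e (\<kappa> M) * (S i - S j) = 0" if "M \<le> i" "M \<le> j" for i j M
    using S_tail[OF that(1)] S_tail[OF that(2)] by (simp_all add: algebra_simps)
  have nS2: "n (S i - S j) \<le> 2 * C" for i j using n_diff[of "S i" "S j"] nS[of i] nS[of j] by linarith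
  have "filterlim \<kappa> sequentially sequentially" using \<kappa> by (rule filterlim_subseq)
  then have lim: "(\<lambda>M. 2 * C * n (e (\<kappa> M) * a - a)) \<longlonglongrightarrow> 2 * C * 0"
    "(\<lambda>M. 2 * C * n (a * e (\<kappa> M) - a)) \<longlonglongrightarrow> 2 * C * 0" if "a \<in> J" for a
    by (intro tendsto_intros filterlim_compose[OF e_unit[OF that]]
        filterlim_compose[OF e_unit_right[OF that]]; assumption)+
  have "\<exists>s. \<forall>a\<in>J. (\<lambda>k. n (S k * a - s * a)) \<longlonglongrightarrow> 0 \<and> (\<lambda>k. n (a * S k - a * s)) \<longlonglongrightarrow> 0"
  proof (rule J_strict[OF nS])
    fix a and \<epsilon> :: real assume a: "a \<in> J" and \<epsilon>: "0 < \<epsilon>"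
    obtain M where M: "2 * C * n (e (\<kappa> M) * a - a) < \<epsilon>"
      using order_tendstoD(2)[OF lim(1)[OF a], of \<epsilon>] \<epsilon> by (auto simp: eventually_sequentially)
    have "n (S i * a - S j * a) < \<epsilon>" if "M \<le> i" "M \<le> j" for i j
    proof -
      have "S i * a - S j * a = (S i - S j) * e (\<kappa> M) * a - (S i - S j) * (e (\<kappa> M) * a - a)"
        by (simp add: algebra_simps)
      then have "n (S i * a - S j * a) = n ((S i - S j) * (e (\<kappa> M) * a - a))"
        unfolding S_eq[OF that] by simp
      also have "\<dots> \<le> 2 * C * n (e (\<kappa> M) * a - a)" by (intro n_mult_mono nS2 order_refl)
      finally show ?thesis using M by simp
    qed
    then show "\<exists>N. \<forall>i\<ge>N. \<forall>j\<ge>N. n (S i * a - S j * a) < \<epsilon>" by blast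
  next
    fix a and \<epsilon> :: real assume a: "a \<in> J" and \<epsilon>: "0 < \<epsilon>"
    obtain M where M: "2 * C * n (a * e (\<kappa> M) - a) < \<epsilon>"
      using order_tendstoD(2)[OF lim(2)[OF a], of \<epsilon>] \<epsilon> by (auto simp: eventually_sequentially)
    have "n (a * S i - a * S j) < \<epsilon>" if "M \<le> i" "M \<le> j" for i j
    proof -
      have "a * S i - a * S j = a * (e (\<kappa> M) * (S i - S j)) - (a * e (\<kappa> M) - a) * (S i - S j)"
        by (simp add: algebra_simps)
      then have "n (a * S i - a * S j) = n ((a * e (\<kappa> M) - a) * (S i - S j))"
        unfolding S_eq[OF that] by simp
      also have "\<dots> \<le> n (a * e (\<kappa> M) - a) * (2 * C)" by (intro n_mult_mono nS2 order_refl)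
      finally show ?thesis using M by (simp add: mult.commute)
    qed
    then show "\<exists>N. \<forall>i\<ge>N. \<forall>j\<ge>N. n (a * S i - a * S j) < \<epsilon>" by blast
  qed
  then obtain s where s: "\<And>a. a \<in> J \<Longrightarrow> (\<lambda>k. n (S k * a - s * a)) \<longlonglongrightarrow> 0"
    "\<And>a. a \<in> J \<Longrightarrow> (\<lambda>k. n (a * S k - a * s)) \<longlonglongrightarrow> 0" by blast
  have "f m * s = f m * X m * f m \<and> s * f m = f m * X m * f m" for m
  proof -
    have Sf: "S k * f m = f m * X m * f m" "f m * S k = f m * X m * f m" if "k > m" for k
    proof -
      have "f i * X i * f i * f m = (if i = m then f m * X m * f m else 0)" for i
        using f_orth[of i m] by (auto simp: mult.assoc)
      then show "S k * f m = f m * X m * f m" using that by (simp add: S_def sum_distrib_right)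
      have "f m * (f i * X i * f i) = (if i = m then f m * X m * f m else 0)" for i
        using f_orth[of m i] by (auto simp: mult.assoc[symmetric])
      then show "f m * S k = f m * X m * f m" using that by (simp add: S_def sum_distrib_left)
    qed
    have "(\<lambda>k. n (f m * X m * f m - s * f m)) \<longlonglongrightarrow> 0"
      using s(1)[OF f_J[of m]] by (rule Lim_transform_eventually)
        (use Sf in \<open>auto simp: eventually_sequentially intro!: exI[of _ "Suc m"]\<close>)
    then have "n (f m * X m * f m - s * f m) = 0" by (simp add: LIMSEQ_const_iff)
    then have 1: "f m * X m * f m - s * f m = 0" by (intro J_faithful J_diff J_left f_J)
    have "(\<lambda>k. n (f m * X m * f m - f m * s)) \<longlonglongrightarrow> 0"
      using s(2)[OF f_J[of m]] by (rule Lim_transform_eventually)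
        (use Sf in \<open>auto simp: eventually_sequentially intro!: exI[of _ "Suc m"]\<close>)
    then have "n (f m * X m * f m - f m * s) = 0" by (simp add: LIMSEQ_const_iff)
    then have "f m * X m * f m - f m * s = 0" by (intro J_faithful J_diff J_left J_right f_J)
    with 1 show ?thesis by simp
  qed
  then show ?thesis by blast
qed

text \<open>On a segment g made of blocks, \<open>g * x * g\<close> is the block diagonal part plus
  the terms \<open>f m * x * (g - f m)\<close>. Since \<open>f m\<close> kills
  \<open>g - f m\<close>, each of these contains the commutator of \<open>f m\<close> and x, and
  their norms sum to at most 2 C (1/2)^a. Starting the segment later makes this arbitrarily
  small.\<close>

lemma q_le_blocks:
  assumes comm: "\<And>m. n (f m * x - x * f m) \<le> C * (1/2)^m"
    and blk: "\<And>m. m \<ge> m0 \<Longrightarrow> n (f m * x * f m) \<le> \<rho>"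
  shows "q x \<le> \<rho>"
proof -
  have C0: "0 \<le> C" using order_trans[OF n_nonneg comm[of 0]] by simp
  have \<rho>0: "0 \<le> \<rho>" using blk[OF order_refl] n_nonneg order_trans by blast
  have bound: "q x \<le> \<rho> + 2 * C * (1/2)^a" if a: "m0 \<le> a" for a
  proof (rule order_trans[OF q_le_corner corner_le_segments])
    fix l assume l: "\<kappa> a \<le> l"
    \<comment> \<open>An index b with a <= b and l <= b <= \<open>\<kappa> b\<close>: the blocks
      from a to b then cover the segment that ends at l.\<close>
    define b where "b = max a l"
    have "l \<le> \<kappa> b" using seq_suble[OF \<kappa>, of b] by (simp add: b_def)
    have ab: "a \<le> b" by (simp add: b_def)
    define g where "g = e (\<kappa> b) - e (\<kappa> a)"
    have g: "g = (\<Sum>m=a..<b. f m)" using sum_f[OF ab] by (simp add: g_def)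
    have fg: "f m * g = f m" if "m \<in> {a..<b}" for m
    proof -
      have "f m * g = (\<Sum>i=a..<b. if i = m then f m else 0)"
        unfolding g sum_distrib_left using f_orth[of m] by (intro sum.cong) auto
      then show ?thesis using that by simp
    qed
    have ng: "n g \<le> 1" unfolding g_def by (rule n_segment) (simp add: \<kappa>_le ab)
    have "g * x * g = (\<Sum>m=a..<b. f m * x * g)" by (simp add: g sum_distrib_right)
    also have "\<dots> = (\<Sum>m=a..<b. f m * x * f m + f m * (f m * x - x * f m) * (g - f m))"
    proof (rule sum.cong)
      fix m assume "m \<in> {a..<b}"
      then have z: "f m * (g - f m) = 0" by (simp add: right_diff_distrib fg)
      have "f m * (f m * x - x * f m) * h = f m * f m * x * h - f m * x * (f m * h)" for h
        by (simp only: left_diff_distrib right_diff_distrib mult.assoc)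
      then have "f m * (f m * x - x * f m) * (g - f m) = f m * f m * x * (g - f m) - f m * x * (f m * (g - f m))" .
      also have "\<dots> = f m * x * g - f m * x * f m" unfolding z by (simp add: right_diff_distrib)
      finally show "f m * x * g = f m * x * f m + f m * (f m * x - x * f m) * (g - f m)" by simp
    qed simp
    finally have "n (g * x * g) \<le> n (\<Sum>m=a..<b. f m * x * f m)
        + n (\<Sum>m=a..<b. f m * (f m * x - x * f m) * (g - f m))"
      by (simp add: sum.distrib n_add)
    also have "n (\<Sum>m=a..<b. f m * x * f m) \<le> \<rho>"
      by (rule n_block_sum) (use a blk \<rho>0 in auto)
    also have "n (\<Sum>m=a..<b. f m * (f m * x - x * f m) * (g - f m)) \<le> (\<Sum>m=a..<b. C * (1/2)^m)"
    proof (rule order_trans[OF n_sum sum_mono])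
      fix m assume m: "m \<in> {a..<b}"
      have gf: "g * f m = f m" using arg_cong[OF fg[OF m], of st] by (simp add: g_def)
      have "n (g - f m) \<le> 1"
        by (rule n_projection) (simp_all add: algebra_simps fg[OF m] gf,
          simp_all add: g_def algebra_simps e_absorb \<kappa>_le ab)
      then have "n (f m * (f m * x - x * f m) * (g - f m)) \<le> n (f m * x - x * f m)"
        by (intro n_contract n_f)
      also note comm
      finally show "n (f m * (f m * x - x * f m) * (g - f m)) \<le> C * (1/2)^m" .
    qed
    also have "\<dots> \<le> 2 * C * (1/2)^a"
    proof -
      have "(\<Sum>m=a..<b. (1/2::real)^m) = 2 * (1/2)^a - 2 * (1/2)^b"
        using ab by (induction b rule: dec_induct) simp_all
      then have "(\<Sum>m=a..<b. C * (1/2)^m) = C * (2 * (1/2)^a - 2 * (1/2)^b)"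
        by (simp add: sum_distrib_left[symmetric])
      also have "\<dots> \<le> C * (2 * (1/2)^a)" using C0 by (intro mult_left_mono) auto
      finally show ?thesis by (simp add: mult_ac)
    qed
    finally have "n (g * x * g) \<le> \<rho> + 2 * C * (1/2)^a" by simp
    moreover have "n ((e l - e (\<kappa> a)) * x * (e l - e (\<kappa> a))) \<le> n (g * x * g)"
      unfolding g_def using l \<open>l \<le> \<kappa> b\<close> by (rule segment_mono)
    ultimately show "n ((e l - e (\<kappa> a)) * x * (e l - e (\<kappa> a))) \<le> \<rho> + 2 * C * (1/2)^a" by simp
  qed
  have "(\<lambda>a. \<rho> + 2 * C * (1/2)^a) \<longlonglongrightarrow> \<rho> + 2 * C * 0"
    by (intro tendsto_intros LIMSEQ_power_zero) simp
  then have "q x \<le> \<rho> + 2 * C * 0"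
    by (rule LIMSEQ_le_const) (use bound in blast)
  then show ?thesis by simp
qed

text \<open>Block m lies under the corner at \<open>\<kappa> m\<close>, so the corner estimate
  passes to it. With \<open>q_le_blocks\<close> this identifies \<open>q x\<close> as the limit
  superior of the block norms when the commutators with the blocks decay like (1/2)^m.\<close>

lemma blocks_le_q:
  assumes "q x < r"
  shows "\<forall>\<^sub>F m in sequentially. n (f m * x * f m) \<le> r"
proof -
  have "filterlim \<kappa> sequentially sequentially" using \<kappa> by (rule filterlim_subseq)
  from eventually_compose_filterlim[OF corner_le_q[OF assms] this] show ?thesis
  proof eventually_elim
    case (elim m)
    have "f m * u (\<kappa> m) = f m" "u (\<kappa> m) * f m = f m"
      by (simp_all add: algebra_simps e_f)
    then have "f m * x * f m = f m * (u (\<kappa> m) * x * u (\<kappa> m)) * f m" by (metis mult.assoc)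
    then have "n (f m * x * f m) \<le> n (u (\<kappa> m) * x * u (\<kappa> m))" by (metis n_contract n_f)
    with elim show ?case by simp
  qed
qed

end

section \<open>Elements approximated block by block, and polynomials in them\<close>

context blocks
begin

text \<open>On block m, x acts like \<open>X m\<close> up to a geometric error. The constant is
  existential so that the relation is stable under all *-polynomials. Both sides are required
  because the involution exchanges them, and the commutator condition lets products move
  \<open>X m\<close> past \<open>f m\<close>.\<close>

definition follows :: "'b \<Rightarrow> (nat \<Rightarrow> 'b) \<Rightarrow> bool" where
  "follows x X \<longleftrightarrow> (\<exists>C. \<forall>m. n (X m) \<le> C \<and> n (f m * x - f m * X m) \<le> C * (1/2)^m \<and>
     n (x * f m - X m * f m) \<le> C * (1/2)^m \<and> n (f m * X m - X m * f m) \<le> C * (1/2)^m)"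

lemma followsI:
  assumes "\<And>m. n (X m) \<le> C0" "\<And>m. n (f m * x - f m * X m) \<le> C1 * (1/2)^m"
    "\<And>m. n (x * f m - X m * f m) \<le> C2 * (1/2)^m" "\<And>m. n (f m * X m - X m * f m) \<le> C3 * (1/2)^m"
  shows "follows x X"
  unfolding follows_def
proof (intro exI allI conjI)
  fix m
  let ?C = "max (max C0 C1) (max C2 C3)"
  have le: "C1 * (1/2)^m \<le> ?C * (1/2)^m" "C2 * (1/2)^m \<le> ?C * (1/2)^m" "C3 * (1/2)^m \<le> ?C * (1/2)^m"
    by (intro mult_right_mono; simp)+
  show "n (X m) \<le> ?C" using assms(1)[of m] by simp
  show "n (f m * x - f m * X m) \<le> ?C * (1/2)^m" using assms(2) le(1) order_trans by blast
  show "n (x * f m - X m * f m) \<le> ?C * (1/2)^m" using assms(3) le(2) order_trans by blast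
  show "n (f m * X m - X m * f m) \<le> ?C * (1/2)^m" using assms(4) le(3) order_trans by blast
qed

lemma followsE:
  assumes "follows x X"
  obtains C where "0 \<le> C" "\<And>m. n (X m) \<le> C" "\<And>m. n (f m * x - f m * X m) \<le> C * (1/2)^m"
    "\<And>m. n (x * f m - X m * f m) \<le> C * (1/2)^m" "\<And>m. n (f m * X m - X m * f m) \<le> C * (1/2)^m"
proof -
  obtain C where C: "\<forall>m. n (X m) \<le> C \<and> n (f m * x - f m * X m) \<le> C * (1/2)^m \<and>
     n (x * f m - X m * f m) \<le> C * (1/2)^m \<and> n (f m * X m - X m * f m) \<le> C * (1/2)^m"
    using assms unfolding follows_def by blast
  then have "n (X 0) \<le> C" by blast
  from order_trans[OF n_nonneg this] C show ?thesis by (intro that[of C]) blast+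
qed

lemma follows_add:
  assumes "follows x X" "follows y Y"
  shows "follows (x + y) (\<lambda>m. X m + Y m)"
proof -
  obtain C where C: "0 \<le> C" "\<And>m. n (X m) \<le> C" "\<And>m. n (f m * x - f m * X m) \<le> C * (1/2)^m"
    "\<And>m. n (x * f m - X m * f m) \<le> C * (1/2)^m" "\<And>m. n (f m * X m - X m * f m) \<le> C * (1/2)^m"
    by (rule followsE[OF assms(1)]) (rule that)
  obtain D where D: "0 \<le> D" "\<And>m. n (Y m) \<le> D" "\<And>m. n (f m * y - f m * Y m) \<le> D * (1/2)^m"
    "\<And>m. n (y * f m - Y m * f m) \<le> D * (1/2)^m" "\<And>m. n (f m * Y m - Y m * f m) \<le> D * (1/2)^m"
    by (rule followsE[OF assms(2)]) (rule that)
  have add: "n (a + b) \<le> (C + D) * (1/2)^m" if "n a \<le> C * (1/2)^m" "n b \<le> D * (1/2)^m" for a b m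
    using order_trans[OF n_add add_mono[OF that]] by (simp add: distrib_right)
  show ?thesis
  proof (rule followsI)
    fix m
    show "n (X m + Y m) \<le> C + D" by (rule order_trans[OF n_add add_mono[OF C(2) D(2)]])
    have "f m * (x + y) - f m * (X m + Y m) = (f m * x - f m * X m) + (f m * y - f m * Y m)"
      by (simp add: algebra_simps)
    then show "n (f m * (x + y) - f m * (X m + Y m)) \<le> (C + D) * (1/2)^m"
      using add[OF C(3) D(3)] by simp
    have "(x + y) * f m - (X m + Y m) * f m = (x * f m - X m * f m) + (y * f m - Y m * f m)"
      by (simp add: algebra_simps)
    then show "n ((x + y) * f m - (X m + Y m) * f m) \<le> (C + D) * (1/2)^m"
      using add[OF C(4) D(4)] by simp
    have "f m * (X m + Y m) - (X m + Y m) * f m = (f m * X m - X m * f m) + (f m * Y m - Y m * f m)"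
      by (simp add: algebra_simps)
    then show "n (f m * (X m + Y m) - (X m + Y m) * f m) \<le> (C + D) * (1/2)^m"
      using add[OF C(5) D(5)] by simp
  qed
qed

lemma follows_mult:
  assumes "follows x X" "follows y Y"
  shows "follows (x * y) (\<lambda>m. X m * Y m)"
proof -
  obtain C where C: "0 \<le> C" "\<And>m. n (X m) \<le> C" "\<And>m. n (f m * x - f m * X m) \<le> C * (1/2)^m"
    "\<And>m. n (x * f m - X m * f m) \<le> C * (1/2)^m" "\<And>m. n (f m * X m - X m * f m) \<le> C * (1/2)^m"
    by (rule followsE[OF assms(1)]) (rule that)
  obtain D where D: "0 \<le> D" "\<And>m. n (Y m) \<le> D" "\<And>m. n (f m * y - f m * Y m) \<le> D * (1/2)^m"
    "\<And>m. n (y * f m - Y m * f m) \<le> D * (1/2)^m" "\<And>m. n (f m * Y m - Y m * f m) \<le> D * (1/2)^m"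
    by (rule followsE[OF assms(2)]) (rule that)
  have C5': "n (X m * f m - f m * X m) \<le> C * (1/2)^m" and D5': "n (Y m * f m - f m * Y m) \<le> D * (1/2)^m" for m
    using C(5)[of m] D(5)[of m] by (simp_all add: n_diff_commute)
  have add4: "n (a + b + c + d) \<le> \<alpha> + \<beta> + \<gamma> + \<delta>"
    if "n a \<le> \<alpha>" "n b \<le> \<beta>" "n c \<le> \<gamma>" "n d \<le> \<delta>" for a b c d \<alpha> \<beta> \<gamma> \<delta>
    using n_add[of "a + b + c" d] n_add[of "a + b" c] n_add[of a b] that by linarith
  show ?thesis
  proof (rule followsI)
    fix m
    show "n (X m * Y m) \<le> C * D" by (rule n_mult_mono[OF C(2) D(2)])
    \<comment> \<open>The telescope runs f x y, f X y, X f y, X f Y, f X Y: the projection moves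
      across X to reach y and then moves back. The right-hand version below is the mirror
      image.\<close>
    have "f m * (x * y) - f m * (X m * Y m) = (f m * x - f m * X m) * y + (f m * X m - X m * f m) * y
        + X m * (f m * y - f m * Y m) + (X m * f m - f m * X m) * Y m"
      by (simp add: algebra_simps)
    then have "n (f m * (x * y) - f m * (X m * Y m))
        \<le> (C * (1/2)^m) * n y + (C * (1/2)^m) * n y + C * (D * (1/2)^m) + (C * (1/2)^m) * D"
      by (simp only:) (intro add4 n_mult_mono C D C5' order_refl)
    then show "n (f m * (x * y) - f m * (X m * Y m)) \<le> (C * n y + C * n y + C * D + C * D) * (1/2)^m"
      by (simp add: algebra_simps)
    have "x * y * f m - X m * Y m * f m = x * (y * f m - Y m * f m) + x * (Y m * f m - f m * Y m)
        + (x * f m - X m * f m) * Y m + X m * (f m * Y m - Y m * f m)"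
      by (simp add: algebra_simps)
    then have "n (x * y * f m - X m * Y m * f m)
        \<le> n x * (D * (1/2)^m) + n x * (D * (1/2)^m) + (C * (1/2)^m) * D + C * (D * (1/2)^m)"
      by (simp only:) (intro add4 n_mult_mono C D D5' order_refl)
    then show "n (x * y * f m - X m * Y m * f m) \<le> (n x * D + n x * D + C * D + C * D) * (1/2)^m"
      by (simp add: algebra_simps)
    have "f m * (X m * Y m) - X m * Y m * f m = (f m * X m - X m * f m) * Y m + X m * (f m * Y m - Y m * f m)"
      by (simp add: algebra_simps)
    then have "n (f m * (X m * Y m) - X m * Y m * f m) \<le> (C * (1/2)^m) * D + C * (D * (1/2)^m)"
      by (simp only:) (intro order_trans[OF n_add] add_mono n_mult_mono[OF C(5) D(2)] n_mult_mono[OF C(2) D(5)])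
    then show "n (f m * (X m * Y m) - X m * Y m * f m) \<le> (C * D + C * D) * (1/2)^m"
      by (simp add: algebra_simps)
  qed
qed

lemma follows_st:
  assumes "follows x X"
  shows "follows (st x) (\<lambda>m. st (X m))"
proof -
  obtain C where C: "0 \<le> C" "\<And>m. n (X m) \<le> C" "\<And>m. n (f m * x - f m * X m) \<le> C * (1/2)^m"
    "\<And>m. n (x * f m - X m * f m) \<le> C * (1/2)^m" "\<And>m. n (f m * X m - X m * f m) \<le> C * (1/2)^m"
    by (rule followsE[OF assms(1)]) (rule that)
  show ?thesis
  proof (rule followsI)
    fix m
    show "n (st (X m)) \<le> C" using C by simp
    have "f m * st x - f m * st (X m) = st (x * f m - X m * f m)" by simp
    then show "n (f m * st x - f m * st (X m)) \<le> C * (1/2)^m" using C(4) by (simp only: n_st)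
    have "st x * f m - st (X m) * f m = st (f m * x - f m * X m)" by simp
    then show "n (st x * f m - st (X m) * f m) \<le> C * (1/2)^m" using C(3) by (simp only: n_st)
    have "f m * st (X m) - st (X m) * f m = - st (f m * X m - X m * f m)" by simp
    then show "n (f m * st (X m) - st (X m) * f m) \<le> C * (1/2)^m" using C(5) by (simp only: n_st n_minus)
  qed
qed

lemma follows_const:
  assumes "\<And>m. m \<ge> m0 \<Longrightarrow> n (f m * c - c * f m) \<le> (1/2)^m"
  shows "follows c (\<lambda>m. c)"
proof (rule followsI)
  fix m
  show "n c \<le> n c" by simp
  show "n (f m * c - f m * c) \<le> 0 * (1/2)^m" "n (c * f m - c * f m) \<le> 0 * (1/2)^m" by simp_all
  \<comment> \<open>Before stage m0 nothing is known beyond the trivial bound 2 n c. These finitely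
    many stages are absorbed by the factor 2^m0, as (1/2)^m is at least (1/2)^m0 there.\<close>
  show "n (f m * c - c * f m) \<le> (1 + 2 * n c * 2^m0) * (1/2)^m"
  proof (cases "m0 \<le> m")
    case True
    have "1 * (1/2)^m \<le> (1 + 2 * n c * 2^m0) * (1/2::real)^m" by (intro mult_right_mono) auto
    with assms[OF True] show ?thesis by linarith
  next
    case False
    have "n (f m * c - c * f m) \<le> n c + n c"
      by (intro order_trans[OF n_diff] add_mono n_contract_left n_contract_right n_f)
    also have "\<dots> = (2 * n c * 2^m) * (1/2)^m" by (simp add: power_one_over)
    also have "\<dots> \<le> (1 + 2 * n c * 2^m0) * (1/2)^m"
    proof -
      have "(2::real)^m \<le> 2^m0" using False by (intro power_increasing) auto
      then have "2 * n c * 2^m \<le> 2 * n c * 2^m0" by (intro mult_left_mono) auto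
      then show ?thesis by (intro mult_right_mono) auto
    qed
    finally show ?thesis .
  qed
qed

lemma follows_ev:
  assumes "\<And>k. follows (b k) (\<lambda>m. B m k)" "\<And>c. c \<in> spoly_consts P \<Longrightarrow> follows c (\<lambda>m. c)"
  shows "follows (ev b P) (\<lambda>m. ev (B m) P)"
  using assms(2)
proof (induction P)
  case (PScal z P)
  have "follows (sc z) (\<lambda>m. sc z)"
    by (rule follows_const) (simp add: sc_commute)
  with PScal show ?case by (simp add: follows_mult)
qed (simp_all add: assms(1) follows_add follows_mult follows_st)

text \<open>Blocks of x and of \<open>X m\<close> have nearly equal norms, the latter are close to
  \<open>q (X m)\<close>, and these approach K. As \<open>q x\<close> is a limit superior of block
  norms of x, it is a limit of points of K.\<close>

lemma q_limsup_mem: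
  assumes fol: "follows x X" and K: "closed K"
    and lo: "\<And>m. m \<ge> m0 \<Longrightarrow> q (X m) - (1/2)^m \<le> n (f m * X m * f m)"
    and hi: "\<And>m. m \<ge> m0 \<Longrightarrow> n (f m * X m * f m) \<le> q (X m) + (1/2)^m"
    and near: "\<And>m. m \<ge> m0 \<Longrightarrow> \<exists>y\<in>K. \<bar>q (X m) - y\<bar> \<le> 1 / real (Suc m)"
  shows "q x \<in> K"
proof -
  obtain C where C: "0 \<le> C" "\<And>m. n (X m) \<le> C" "\<And>m. n (f m * x - f m * X m) \<le> C * (1/2)^m"
    "\<And>m. n (x * f m - X m * f m) \<le> C * (1/2)^m" "\<And>m. n (f m * X m - X m * f m) \<le> C * (1/2)^m"
    by (rule followsE[OF fol]) (rule that)
  have comm: "n (f m * x - x * f m) \<le> (3 * C) * (1/2)^m" for m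
  proof -
    have "f m * x - x * f m = (f m * x - f m * X m) + (f m * X m - X m * f m) - (x * f m - X m * f m)" by simp
    then have "n (f m * x - x * f m) \<le> n (f m * x - f m * X m) + n (f m * X m - X m * f m) + n (x * f m - X m * f m)"
      using n_diff[of "(f m * x - f m * X m) + (f m * X m - X m * f m)" "x * f m - X m * f m"]
        n_add[of "f m * x - f m * X m" "f m * X m - X m * f m"] by simp
    then show ?thesis using C(3,4,5)[of m] by simp
  qed
  have blk: "\<bar>n (f m * x * f m) - n (f m * X m * f m)\<bar> \<le> C * (1/2)^m" for m
  proof -
    have "n (f m * x * f m - f m * X m * f m) \<le> C * (1/2)^m"
      using n_contract_right[OF n_f, of "f m * x - f m * X m" m] C(3)[of m] by (simp add: left_diff_distrib)
    moreover have "n a - n b \<le> n (a - b)" for a b using n_add[of "a - b" b] by simp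
    ultimately show ?thesis
      unfolding abs_le_iff by (smt (verit) n_diff_commute)
  qed
  have "\<exists>y\<in>K. dist y (q x) < \<epsilon>" if \<epsilon>: "0 < \<epsilon>" for \<epsilon>
  proof -
    have up: "\<forall>\<^sub>F m in sequentially. n (f m * x * f m) \<le> q x + \<epsilon>/4"
      by (rule blocks_le_q) (use \<epsilon> in simp)
    have "(\<lambda>m. (C + 1) * (1/2)^m + 1 / real (Suc m)) \<longlonglongrightarrow> (C + 1) * 0 + 0"
      by (intro tendsto_intros LIMSEQ_power_zero LIMSEQ_inverse_real_of_nat[unfolded inverse_eq_divide]) simp
    then have sm: "\<forall>\<^sub>F m in sequentially. (C + 1) * (1/2)^m + 1 / real (Suc m) < \<epsilon>/4"
      by (rule order_tendstoD(2)) (use \<epsilon> in simp)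
    from eventually_conj[OF up sm] obtain M0 where M0: "\<forall>m\<ge>M0. n (f m * x * f m) \<le> q x + \<epsilon>/4 \<and>
        (C + 1) * (1/2)^m + 1 / real (Suc m) < \<epsilon>/4"
      unfolding eventually_sequentially by blast
    define M where "M = max m0 M0"
    have M: "M \<ge> m0" "\<And>m. m \<ge> M \<Longrightarrow> n (f m * x * f m) \<le> q x + \<epsilon>/4"
      "\<And>m. m \<ge> M \<Longrightarrow> (C + 1) * (1/2)^m + 1 / real (Suc m) < \<epsilon>/4"
      using M0 by (simp_all add: M_def)
    \<comment> \<open>The contrapositive of \<open>q_le_blocks\<close>: if all late blocks stayed
      below \<open>q x\<close> by a fixed amount, so would \<open>q x\<close> itself. One such late
      block is enough, because the upper bound and the error bounds hold for all of them.\<close>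
    have "\<exists>m\<ge>M. q x - \<epsilon>/4 < n (f m * x * f m)"
    proof (rule ccontr)
      assume "\<not> ?thesis"
      then have "n (f m * x * f m) \<le> q x - \<epsilon>/4" if "m \<ge> M" for m using that by (simp add: not_less)
      from q_le_blocks[OF comm this] \<epsilon> show False by simp
    qed
    then obtain m where m: "m \<ge> M" "q x - \<epsilon>/4 < n (f m * x * f m)" by blast
    obtain y where y: "y \<in> K" "\<bar>q (X m) - y\<bar> \<le> 1 / real (Suc m)" using near m(1) M(1) by (meson order_trans)
    have "\<bar>n (f m * X m * f m) - q (X m)\<bar> \<le> (1/2)^m"
      using lo[of m] hi[of m] m(1) M(1) by (simp add: abs_le_iff)
    then have "\<bar>n (f m * x * f m) - y\<bar> \<le> C * (1/2)^m + (1/2)^m + 1 / real (Suc m)"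
      using blk[of m] y(2) by linarith
    also have "\<dots> < \<epsilon>/4" using M(3)[OF m(1)] by (simp add: distrib_right)
    finally have "\<bar>q x - y\<bar> < \<epsilon>" using M(2)[OF m(1)] m(2) \<epsilon> by linarith
    with y(1) show ?thesis by (auto simp: dist_real_def abs_minus_commute)
  qed
  then have *: "\<And>\<epsilon>. 0 < \<epsilon> \<Longrightarrow> \<exists>y\<in>K. dist y (q x) < \<epsilon>" .
  show ?thesis
  proof (rule ccontr)
    assume "q x \<notin> K"
    moreover have "open (- K)" using K by (simp add: closed_def)
    ultimately obtain \<epsilon> where "0 < \<epsilon>" "\<And>y. dist y (q x) < \<epsilon> \<Longrightarrow> y \<in> - K"
      unfolding open_dist by blast
    with *[of \<epsilon>] show False by auto
  qed
qed

end

section \<open>Choice of the block indices\<close>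

context projection_unit
begin

text \<open>Three requirements hold for all large indices: small commutators, corners close to
  \<open>q\<close> from above, and, once the left end is fixed, segments close to the corner from
  below. Finiteness of \<open>F m\<close> and \<open>G m\<close> makes the thresholds uniform, and a
  recursion satisfies them all.\<close>

lemma block_scheme_exists:
  fixes F G :: "nat \<Rightarrow> 'b set"
  assumes fin: "\<And>m. finite (F m)" "\<And>m. finite (G m)"
    and comm: "\<And>m d. d \<in> F m \<Longrightarrow> (\<lambda>k. n (e k * d - d * e k)) \<longlonglongrightarrow> 0"
  shows "\<exists>\<kappa>. strict_mono \<kappa> \<and> (\<forall>m. let g = e (\<kappa> (Suc m)) - e (\<kappa> m) in
    (\<forall>d\<in>F m. n (g * d - d * g) \<le> (1/2)^m) \<and>
    (\<forall>x\<in>G m. q x - (1/2)^m \<le> n (g * x * g) \<and> n (g * x * g) \<le> q x + (1/2)^m))"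
proof -
  have "\<exists>A. \<forall>k\<ge>A. (\<forall>d\<in>F m. n (e k * d - d * e k) \<le> (1/2)^m / 2) \<and> (\<forall>x\<in>G m. n (u k * x * u k) \<le> q x + (1/2)^m)" for m
  proof -
    have "\<forall>\<^sub>F k in sequentially. n (e k * d - d * e k) \<le> (1/2)^m / 2" if "d \<in> F m" for d
      using order_tendstoD(2)[OF comm[OF that], of "(1/2)^m / 2"] by (auto elim: eventually_mono)
    moreover have "\<forall>\<^sub>F k in sequentially. n (u k * x * u k) \<le> q x + (1/2)^m" for x
      by (rule corner_le_q) simp
    ultimately have "\<forall>\<^sub>F k in sequentially. (\<forall>d\<in>F m. n (e k * d - d * e k) \<le> (1/2)^m / 2) \<and> (\<forall>x\<in>G m. n (u k * x * u k) \<le> q x + (1/2)^m)"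
      using fin by (intro eventually_conj) (simp_all add: eventually_ball_finite)
    then show ?thesis by (simp add: eventually_sequentially)
  qed
  then obtain A where A: "\<And>m k d. k \<ge> A m \<Longrightarrow> d \<in> F m \<Longrightarrow> n (e k * d - d * e k) \<le> (1/2)^m / 2"
    "\<And>m k x. k \<ge> A m \<Longrightarrow> x \<in> G m \<Longrightarrow> n (u k * x * u k) \<le> q x + (1/2)^m"
    by metis
  have "\<exists>L. \<forall>l\<ge>L. \<forall>x\<in>G m. n (u k * x * u k) - (1/2)^m \<le> n ((e l - e k) * x * (e l - e k))" for m k
  proof -
    have "\<forall>\<^sub>F l in sequentially. n (u k * x * u k) - (1/2)^m \<le> n ((e l - e k) * x * (e l - e k))" for x
      using corner_approx_segment[of "(1/2)^m" k x] by (auto simp: eventually_sequentially)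
    then have "\<forall>\<^sub>F l in sequentially. \<forall>x\<in>G m. n (u k * x * u k) - (1/2)^m \<le> n ((e l - e k) * x * (e l - e k))"
      using fin by (simp add: eventually_ball_finite)
    then show ?thesis by (simp add: eventually_sequentially)
  qed
  then obtain L where L: "\<And>m k l x. l \<ge> L m k \<Longrightarrow> x \<in> G m \<Longrightarrow>
      n (u k * x * u k) - (1/2)^m \<le> n ((e l - e k) * x * (e l - e k))" by metis
  \<comment> \<open>The index \<open>\<kappa> (Suc m)\<close> is the right end of block m and the
    left end of the next one, hence both \<open>A m\<close> and \<open>A (Suc m)\<close>, since
    \<open>A\<close> need not be monotone. \<open>L\<close> depends on the left end already chosen.
    The two ends share the commutator bound, which is why \<open>A\<close> asks for half of
    it.\<close>
  define \<kappa> where "\<kappa> = rec_nat (A 0) (\<lambda>m k. max (Suc k) (max (A m) (max (A (Suc m)) (L m k))))"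
  have \<kappa>0: "\<kappa> 0 = A 0" and \<kappa>S: "\<kappa> (Suc m) = max (Suc (\<kappa> m)) (max (A m) (max (A (Suc m)) (L m (\<kappa> m))))" for m
    by (simp_all add: \<kappa>_def)
  have mono: "strict_mono \<kappa>" by (rule strict_mono_Suc_iff[THEN iffD2]) (simp add: \<kappa>S less_max_iff_disj)
  have A\<kappa>: "A m \<le> \<kappa> m" for m by (cases m) (simp_all add: \<kappa>0 \<kappa>S)
  have A\<kappa>': "A m \<le> \<kappa> (Suc m)" "L m (\<kappa> m) \<le> \<kappa> (Suc m)" "\<kappa> m \<le> \<kappa> (Suc m)" for m by (simp_all add: \<kappa>S)
  show ?thesis
  proof (intro exI[of _ \<kappa>] conjI mono allI)
    fix m
    define g where "g = e (\<kappa> (Suc m)) - e (\<kappa> m)"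
    have "n (g * d - d * g) \<le> (1/2)^m" if d: "d \<in> F m" for d
    proof -
      have "g * d - d * g = (e (\<kappa> (Suc m)) * d - d * e (\<kappa> (Suc m))) - (e (\<kappa> m) * d - d * e (\<kappa> m))"
        by (simp add: g_def algebra_simps)
      then have "n (g * d - d * g) \<le> n (e (\<kappa> (Suc m)) * d - d * e (\<kappa> (Suc m))) + n (e (\<kappa> m) * d - d * e (\<kappa> m))"
        by (simp only: n_diff)
      also have "\<dots> \<le> (1/2)^m / 2 + (1/2)^m / 2" by (intro add_mono A d A\<kappa> A\<kappa>')
      finally show ?thesis by simp
    qed
    moreover have "q x - (1/2)^m \<le> n (g * x * g)" if "x \<in> G m" for x
      using L[OF A\<kappa>'(2) that] q_le_corner[of x "\<kappa> m"] by (simp add: g_def)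
    moreover have "n (g * x * g) \<le> q x + (1/2)^m" if "x \<in> G m" for x
    proof -
      have "g * u (\<kappa> m) = g" "u (\<kappa> m) * g = g"
        using A\<kappa>'(3) by (simp_all add: g_def algebra_simps e_absorb)
      then have "g * x * g = g * (u (\<kappa> m) * x * u (\<kappa> m)) * g" by (metis mult.assoc)
      moreover have "n g \<le> 1" unfolding g_def by (rule n_segment[OF A\<kappa>'(3)])
      ultimately have "n (g * x * g) \<le> n (u (\<kappa> m) * x * u (\<kappa> m))" by (metis n_contract)
      also have "\<dots> \<le> q x + (1/2)^m" by (rule A(2)[OF A\<kappa> that])
      finally show ?thesis .
    qed
    ultimately show "let g = e (\<kappa> (Suc m)) - e (\<kappa> m) in
      (\<forall>d\<in>F m. n (g * d - d * g) \<le> (1/2)^m) \<and>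
      (\<forall>x\<in>G m. q x - (1/2)^m \<le> n (g * x * g) \<and> n (g * x * g) \<le> q x + (1/2)^m)"
      by (simp add: Let_def g_def)
  qed
qed

end

section \<open>Saturation in the abstract frame\<close>

lemma finite_spoly_consts: "finite (spoly_consts P)"
  by (induction P) simp_all

theorem (in corona_frame) saturation:
  fixes P :: "nat \<Rightarrow> 'b spoly" and K :: "nat \<Rightarrow> real set"
  assumes units: "\<And>D. countable D \<Longrightarrow>
      \<exists>e. projection_unit st sc n J e \<and> (\<forall>d\<in>D. (\<lambda>k. n (e k * d - d * e k)) \<longlonglongrightarrow> 0)"
    and K: "\<And>j. closed (K j)"
    and approx: "\<And>m. \<exists>b. (\<forall>k. q (b k) \<le> 1) \<and>
      (\<forall>j\<le>m. \<exists>y\<in>K j. \<bar>q (ev b (P j)) - y\<bar> \<le> 1 / real (Suc m))"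
  shows "\<exists>b. (\<forall>k. q (b k) \<le> 1) \<and> (\<forall>j. q (ev b (P j)) \<in> K j)"
proof -
  have "\<exists>b. (\<forall>k. n (b k) \<le> 2 \<and> q (b k) \<le> 1) \<and>
      (\<forall>j\<le>m. \<exists>y\<in>K j. \<bar>q (ev b (P j)) - y\<bar> \<le> 1 / real (Suc m))" for m
  proof -
    obtain b where b: "\<And>k. q (b k) \<le> 1" "\<And>j. j \<le> m \<Longrightarrow> \<exists>y\<in>K j. \<bar>q (ev b (P j)) - y\<bar> \<le> 1 / real (Suc m)"
      using approx[of m] by blast
    \<comment> \<open>A quotient norm of at most 1 is an infimum, so a lift with strict slack is
      taken. The bound must be the same for all m, or the block sums could be unbounded.\<close>
    have "\<exists>a\<in>J. n (b k - a) < 2" for k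
      using q_approx[of "b k" 2] b(1)[of k] by force
    then obtain a where a: "\<And>k. a k \<in> J" "\<And>k. n (b k - a k) < 2" by metis
    define b' where "b' k = b k - a k" for k
    have "q (b' k) = q (b k)" for k by (rule q_mod_J) (simp add: b'_def a J_minus)
    moreover have "q (ev b' (P j)) = q (ev b (P j))" for j
      by (rule q_mod_J[OF ev_mod_J]) (simp add: b'_def a J_minus)
    ultimately show ?thesis using b a(2) by (intro exI[of _ b']) (auto simp: b'_def less_imp_le)
  qed
  then obtain B where B: "\<And>m k. n (B m k) \<le> 2" "\<And>m k. q (B m k) \<le> 1"
    "\<And>m j. j \<le> m \<Longrightarrow> \<exists>y\<in>K j. \<bar>q (ev (B m) (P j)) - y\<bar> \<le> 1 / real (Suc m)"
    by metis
  \<comment> \<open>Block m has to almost commute with \<open>F m\<close> and to see the quotient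
    norm on \<open>G m\<close>. Restricting to indices up to m keeps both finite, and each variable
    and each polynomial is covered from its own index on.\<close>
  define F where "F m = (B m ` {..m}) \<union> (\<Union>j\<le>m. spoly_consts (P j))" for m
  define G where "G m = (B m ` {..m}) \<union> (\<lambda>j. ev (B m) (P j)) ` {..m}" for m
  have fin: "finite (F m)" "finite (G m)" for m by (simp_all add: F_def G_def finite_spoly_consts)
  have "countable (\<Union>m. F m)" using fin by (intro countable_UN) (auto intro: countable_finite)
  then obtain e where e: "projection_unit st sc n J e"
    and comm: "\<And>m d. d \<in> F m \<Longrightarrow> (\<lambda>k. n (e k * d - d * e k)) \<longlonglongrightarrow> 0"
    using units[of "\<Union>m. F m"] by blast
  interpret projection_unit st sc n J e by (rule e)
  obtain \<kappa> where \<kappa>: "strict_mono \<kappa>" and sch: "\<And>m. let g = e (\<kappa> (Suc m)) - e (\<kappa> m) in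
    (\<forall>d\<in>F m. n (g * d - d * g) \<le> (1/2)^m) \<and>
    (\<forall>x\<in>G m. q x - (1/2)^m \<le> n (g * x * g) \<and> n (g * x * g) \<le> q x + (1/2)^m)"
    using block_scheme_exists[of F G] fin comm by blast
  interpret blocks st sc n J e \<kappa> by unfold_locales (rule \<kappa>)
  have fF: "n (f m * d - d * f m) \<le> (1/2)^m" if "d \<in> F m" for m d
    using sch[of m] that by (simp add: f_def Let_def)
  have fG: "q x - (1/2)^m \<le> n (f m * x * f m)" "n (f m * x * f m) \<le> q x + (1/2)^m" if "x \<in> G m" for m x
    using sch[of m] that by (simp_all add: f_def Let_def)
  have "\<exists>s. \<forall>m. f m * s = f m * B m k * f m \<and> s * f m = f m * B m k * f m" for k
    by (rule block_diagonal_exists[OF B(1)])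
  then obtain b where b: "\<And>k m. f m * b k = f m * B m k * f m" "\<And>k m. b k * f m = f m * B m k * f m"
    by metis
  have bF: "follows (b k) (\<lambda>m. B m k)" for k
  proof -
    \<comment> \<open>At the stages m < k the element \<open>B m k\<close> is not among the
      controlled ones, and its commutator is only bounded by 4 = 2 + 2. The term 4 * 2^k compensates
      for this.\<close>
    define E :: real where "E = 1 + 4 * 2^k"
    have cm: "n (f m * B m k - B m k * f m) \<le> E * (1/2)^m" for m
    proof (cases "k \<le> m")
      case True
      then have "n (f m * B m k - B m k * f m) \<le> 1 * (1/2)^m" using fF[of "B m k" m] by (simp add: F_def)
      also have "\<dots> \<le> E * (1/2)^m" by (intro mult_right_mono) (simp_all add: E_def)
      finally show ?thesis .
    next
      case False
      have "n (f m * B m k - B m k * f m) \<le> n (B m k) + n (B m k)"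
        by (intro order_trans[OF n_diff] add_mono n_contract_left n_contract_right n_f)
      also have "\<dots> \<le> 4" using B(1)[of m k] by simp
      also have "\<dots> = (4 * 2^m) * (1/2)^m" by (simp add: power_one_over)
      also have "\<dots> \<le> E * (1/2)^m"
      proof -
        have "(2::real)^m \<le> 2^k" using False by (intro power_increasing) auto
        then have "4 * 2^m \<le> E" unfolding E_def by linarith
        then show ?thesis by (intro mult_right_mono) auto
      qed
      finally show ?thesis .
    qed
    show ?thesis
    proof (rule followsI)
      fix m
      show "n (B m k) \<le> 2" by (rule B(1))
      have "f m * B m k - f m * b k = f m * (f m * B m k - B m k * f m)"
        by (simp add: b right_diff_distrib mult.assoc[symmetric])
      then have "n (f m * b k - f m * B m k) \<le> n (f m * B m k - B m k * f m)"
        by (metis n_contract_left n_f n_diff_commute)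
      then show "n (f m * b k - f m * B m k) \<le> E * (1/2)^m" using cm[of m] by linarith
      have "b k * f m - B m k * f m = (f m * B m k - B m k * f m) * f m"
        by (simp add: b left_diff_distrib mult.assoc)
      then have "n (b k * f m - B m k * f m) \<le> n (f m * B m k - B m k * f m)"
        by (metis n_contract_right n_f)
      then show "n (b k * f m - B m k * f m) \<le> E * (1/2)^m" using cm[of m] by linarith
      show "n (f m * B m k - B m k * f m) \<le> E * (1/2)^m" by (rule cm)
    qed
  qed
  have "q (b k) \<le> 1" for k
  proof (rule field_le_epsilon)
    fix \<epsilon> :: real assume "0 < \<epsilon>"
    then obtain M where M: "(1/2::real)^M < \<epsilon>" using real_arch_pow_inv[of \<epsilon> "1/2"] by auto
    show "q (b k) \<le> 1 + \<epsilon>"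
    \<comment> \<open>The element \<open>b k\<close> commutes exactly with every block projection,
      so there is no off-diagonal error, and its blocks have norm at most 1 + (1/2)^m for m at least
      k.\<close>
    proof (rule q_le_blocks[where C = 0 and ?m0.0 = "max k M"])
      show "n (f m * b k - b k * f m) \<le> 0 * (1/2)^m" for m by (simp add: b)
      fix m assume m: "max k M \<le> m"
      have "f m * b k * f m = f m * B m k * f m" by (simp add: b mult.assoc)
      then have "n (f m * b k * f m) \<le> q (B m k) + (1/2)^m"
        using fG(2)[of "B m k" m] m by (simp add: G_def)
      also have "\<dots> \<le> 1 + (1/2)^M" using m by (intro add_mono B power_decreasing) auto
      finally show "n (f m * b k * f m) \<le> 1 + \<epsilon>" using M by simp
    qed
  qed
  moreover have "q (ev b (P j)) \<in> K j" for j
  proof (rule q_limsup_mem[where X = "\<lambda>m. ev (B m) (P j)" and ?m0.0 = j])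
    show "follows (ev b (P j)) (\<lambda>m. ev (B m) (P j))"
    proof (rule follows_ev[OF bF])
      fix c assume "c \<in> spoly_consts (P j)"
      then show "follows c (\<lambda>m. c)" by (intro follows_const[of j] fF) (auto simp: F_def)
    qed
    show "closed (K j)" by (rule K)
  qed (use B(3) fG in \<open>auto simp: G_def\<close>)
  ultimately show ?thesis by blast
qed

section \<open>Algebra and limits in a C*-algebra given by a carrier set\<close>

locale cstar_alg =
  fixes A :: "'a cstar"
  assumes is_cstar: "is_cstar A"
begin

abbreviation C where "C \<equiv> cs_carrier A"
abbreviation zero where "zero \<equiv> cs_zero A"
abbreviation add (infixl "\<oplus>" 65) where "x \<oplus> y \<equiv> cs_add A x y"
abbreviation mult (infixl "\<odot>" 70) where "x \<odot> y \<equiv> cs_mult A x y"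
abbreviation smult where "smult c x \<equiv> cs_smult A c x"
abbreviation sub (infixl "\<ominus>" 65) where "x \<ominus> y \<equiv> cs_minus A x y"
abbreviation adj where "adj x \<equiv> cs_star A x"
abbreviation nm where "nm x \<equiv> cs_nrm A x"
abbreviation M where "M \<equiv> mult_alg A"

lemma cstar_laws:
  shows "zero \<in> C"
    "\<forall>x\<in>C. \<forall>y\<in>C. x \<oplus> y \<in> C \<and> x \<odot> y \<in> C"
    "\<forall>c. \<forall>x\<in>C. smult c x \<in> C"
    "\<forall>x\<in>C. adj x \<in> C"
    "\<forall>x\<in>C. \<forall>y\<in>C. \<forall>w\<in>C. x \<oplus> y \<oplus> w = x \<oplus> (y \<oplus> w)"
    "\<forall>x\<in>C. \<forall>y\<in>C. x \<oplus> y = y \<oplus> x"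
    "\<forall>x\<in>C. zero \<oplus> x = x"
    "\<forall>x\<in>C. x \<oplus> smult (-1) x = zero"
    "\<forall>c. \<forall>x\<in>C. \<forall>y\<in>C. smult c (x \<oplus> y) = smult c x \<oplus> smult c y"
    "\<forall>c d. \<forall>x\<in>C. smult (c + d) x = smult c x \<oplus> smult d x"
    "\<forall>c d. \<forall>x\<in>C. smult c (smult d x) = smult (c * d) x"
    "\<forall>x\<in>C. smult 1 x = x"
    "\<forall>x\<in>C. \<forall>y\<in>C. \<forall>w\<in>C. x \<odot> y \<odot> w = x \<odot> (y \<odot> w)"
    "\<forall>x\<in>C. \<forall>y\<in>C. \<forall>w\<in>C. x \<odot> (y \<oplus> w) = x \<odot> y \<oplus> x \<odot> w"
    "\<forall>x\<in>C. \<forall>y\<in>C. \<forall>w\<in>C. (x \<oplus> y) \<odot> w = x \<odot> w \<oplus> y \<odot> w"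
    "\<forall>c. \<forall>x\<in>C. \<forall>y\<in>C. smult c (x \<odot> y) = smult c x \<odot> y \<and> smult c (x \<odot> y) = x \<odot> smult c y"
    "\<forall>x\<in>C. adj (adj x) = x"
    "\<forall>x\<in>C. \<forall>y\<in>C. adj (x \<oplus> y) = adj x \<oplus> adj y"
    "\<forall>c. \<forall>x\<in>C. adj (smult c x) = smult (cnj c) (adj x)"
    "\<forall>x\<in>C. \<forall>y\<in>C. adj (x \<odot> y) = adj y \<odot> adj x"
    "\<forall>x\<in>C. 0 \<le> nm x \<and> (nm x = 0 \<longleftrightarrow> x = zero)"
    "\<forall>x\<in>C. \<forall>y\<in>C. nm (x \<oplus> y) \<le> nm x + nm y"
    "\<forall>c. \<forall>x\<in>C. nm (smult c x) = cmod c * nm x"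
    "\<forall>x\<in>C. \<forall>y\<in>C. nm (x \<odot> y) \<le> nm x * nm y"
    "\<forall>x\<in>C. nm (adj x \<odot> x) = (nm x)\<^sup>2"
    "\<forall>X. (\<forall>k. X k \<in> C) \<and> (\<forall>e>0. \<exists>N. \<forall>p\<ge>N. \<forall>q\<ge>N. nm (X p \<ominus> X q) < e) \<longrightarrow>
      (\<exists>l\<in>C. (\<lambda>k. nm (X k \<ominus> l)) \<longlonglongrightarrow> 0)"
  using is_cstar unfolding is_cstar_def Let_def by - (elim conjE, assumption)+

lemmas zero_closed [simp] = cstar_laws(1)
lemmas add_closed [simp] = cstar_laws(2)[rule_format, THEN conjunct1]
lemmas mult_closed [simp] = cstar_laws(2)[rule_format, THEN conjunct2]
lemmas smult_closed [simp] = cstar_laws(3)[rule_format]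
lemmas adj_closed [simp] = cstar_laws(4)[rule_format]
lemmas add_assoc = cstar_laws(5)[rule_format]
lemmas add_commute = cstar_laws(6)[rule_format]
lemmas add_zero [simp] = cstar_laws(7)[rule_format]
lemmas add_neg [simp] = cstar_laws(8)[rule_format]
lemmas smult_add = cstar_laws(9)[rule_format]
lemmas smult_plus = cstar_laws(10)[rule_format]
lemmas smult_smult = cstar_laws(11)[rule_format]
lemmas smult_1 [simp] = cstar_laws(12)[rule_format]
lemmas mult_assoc = cstar_laws(13)[rule_format]
lemmas mult_add = cstar_laws(14)[rule_format]
lemmas add_mult = cstar_laws(15)[rule_format]
lemmas smult_mult = cstar_laws(16)[rule_format, THEN conjunct1, symmetric]
lemmas mult_smult = cstar_laws(16)[rule_format, THEN conjunct2, symmetric]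
lemmas adj_adj [simp] = cstar_laws(17)[rule_format]
lemmas adj_add = cstar_laws(18)[rule_format]
lemmas adj_smult = cstar_laws(19)[rule_format]
lemmas adj_mult = cstar_laws(20)[rule_format]
lemmas nm_nonneg [simp] = cstar_laws(21)[rule_format, THEN conjunct1]
lemmas nm_eq_0 = cstar_laws(21)[rule_format, THEN conjunct2]
lemmas nm_add = cstar_laws(22)[rule_format]
lemmas nm_smult = cstar_laws(23)[rule_format]
lemmas nm_mult = cstar_laws(24)[rule_format]
lemmas nm_cstar = cstar_laws(25)[rule_format]

lemma complete:
  "\<lbrakk>\<And>k. X k \<in> C; \<And>e. e > 0 \<Longrightarrow> \<exists>N. \<forall>p\<ge>N. \<forall>q\<ge>N. nm (X p \<ominus> X q) < e\<rbrakk>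
    \<Longrightarrow> \<exists>l\<in>C. (\<lambda>k. nm (X k \<ominus> l)) \<longlonglongrightarrow> 0"
  using cstar_laws(26)[THEN spec, of X] by blast

lemma add_left_commute: "x \<in> C \<Longrightarrow> y \<in> C \<Longrightarrow> w \<in> C \<Longrightarrow> x \<oplus> (y \<oplus> w) = y \<oplus> (x \<oplus> w)"
  by (metis add_assoc add_commute)

lemmas add_ac = add_assoc add_commute add_left_commute

lemma sub_closed [simp]: "x \<in> C \<Longrightarrow> y \<in> C \<Longrightarrow> x \<ominus> y \<in> C"
  by (simp add: cs_minus_def)

lemma sub_self [simp]: "x \<in> C \<Longrightarrow> x \<ominus> x = zero"
  by (simp add: cs_minus_def)

lemma add_zero_right [simp]: "x \<in> C \<Longrightarrow> x \<oplus> zero = x"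
  by (subst add_commute) simp_all

lemma sub_eq_zero: "x \<in> C \<Longrightarrow> y \<in> C \<Longrightarrow> x \<ominus> y = zero \<longleftrightarrow> x = y"
proof
  assume xy: "x \<in> C" "y \<in> C" "x \<ominus> y = zero"
  have "smult (-1) y \<oplus> y = zero" using xy by (subst add_commute) simp_all
  then have "x = x \<oplus> (smult (-1) y \<oplus> y)" using xy by simp
  also have "\<dots> = (x \<ominus> y) \<oplus> y" using xy(1,2) by (simp add: cs_minus_def add_assoc)
  finally show "x = y" using xy by simp
qed simp

lemma sub_add_cancel: "x \<in> C \<Longrightarrow> y \<in> C \<Longrightarrow> w \<in> C \<Longrightarrow> (x \<ominus> y) \<oplus> (y \<ominus> w) = x \<ominus> w"
proof -
  assume xyw: "x \<in> C" "y \<in> C" "w \<in> C"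
  have "(x \<ominus> y) \<oplus> (y \<ominus> w) = (x \<ominus> w) \<oplus> (y \<oplus> smult (-1) y)"
    using xyw by (simp add: cs_minus_def add_ac del: add_neg)
  then show ?thesis using xyw by simp
qed

lemma smult_0 [simp]: "x \<in> C \<Longrightarrow> smult 0 x = zero"
  using smult_plus[of x 1 "-1"] by simp

lemma smult_zero [simp]: "smult c zero = zero"
  using smult_smult[of zero c 0] by simp

lemma mult_zero [simp]: "x \<in> C \<Longrightarrow> x \<odot> zero = zero"
  using mult_smult[of x zero 0] by simp

lemma zero_mult [simp]: "x \<in> C \<Longrightarrow> zero \<odot> x = zero"
  using smult_mult[of zero x 0] by simp

lemma adj_zero [simp]: "adj zero = zero"
  using adj_smult[of zero 0] by simp

lemma mult_sub: "x \<in> C \<Longrightarrow> y \<in> C \<Longrightarrow> w \<in> C \<Longrightarrow> x \<odot> (y \<ominus> w) = x \<odot> y \<ominus> x \<odot> w"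
  by (simp add: cs_minus_def mult_add mult_smult)

lemma sub_mult: "x \<in> C \<Longrightarrow> y \<in> C \<Longrightarrow> w \<in> C \<Longrightarrow> (x \<ominus> y) \<odot> w = x \<odot> w \<ominus> y \<odot> w"
  by (simp add: cs_minus_def add_mult smult_mult)

lemma smult_sub: "x \<in> C \<Longrightarrow> y \<in> C \<Longrightarrow> smult c (x \<ominus> y) = smult c x \<ominus> smult c y"
  by (simp add: cs_minus_def smult_add smult_smult mult.commute)

lemma nm_zero [simp]: "nm zero = 0"
  by (simp add: nm_eq_0)

lemma nm_sub_commute: "x \<in> C \<Longrightarrow> y \<in> C \<Longrightarrow> nm (x \<ominus> y) = nm (y \<ominus> x)"
proof -
  assume xy: "x \<in> C" "y \<in> C"
  then have "x \<ominus> y = smult (-1) (y \<ominus> x)"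
    by (simp add: cs_minus_def smult_add smult_smult add_commute)
  then show ?thesis using xy by (simp add: nm_smult)
qed

lemma nm_adj [simp]: "x \<in> C \<Longrightarrow> nm (adj x) = nm x"
proof -
  have le: "nm x \<le> nm (adj x)" if x: "x \<in> C" for x
  proof (cases "nm x = 0")
    case False
    have "nm x * nm x \<le> nm (adj x) * nm x"
      using nm_cstar[OF x] nm_mult[of "adj x" x] x by (simp add: power2_eq_square)
    then show ?thesis using False nm_nonneg[OF x] by (simp add: mult_le_cancel_right)
  qed (simp add: x)
  assume x: "x \<in> C"
  show ?thesis using le[OF x] le[of "adj x"] x by simp
qed

text \<open>Taking y = adj d, the C*-identity gives norm 0.\<close>

lemma annihilator_zero_left:
  assumes d: "d \<in> C" and "\<And>y. y \<in> C \<Longrightarrow> y \<odot> d = zero"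
  shows "d = zero"
  using nm_cstar[OF d] assms nm_eq_0[OF d] by simp

definition conv :: "(nat \<Rightarrow> 'a) \<Rightarrow> 'a \<Rightarrow> bool" where
  "conv X l \<longleftrightarrow> (\<forall>k. X k \<in> C) \<and> l \<in> C \<and> (\<lambda>k. nm (X k \<ominus> l)) \<longlonglongrightarrow> 0"

lemma conv_by_bound:
  assumes "\<And>k. Y k \<in> C" "l' \<in> C" "\<And>k. nm (Y k \<ominus> l') \<le> g k" "g \<longlonglongrightarrow> 0"
  shows "conv Y l'"
  unfolding conv_def
proof (intro conjI allI assms(1,2))
  show "(\<lambda>k. nm (Y k \<ominus> l')) \<longlonglongrightarrow> 0"
    by (rule tendsto_sandwich[OF _ _ tendsto_const assms(4)]) (use assms in auto)
qed

lemma conv_unique: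
  assumes "conv X l" "conv X l'"
  shows "l = l'"
proof -
  have mem: "l \<in> C" "l' \<in> C" "\<And>k. X k \<in> C" using assms by (auto simp: conv_def)
  have "(\<lambda>k. nm (X k \<ominus> l) + nm (X k \<ominus> l')) \<longlonglongrightarrow> 0 + 0"
    using assms unfolding conv_def by (intro tendsto_add) auto
  moreover have "nm (l \<ominus> l') \<le> nm (X k \<ominus> l) + nm (X k \<ominus> l')" for k
    using nm_add[of "l \<ominus> X k" "X k \<ominus> l'"] mem by (simp add: sub_add_cancel nm_sub_commute)
  ultimately have "nm (l \<ominus> l') \<le> 0 + 0" by (intro LIMSEQ_le_const) auto
  then have "nm (l \<ominus> l') = 0" using nm_nonneg[OF sub_closed[OF mem(1,2)]] by linarith
  then show ?thesis using mem by (simp add: nm_eq_0 sub_eq_zero)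
qed

lemma conv_add:
  assumes "conv X l" "conv Y l'"
  shows "conv (\<lambda>k. X k \<oplus> Y k) (l \<oplus> l')"
proof (rule conv_by_bound)
  have mem: "l \<in> C" "l' \<in> C" "X k \<in> C" "Y k \<in> C" for k using assms by (auto simp: conv_def)
  then show "X k \<oplus> Y k \<in> C" "l \<oplus> l' \<in> C" for k by simp_all
  have "X k \<oplus> Y k \<ominus> (l \<oplus> l') = (X k \<ominus> l) \<oplus> (Y k \<ominus> l')" for k
    using mem by (simp add: cs_minus_def smult_add add_ac)
  then show "nm (X k \<oplus> Y k \<ominus> (l \<oplus> l')) \<le> nm (X k \<ominus> l) + nm (Y k \<ominus> l')" for k
    using mem nm_add[of "X k \<ominus> l" "Y k \<ominus> l'"] by simp
  show "(\<lambda>k. nm (X k \<ominus> l) + nm (Y k \<ominus> l')) \<longlonglongrightarrow> 0"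
    using assms unfolding conv_def by (intro tendsto_add_zero) auto
qed

lemma conv_smult:
  assumes "conv X l"
  shows "conv (\<lambda>k. smult c (X k)) (smult c l)"
proof (rule conv_by_bound)
  have mem: "l \<in> C" "X k \<in> C" for k using assms by (auto simp: conv_def)
  then show "smult c (X k) \<in> C" "smult c l \<in> C" for k by simp_all
  show "nm (smult c (X k) \<ominus> smult c l) \<le> cmod c * nm (X k \<ominus> l)" for k
    using mem by (simp add: smult_sub[symmetric] nm_smult)
  show "(\<lambda>k. cmod c * nm (X k \<ominus> l)) \<longlonglongrightarrow> 0"
    using assms unfolding conv_def by (intro tendsto_mult_right_zero) auto
qed

lemma conv_mult_left:
  assumes "conv X l" "x \<in> C"
  shows "conv (\<lambda>k. x \<odot> X k) (x \<odot> l)"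
proof (rule conv_by_bound)
  have mem: "l \<in> C" "X k \<in> C" for k using assms by (auto simp: conv_def)
  then show "x \<odot> X k \<in> C" "x \<odot> l \<in> C" for k using assms by simp_all
  show "nm (x \<odot> X k \<ominus> x \<odot> l) \<le> nm x * nm (X k \<ominus> l)" for k
    using mem assms nm_mult[of x "X k \<ominus> l"] by (simp add: mult_sub)
  show "(\<lambda>k. nm x * nm (X k \<ominus> l)) \<longlonglongrightarrow> 0"
    using assms unfolding conv_def by (intro tendsto_mult_right_zero) auto
qed

lemma conv_mult_right:
  assumes "conv X l" "x \<in> C"
  shows "conv (\<lambda>k. X k \<odot> x) (l \<odot> x)"
proof (rule conv_by_bound)
  have mem: "l \<in> C" "X k \<in> C" for k using assms by (auto simp: conv_def)
  then show "X k \<odot> x \<in> C" "l \<odot> x \<in> C" for k using assms by simp_all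
  show "nm (X k \<odot> x \<ominus> l \<odot> x) \<le> nm (X k \<ominus> l) * nm x" for k
    using mem assms nm_mult[of "X k \<ominus> l" x] by (simp add: sub_mult)
  show "(\<lambda>k. nm (X k \<ominus> l) * nm x) \<longlonglongrightarrow> 0"
    using assms unfolding conv_def by (intro tendsto_mult_left_zero) auto
qed

lemma conv_bound:
  assumes "conv X l" "\<And>k. nm (X k) \<le> c"
  shows "nm l \<le> c"
proof -
  have mem: "l \<in> C" "X k \<in> C" for k using assms by (auto simp: conv_def)
  have "l = (l \<ominus> X k) \<oplus> X k" for k
    using sub_add_cancel[of l "X k" zero] mem by (simp add: cs_minus_def)
  then have "nm l \<le> nm (X k \<ominus> l) + c" for k
    using nm_add[of "l \<ominus> X k" "X k"] mem assms(2)[of k] by (simp add: nm_sub_commute)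
  moreover have "(\<lambda>k. nm (X k \<ominus> l) + c) \<longlonglongrightarrow> 0 + c"
    using assms unfolding conv_def by (intro tendsto_add) auto
  ultimately have "nm l \<le> 0 + c" by (intro LIMSEQ_le_const) auto
  then show ?thesis by simp
qed

section \<open>The multiplier algebra\<close>

lemma carrier_M: "cs_carrier M = {m. double_centralizer A m}"
  by (simp add: mult_alg_def Let_def)

definition one :: "'a mult" where
  "one = (restrict (\<lambda>x. x) C, restrict (\<lambda>x. x) C)"

lemma M_apply:
  assumes "x \<in> C"
  shows "fst (cs_zero M) x = zero" "snd (cs_zero M) x = zero"
    "fst (cs_add M m1 m2) x = fst m1 x \<oplus> fst m2 x" "snd (cs_add M m1 m2) x = snd m1 x \<oplus> snd m2 x"
    "fst (cs_smult M c m1) x = smult c (fst m1 x)" "snd (cs_smult M c m1) x = smult c (snd m1 x)"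
    "fst (cs_mult M m1 m2) x = fst m1 (fst m2 x)" "snd (cs_mult M m1 m2) x = snd m2 (snd m1 x)"
    "fst (cs_star M m1) x = adj (snd m1 (adj x))" "snd (cs_star M m1) x = adj (fst m1 (adj x))"
    "fst one x = x" "snd one x = x"
    "fst (mult_emb A a) x = a \<odot> x" "snd (mult_emb A a) x = x \<odot> a"
  using assms by (simp_all add: mult_alg_def Let_def one_def mult_emb_def)

lemma M_extensional:
  "fst (cs_zero M) \<in> extensional C" "snd (cs_zero M) \<in> extensional C"
  "fst (cs_add M m1 m2) \<in> extensional C" "snd (cs_add M m1 m2) \<in> extensional C"
  "fst (cs_smult M c m1) \<in> extensional C" "snd (cs_smult M c m1) \<in> extensional C"
  "fst (cs_mult M m1 m2) \<in> extensional C" "snd (cs_mult M m1 m2) \<in> extensional C"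
  "fst (cs_star M m1) \<in> extensional C" "snd (cs_star M m1) \<in> extensional C"
  "fst one \<in> extensional C" "snd one \<in> extensional C"
  "fst (mult_emb A a) \<in> extensional C" "snd (mult_emb A a) \<in> extensional C"
  by (simp_all add: mult_alg_def Let_def one_def mult_emb_def)

lemma bdd_linearI:
  assumes "T \<in> extensional C" "\<And>x. x \<in> C \<Longrightarrow> T x \<in> C"
    "\<And>x y. x \<in> C \<Longrightarrow> y \<in> C \<Longrightarrow> T (x \<oplus> y) = T x \<oplus> T y"
    "\<And>c x. x \<in> C \<Longrightarrow> T (smult c x) = smult c (T x)" "\<And>x. x \<in> C \<Longrightarrow> nm (T x) \<le> K * nm x"
  shows "bdd_linear_on A T"
  unfolding bdd_linear_on_def using assms by blast

lemma double_centralizerI: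
  assumes "bdd_linear_on A (fst m)" "bdd_linear_on A (snd m)"
    "\<And>x y. x \<in> C \<Longrightarrow> y \<in> C \<Longrightarrow> x \<odot> fst m y = snd m x \<odot> y"
  shows "m \<in> cs_carrier M"
  using assms by (auto simp: carrier_M double_centralizer_def)

lemma M_memD:
  assumes "m \<in> cs_carrier M"
  shows "bdd_linear_on A (fst m)" "bdd_linear_on A (snd m)"
    "fst m \<in> extensional C" "snd m \<in> extensional C"
    "x \<in> C \<Longrightarrow> fst m x \<in> C" "x \<in> C \<Longrightarrow> snd m x \<in> C"
    "x \<in> C \<Longrightarrow> y \<in> C \<Longrightarrow> fst m (x \<oplus> y) = fst m x \<oplus> fst m y"
    "x \<in> C \<Longrightarrow> y \<in> C \<Longrightarrow> snd m (x \<oplus> y) = snd m x \<oplus> snd m y"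
    "x \<in> C \<Longrightarrow> fst m (smult c x) = smult c (fst m x)"
    "x \<in> C \<Longrightarrow> snd m (smult c x) = smult c (snd m x)"
    "x \<in> C \<Longrightarrow> y \<in> C \<Longrightarrow> x \<odot> fst m y = snd m x \<odot> y"
  using assms by (auto simp: carrier_M double_centralizer_def bdd_linear_on_def)

lemma bdd_linear_bound:
  assumes "bdd_linear_on A T"
  obtains K where "0 \<le> K" "\<And>x. x \<in> C \<Longrightarrow> nm (T x) \<le> K * nm x"
proof -
  obtain K where K: "\<And>x. x \<in> C \<Longrightarrow> nm (T x) \<le> K * nm x"
    using assms unfolding bdd_linear_on_def by blast
  have "nm (T x) \<le> max K 0 * nm x" if "x \<in> C" for x
    using K[OF that] mult_right_mono[of K "max K 0" "nm x"] that by simp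
  then show ?thesis by (intro that[of "max K 0"]) auto
qed

lemma M_eqI:
  assumes "m \<in> cs_carrier M" "m' \<in> cs_carrier M"
    "\<And>x. x \<in> C \<Longrightarrow> fst m x = fst m' x" "\<And>x. x \<in> C \<Longrightarrow> snd m x = snd m' x"
  shows "m = m'"
proof (rule prod_eqI)
  show "fst m = fst m'" by (rule extensionalityI[OF M_memD(3)[OF assms(1)] M_memD(3)[OF assms(2)] assms(3)])
  show "snd m = snd m'" by (rule extensionalityI[OF M_memD(4)[OF assms(1)] M_memD(4)[OF assms(2)] assms(4)])
qed

lemma M_zero [simp]: "cs_zero M \<in> cs_carrier M"
  by (rule double_centralizerI; (rule bdd_linearI[where K = 0])?) (simp_all add: M_apply M_extensional)

lemma M_one [simp]: "one \<in> cs_carrier M"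
  by (rule double_centralizerI; (rule bdd_linearI[where K = 1])?) (simp_all add: M_apply M_extensional)

lemma bdd_linear_add:
  assumes "bdd_linear_on A S" "bdd_linear_on A T" "R \<in> extensional C" "\<And>x. x \<in> C \<Longrightarrow> R x = S x \<oplus> T x"
  shows "bdd_linear_on A R"
proof -
  obtain K where K: "\<And>x. x \<in> C \<Longrightarrow> nm (S x) \<le> K * nm x" using bdd_linear_bound[OF assms(1)] by blast
  obtain L where L: "\<And>x. x \<in> C \<Longrightarrow> nm (T x) \<le> L * nm x" using bdd_linear_bound[OF assms(2)] by blast
  have S: "\<And>x. x \<in> C \<Longrightarrow> S x \<in> C" "\<And>x y. x \<in> C \<Longrightarrow> y \<in> C \<Longrightarrow> S (x \<oplus> y) = S x \<oplus> S y"
    "\<And>c x. x \<in> C \<Longrightarrow> S (smult c x) = smult c (S x)"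
    "\<And>x. x \<in> C \<Longrightarrow> T x \<in> C" "\<And>x y. x \<in> C \<Longrightarrow> y \<in> C \<Longrightarrow> T (x \<oplus> y) = T x \<oplus> T y"
    "\<And>c x. x \<in> C \<Longrightarrow> T (smult c x) = smult c (T x)"
    using assms(1,2) by (auto simp: bdd_linear_on_def)
  show ?thesis
  proof (rule bdd_linearI[where K = "K + L"])
    fix x assume "x \<in> C"
    then show "nm (R x) \<le> (K + L) * nm x"
      using nm_add[of "S x" "T x"] K[of x] L[of x] by (simp add: assms(4) S distrib_right)
  qed (simp_all add: assms S smult_add add_ac)
qed

lemma M_add [simp]: "m1 \<in> cs_carrier M \<Longrightarrow> m2 \<in> cs_carrier M \<Longrightarrow> cs_add M m1 m2 \<in> cs_carrier M"
proof (rule double_centralizerI)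
  assume m: "m1 \<in> cs_carrier M" "m2 \<in> cs_carrier M"
  show "bdd_linear_on A (fst (cs_add M m1 m2))"
    by (rule bdd_linear_add[OF M_memD(1)[OF m(1)] M_memD(1)[OF m(2)]]) (simp_all add: M_apply M_extensional)
  show "bdd_linear_on A (snd (cs_add M m1 m2))"
    by (rule bdd_linear_add[OF M_memD(2)[OF m(1)] M_memD(2)[OF m(2)]]) (simp_all add: M_apply M_extensional)
qed (simp add: M_apply M_memD mult_add add_mult)

lemma bdd_linear_smult:
  assumes "bdd_linear_on A S" "R \<in> extensional C" "\<And>x. x \<in> C \<Longrightarrow> R x = smult c (S x)"
  shows "bdd_linear_on A R"
proof -
  obtain K where K: "\<And>x. x \<in> C \<Longrightarrow> nm (S x) \<le> K * nm x" using bdd_linear_bound[OF assms(1)] by blast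
  have S: "\<And>x. x \<in> C \<Longrightarrow> S x \<in> C" "\<And>x y. x \<in> C \<Longrightarrow> y \<in> C \<Longrightarrow> S (x \<oplus> y) = S x \<oplus> S y"
    "\<And>c x. x \<in> C \<Longrightarrow> S (smult c x) = smult c (S x)"
    using assms(1) by (auto simp: bdd_linear_on_def)
  show ?thesis
  proof (rule bdd_linearI[where K = "cmod c * K"])
    fix x assume "x \<in> C"
    then show "nm (R x) \<le> (cmod c * K) * nm x"
      using mult_left_mono[OF K[of x], of "cmod c"] by (simp add: assms(3) S nm_smult mult.assoc)
  qed (simp_all add: assms S smult_add smult_smult mult.commute)
qed

lemma M_smult [simp]: "m1 \<in> cs_carrier M \<Longrightarrow> cs_smult M c m1 \<in> cs_carrier M"
proof (rule double_centralizerI)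
  assume m: "m1 \<in> cs_carrier M"
  show "bdd_linear_on A (fst (cs_smult M c m1))"
    by (rule bdd_linear_smult[OF M_memD(1)[OF m]]) (simp_all add: M_apply M_extensional)
  show "bdd_linear_on A (snd (cs_smult M c m1))"
    by (rule bdd_linear_smult[OF M_memD(2)[OF m]]) (simp_all add: M_apply M_extensional)
qed (simp add: M_apply M_memD mult_smult smult_mult)

lemma bdd_linear_comp:
  assumes "bdd_linear_on A S" "bdd_linear_on A T" "R \<in> extensional C" "\<And>x. x \<in> C \<Longrightarrow> R x = S (T x)"
  shows "bdd_linear_on A R"
proof -
  obtain K where K: "0 \<le> K" "\<And>x. x \<in> C \<Longrightarrow> nm (S x) \<le> K * nm x" using bdd_linear_bound[OF assms(1)] by blast
  obtain L where L: "\<And>x. x \<in> C \<Longrightarrow> nm (T x) \<le> L * nm x" using bdd_linear_bound[OF assms(2)] by blast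
  have S: "\<And>x. x \<in> C \<Longrightarrow> S x \<in> C" "\<And>x y. x \<in> C \<Longrightarrow> y \<in> C \<Longrightarrow> S (x \<oplus> y) = S x \<oplus> S y"
    "\<And>c x. x \<in> C \<Longrightarrow> S (smult c x) = smult c (S x)"
    "\<And>x. x \<in> C \<Longrightarrow> T x \<in> C" "\<And>x y. x \<in> C \<Longrightarrow> y \<in> C \<Longrightarrow> T (x \<oplus> y) = T x \<oplus> T y"
    "\<And>c x. x \<in> C \<Longrightarrow> T (smult c x) = smult c (T x)"
    using assms(1,2) by (auto simp: bdd_linear_on_def)
  show ?thesis
  proof (rule bdd_linearI[where K = "K * L"])
    fix x assume "x \<in> C"
    then show "nm (R x) \<le> (K * L) * nm x"
      using K(2)[of "T x"] mult_left_mono[OF L[of x] K(1)] by (simp add: assms(4) S mult.assoc)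
  qed (simp_all add: assms S)
qed

lemma M_mult [simp]: "m1 \<in> cs_carrier M \<Longrightarrow> m2 \<in> cs_carrier M \<Longrightarrow> cs_mult M m1 m2 \<in> cs_carrier M"
proof (rule double_centralizerI)
  assume m: "m1 \<in> cs_carrier M" "m2 \<in> cs_carrier M"
  show "bdd_linear_on A (fst (cs_mult M m1 m2))"
    by (rule bdd_linear_comp[OF M_memD(1)[OF m(1)] M_memD(1)[OF m(2)]]) (simp_all add: M_apply M_extensional)
  show "bdd_linear_on A (snd (cs_mult M m1 m2))"
    by (rule bdd_linear_comp[OF M_memD(2)[OF m(2)] M_memD(2)[OF m(1)]]) (simp_all add: M_apply M_extensional)
qed (simp add: M_apply M_memD)

lemma bdd_linear_adj:
  assumes "bdd_linear_on A S" "R \<in> extensional C" "\<And>x. x \<in> C \<Longrightarrow> R x = adj (S (adj x))"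
  shows "bdd_linear_on A R"
proof -
  obtain K where K: "\<And>x. x \<in> C \<Longrightarrow> nm (S x) \<le> K * nm x" using bdd_linear_bound[OF assms(1)] by blast
  have S: "\<And>x. x \<in> C \<Longrightarrow> S x \<in> C" "\<And>x y. x \<in> C \<Longrightarrow> y \<in> C \<Longrightarrow> S (x \<oplus> y) = S x \<oplus> S y"
    "\<And>c x. x \<in> C \<Longrightarrow> S (smult c x) = smult c (S x)"
    using assms(1) by (auto simp: bdd_linear_on_def)
  show ?thesis
  proof (rule bdd_linearI[where K = K])
    fix x assume "x \<in> C"
    then show "nm (R x) \<le> K * nm x" using K[of "adj x"] by (simp add: assms(3) S)
  qed (simp_all add: assms S adj_add adj_smult)
qed

lemma M_star [simp]: "m \<in> cs_carrier M \<Longrightarrow> cs_star M m \<in> cs_carrier M"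
proof (rule double_centralizerI)
  assume m: "m \<in> cs_carrier M"
  show "bdd_linear_on A (fst (cs_star M m))"
    by (rule bdd_linear_adj[OF M_memD(2)[OF m]]) (simp_all add: M_apply M_extensional)
  show "bdd_linear_on A (snd (cs_star M m))"
    by (rule bdd_linear_adj[OF M_memD(1)[OF m]]) (simp_all add: M_apply M_extensional)
  fix x y assume xy: "x \<in> C" "y \<in> C"
  have "x \<odot> adj (snd m (adj y)) = adj (snd m (adj y) \<odot> adj x)" using m xy by (simp add: adj_mult M_memD(6))
  also have "\<dots> = adj (adj y \<odot> fst m (adj x))" using M_memD(11)[OF m, of "adj y" "adj x"] xy by simp
  also have "\<dots> = adj (fst m (adj x)) \<odot> y" using m xy by (simp add: adj_mult M_memD(5))
  finally show "x \<odot> fst (cs_star M m) y = snd (cs_star M m) x \<odot> y" using xy by (simp add: M_apply)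
qed

lemma M_emb [simp]: "a \<in> C \<Longrightarrow> mult_emb A a \<in> cs_carrier M"
proof (rule double_centralizerI)
  assume a: "a \<in> C"
  show "bdd_linear_on A (fst (mult_emb A a))"
    by (rule bdd_linearI[where K = "nm a"])
      (simp_all add: a M_apply M_extensional mult_add mult_smult nm_mult)
  show "bdd_linear_on A (snd (mult_emb A a))"
    by (rule bdd_linearI[where K = "nm a"])
      (simp_all add: a M_apply M_extensional add_mult smult_mult nm_mult mult.commute[of "nm a"])
qed (simp add: M_apply mult_assoc)

lemma M_minus [simp]: "m1 \<in> cs_carrier M \<Longrightarrow> m2 \<in> cs_carrier M \<Longrightarrow> cs_minus M m1 m2 \<in> cs_carrier M"
  by (simp add: cs_minus_def)

lemma M_minus_apply: "x \<in> C \<Longrightarrow> fst (cs_minus M m1 m2) x = fst m1 x \<ominus> fst m2 x"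
  "x \<in> C \<Longrightarrow> snd (cs_minus M m1 m2) x = snd m1 x \<ominus> snd m2 x"
  by (simp_all add: cs_minus_def M_apply)

text \<open>Being a module map is not part of \<open>double_centralizer\<close>. It follows by
  multiplying from the left by any z: the centralizer identity moves the multiplier onto z, and
  associativity moves it back past x only.\<close>

lemma fst_mult: 
  assumes m: "m \<in> cs_carrier M" and xy: "x \<in> C" "y \<in> C"
  shows "fst m (x \<odot> y) = fst m x \<odot> y"
proof -
  have "fst m (x \<odot> y) \<ominus> fst m x \<odot> y = zero"
  proof (rule annihilator_zero_left)
    fix z assume z: "z \<in> C"
    have "z \<odot> fst m (x \<odot> y) = snd m z \<odot> (x \<odot> y)" using m xy z by (simp add: M_memD)
    also have "\<dots> = (z \<odot> fst m x) \<odot> y" using m xy z by (simp add: M_memD mult_assoc)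
    also have "\<dots> = z \<odot> (fst m x \<odot> y)" using m xy z by (simp add: M_memD(5) mult_assoc)
    finally show "z \<odot> (fst m (x \<odot> y) \<ominus> fst m x \<odot> y) = zero"
      using m xy z by (simp add: mult_sub M_memD(5))
  qed (use m xy in \<open>simp add: M_memD\<close>)
  then show ?thesis using m xy by (simp add: sub_eq_zero M_memD)
qed

text \<open>The involution exchanges the two components, so this is \<open>fst_mult\<close> for the
  adjoint multiplier.\<close>

lemma snd_mult:
  assumes m: "m \<in> cs_carrier M" and xy: "x \<in> C" "y \<in> C"
  shows "snd m (x \<odot> y) = x \<odot> snd m y"
proof -
  have "fst (cs_star M m) (adj y \<odot> adj x) = fst (cs_star M m) (adj y) \<odot> adj x"
    using m xy by (intro fst_mult) auto
  then have "adj (adj (snd m (x \<odot> y))) = adj (adj (snd m y) \<odot> adj x)"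
    using m xy by (simp add: M_apply adj_mult)
  then show ?thesis using m xy by (simp add: M_memD adj_mult)
qed

text \<open>With \<open>M_emb_mult\<close> below, this makes the image of A a two-sided ideal and
  reduces products with it to evaluation of the components.\<close>

lemma M_mult_emb: "m \<in> cs_carrier M \<Longrightarrow> a \<in> C \<Longrightarrow> cs_mult M m (mult_emb A a) = mult_emb A (fst m a)"
  by (rule M_eqI) (simp_all add: M_apply M_memD fst_mult)

lemma M_emb_mult: "m \<in> cs_carrier M \<Longrightarrow> a \<in> C \<Longrightarrow> cs_mult M (mult_emb A a) m = mult_emb A (snd m a)"
  by (rule M_eqI) (simp_all add: M_apply M_memD snd_mult)

lemma M_emb_add: "a \<in> C \<Longrightarrow> b \<in> C \<Longrightarrow> mult_emb A (a \<oplus> b) = cs_add M (mult_emb A a) (mult_emb A b)"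
  by (rule M_eqI) (simp_all add: M_apply mult_add add_mult)

lemma M_emb_emb: "a \<in> C \<Longrightarrow> b \<in> C \<Longrightarrow> mult_emb A (a \<odot> b) = cs_mult M (mult_emb A a) (mult_emb A b)"
  by (rule M_eqI) (simp_all add: M_apply mult_assoc)

lemma M_emb_minus: "a \<in> C \<Longrightarrow> b \<in> C \<Longrightarrow> mult_emb A (a \<ominus> b) = cs_minus M (mult_emb A a) (mult_emb A b)"
  by (rule M_eqI) (simp_all add: M_apply M_minus_apply sub_mult mult_sub)

lemma M_emb_adj: "a \<in> C \<Longrightarrow> mult_emb A (adj a) = cs_star M (mult_emb A a)"
  by (rule M_eqI) (simp_all add: M_apply adj_mult)

lemma M_emb_zero: "mult_emb A zero = cs_zero M"
  by (rule M_eqI) (simp_all add: M_apply)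

lemma M_add_assoc: "m1 \<in> cs_carrier M \<Longrightarrow> m2 \<in> cs_carrier M \<Longrightarrow> m3 \<in> cs_carrier M \<Longrightarrow>
    cs_add M (cs_add M m1 m2) m3 = cs_add M m1 (cs_add M m2 m3)"
  by (rule M_eqI) (simp_all add: M_memD(5,6) M_apply add_assoc)

lemma M_add_commute: "m1 \<in> cs_carrier M \<Longrightarrow> m2 \<in> cs_carrier M \<Longrightarrow> cs_add M m1 m2 = cs_add M m2 m1"
  by (rule M_eqI) (simp_all add: M_memD(5,6) M_apply add_commute)

lemma M_add_zero: "m \<in> cs_carrier M \<Longrightarrow> cs_add M (cs_zero M) m = m"
  by (rule M_eqI) (simp_all add: M_memD(5,6) M_apply)

lemma M_add_neg: "m \<in> cs_carrier M \<Longrightarrow> cs_add M (cs_smult M (-1) m) m = cs_zero M"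
  by (rule M_eqI) (simp_all add: M_memD(5,6) M_apply add_commute[of "smult (-1) x" for x])

lemma M_mult_assoc: "m1 \<in> cs_carrier M \<Longrightarrow> m2 \<in> cs_carrier M \<Longrightarrow> m3 \<in> cs_carrier M \<Longrightarrow>
    cs_mult M (cs_mult M m1 m2) m3 = cs_mult M m1 (cs_mult M m2 m3)"
  by (rule M_eqI) (simp_all add: M_memD(5,6) M_apply)

lemma M_mult_add: "m1 \<in> cs_carrier M \<Longrightarrow> m2 \<in> cs_carrier M \<Longrightarrow> m3 \<in> cs_carrier M \<Longrightarrow>
    cs_mult M m1 (cs_add M m2 m3) = cs_add M (cs_mult M m1 m2) (cs_mult M m1 m3)"
  by (rule M_eqI) (simp_all add: M_memD(5-8) M_apply)

lemma M_add_mult: "m1 \<in> cs_carrier M \<Longrightarrow> m2 \<in> cs_carrier M \<Longrightarrow> m3 \<in> cs_carrier M \<Longrightarrow>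
    cs_mult M (cs_add M m1 m2) m3 = cs_add M (cs_mult M m1 m3) (cs_mult M m2 m3)"
  by (rule M_eqI) (simp_all add: M_memD(5-8) M_apply)

lemma M_one_mult: "m \<in> cs_carrier M \<Longrightarrow> cs_mult M one m = m"
  by (rule M_eqI) (simp_all add: M_memD(5,6) M_apply)

lemma M_mult_one: "m \<in> cs_carrier M \<Longrightarrow> cs_mult M m one = m"
  by (rule M_eqI) (simp_all add: M_memD(5,6) M_apply)

lemma M_star_star: "m \<in> cs_carrier M \<Longrightarrow> cs_star M (cs_star M m) = m"
  by (rule M_eqI) (simp_all add: M_memD(5,6) M_apply)

lemma M_star_add: "m1 \<in> cs_carrier M \<Longrightarrow> m2 \<in> cs_carrier M \<Longrightarrow>
    cs_star M (cs_add M m1 m2) = cs_add M (cs_star M m1) (cs_star M m2)"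
  by (rule M_eqI) (simp_all add: M_memD(5,6) M_apply adj_add)

lemma M_star_mult: "m1 \<in> cs_carrier M \<Longrightarrow> m2 \<in> cs_carrier M \<Longrightarrow>
    cs_star M (cs_mult M m1 m2) = cs_mult M (cs_star M m2) (cs_star M m1)"
  by (rule M_eqI) (simp_all add: M_memD(5,6) M_apply)

lemma M_scalar_mult: "m \<in> cs_carrier M \<Longrightarrow> cs_mult M (cs_smult M c one) m = cs_smult M c m"
  by (rule M_eqI) (simp_all add: M_memD(5,6,9,10) M_apply)

lemma M_mult_scalar: "m \<in> cs_carrier M \<Longrightarrow> cs_mult M m (cs_smult M c one) = cs_smult M c m"
  by (rule M_eqI) (simp_all add: M_memD(5,6,9,10) M_apply)

lemma M_scalar_add: "cs_smult M (c + d) one = cs_add M (cs_smult M c one) (cs_smult M d one)"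
  by (rule M_eqI) (simp_all add: M_apply smult_plus)

lemma M_scalar_scalar: "cs_smult M (c * d) one = cs_mult M (cs_smult M c one) (cs_smult M d one)"
  by (rule M_eqI) (simp_all add: M_apply smult_smult mult.commute)

lemma M_scalar_1: "cs_smult M 1 one = one"
  by (rule M_eqI) (simp_all add: M_apply)

lemma M_scalar_star: "cs_star M (cs_smult M c one) = cs_smult M (cnj c) one"
  by (rule M_eqI) (simp_all add: M_apply adj_smult)


section \<open>The operator norm on multipliers and strict completeness\<close>

lemma nrm_M: "cs_nrm M m = Sup {nm (fst m x) | x. x \<in> C \<and> nm x \<le> 1}"
  by (simp add: mult_alg_def Let_def)

lemma nrm_least: "(\<And>x. x \<in> C \<Longrightarrow> nm x \<le> 1 \<Longrightarrow> nm (fst m x) \<le> c) \<Longrightarrow> cs_nrm M m \<le> c"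
  unfolding nrm_M by (rule cSup_least) (auto intro!: exI[of _ zero])

lemma nrm_upper:
  assumes m: "m \<in> cs_carrier M" and x: "x \<in> C" "nm x \<le> 1"
  shows "nm (fst m x) \<le> cs_nrm M m"
  unfolding nrm_M
proof (rule cSup_upper)
  obtain K where K: "0 \<le> K" "\<And>x. x \<in> C \<Longrightarrow> nm (fst m x) \<le> K * nm x"
    using bdd_linear_bound[OF M_memD(1)[OF m]] by blast
  have "nm (fst m y) \<le> K" if "y \<in> C" "nm y \<le> 1" for y
    using K(2)[OF that(1)] mult_left_mono[OF that(2) K(1)] by simp
  then show "bdd_above {nm (fst m x) |x. x \<in> C \<and> nm x \<le> 1}" by (auto intro!: bdd_aboveI[of _ K])
qed (use x in blast)

lemma nrm_nonneg: "m \<in> cs_carrier M \<Longrightarrow> 0 \<le> cs_nrm M m"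
  by (rule order_trans[OF nm_nonneg nrm_upper[of m zero]]) (simp_all add: M_memD(5))

lemma nrm_apply:
  assumes m: "m \<in> cs_carrier M" and x: "x \<in> C"
  shows "nm (fst m x) \<le> cs_nrm M m * nm x"
proof (cases "nm x = 0")
  case True
  \<comment> \<open>Written as a scalar multiple, zero is sent to zero by homogeneity.\<close>
  then have "x = smult 0 zero" using x by (simp add: nm_eq_0)
  then have "fst m x = zero" using M_memD(9)[OF m, of zero 0] M_memD(5)[OF m, of zero] by simp
  then show ?thesis using True by simp
next
  case False
  then have pos: "0 < nm x" using nm_nonneg[OF x] by linarith
  let ?y = "smult (complex_of_real (1 / nm x)) x"
  have "nm ?y = 1" using x pos by (simp add: nm_smult norm_divide)
  then have "nm (fst m ?y) \<le> cs_nrm M m" using nrm_upper[OF m, of ?y] x by simp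
  moreover have "nm (fst m ?y) = nm (fst m x) / nm x"
    using M_memD(9)[OF m x] M_memD(5)[OF m x] pos by (simp add: nm_smult norm_divide)
  ultimately have "nm (fst m x) / nm x \<le> cs_nrm M m" by (simp only:)
  then show ?thesis using pos by (simp only: pos_divide_le_eq)
qed

lemma nrm_add:
  assumes "m1 \<in> cs_carrier M" "m2 \<in> cs_carrier M"
  shows "cs_nrm M (cs_add M m1 m2) \<le> cs_nrm M m1 + cs_nrm M m2"
proof (rule nrm_least)
  fix x assume x: "x \<in> C" "nm x \<le> 1"
  have "nm (fst m1 x \<oplus> fst m2 x) \<le> nm (fst m1 x) + nm (fst m2 x)"
    using assms x by (intro nm_add M_memD(5))
  then show "nm (fst (cs_add M m1 m2) x) \<le> cs_nrm M m1 + cs_nrm M m2"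
    using nrm_upper[OF assms(1) x] nrm_upper[OF assms(2) x] x by (simp add: M_apply)
qed

lemma nrm_mult:
  assumes "m1 \<in> cs_carrier M" "m2 \<in> cs_carrier M"
  shows "cs_nrm M (cs_mult M m1 m2) \<le> cs_nrm M m1 * cs_nrm M m2"
proof (rule nrm_least)
  fix x assume x: "x \<in> C" "nm x \<le> 1"
  have "nm (fst m1 (fst m2 x)) \<le> cs_nrm M m1 * nm (fst m2 x)"
    using assms x by (intro nrm_apply M_memD(5))
  also have "\<dots> \<le> cs_nrm M m1 * cs_nrm M m2"
    by (intro mult_left_mono nrm_upper nrm_nonneg assms x)
  finally show "nm (fst (cs_mult M m1 m2) x) \<le> cs_nrm M m1 * cs_nrm M m2" using x by (simp add: M_apply)
qed

lemma nrm_smult: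
  assumes m: "m \<in> cs_carrier M"
  shows "cs_nrm M (cs_smult M c m) = cmod c * cs_nrm M m"
proof -
  have le: "cs_nrm M (cs_smult M c m) \<le> cmod c * cs_nrm M m" if "m \<in> cs_carrier M" for c m
  proof (rule nrm_least)
    fix x assume x: "x \<in> C" "nm x \<le> 1"
    show "nm (fst (cs_smult M c m) x) \<le> cmod c * cs_nrm M m"
      using nrm_upper[OF that x] x M_memD(5)[OF that x(1)] by (simp add: M_apply nm_smult mult_left_mono)
  qed
  show ?thesis
  proof (cases "c = 0")
    case True
    then show ?thesis using le[OF m, of c] nrm_nonneg[of "cs_smult M c m"] m by simp
  next
    case False
    have "cs_smult M (1 / c) (cs_smult M c m) = m"
      by (rule M_eqI) (use m False in \<open>simp_all add: M_apply smult_smult M_memD(5,6)\<close>)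
    then have "cs_nrm M m \<le> cmod (1 / c) * cs_nrm M (cs_smult M c m)" using le[of "cs_smult M c m" "1 / c"] m by simp
    then have "cmod c * cs_nrm M m \<le> cs_nrm M (cs_smult M c m)"
      using False by (simp add: norm_divide field_simps)
    with le[OF m, of c] show ?thesis by simp
  qed
qed

text \<open>For x in the unit ball the centralizer identity rewrites
  \<open>adj (fst m x) \<odot> fst m x\<close> as \<open>adj x\<close> times the value of the
  product at x. This gives one inequality of the C*-identity, which with submultiplicativity already
  yields the isometry of the star; that in turn gives the other inequality.\<close>

lemma nrm_cstar:
  assumes m: "m \<in> cs_carrier M"
  shows "cs_nrm M (cs_mult M (cs_star M m) m) = (cs_nrm M m)\<^sup>2"
    and nrm_star: "cs_nrm M (cs_star M m) = cs_nrm M m"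
proof -
  have sq: "(cs_nrm M m)\<^sup>2 \<le> cs_nrm M (cs_mult M (cs_star M m) m)" if m: "m \<in> cs_carrier M" for m
  proof -
    let ?mm = "cs_mult M (cs_star M m) m"
    have mm: "?mm \<in> cs_carrier M" using m by simp
    have "cs_nrm M m \<le> sqrt (cs_nrm M ?mm)"
    proof (rule nrm_least)
      fix x assume x: "x \<in> C" "nm x \<le> 1"
      have "adj (fst m x) \<odot> fst m x = snd (cs_star M m) (adj x) \<odot> fst m x"
        using x by (simp add: M_apply)
      also have "\<dots> = adj x \<odot> fst (cs_star M m) (fst m x)"
        using m x by (intro M_memD(11)[symmetric]) (simp_all add: M_memD(5))
      also have "\<dots> = adj x \<odot> fst ?mm x" using x by (simp add: M_apply(7))
      finally have "(nm (fst m x))\<^sup>2 = nm (adj x \<odot> fst ?mm x)"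
        using nm_cstar[OF M_memD(5)[OF m x(1)]] by simp
      also have "\<dots> \<le> nm x * nm (fst ?mm x)"
        using nm_mult[of "adj x" "fst ?mm x"] x M_memD(5)[OF mm x(1)] by simp
      also have "\<dots> \<le> 1 * cs_nrm M ?mm"
        using x nrm_upper[OF mm x] M_memD(5)[OF mm x(1)] by (intro mult_mono) auto
      finally show "nm (fst m x) \<le> sqrt (cs_nrm M ?mm)" by (simp add: real_le_rsqrt)
    qed
    then have "(cs_nrm M m)\<^sup>2 \<le> (sqrt (cs_nrm M ?mm))\<^sup>2"
      using nrm_nonneg[OF m] by (intro power_mono)
    then show ?thesis using nrm_nonneg[OF mm] by simp
  qed
  have le: "cs_nrm M m \<le> cs_nrm M (cs_star M m)" if m: "m \<in> cs_carrier M" for m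
  proof (cases "cs_nrm M m = 0")
    case True
    then show ?thesis using nrm_nonneg[OF M_star[OF m]] by simp
  next
    case False
    then have pos: "0 < cs_nrm M m" using nrm_nonneg[OF m] by linarith
    have "cs_nrm M m * cs_nrm M m \<le> cs_nrm M (cs_star M m) * cs_nrm M m"
      using sq[OF m] nrm_mult[OF M_star[OF m] m] by (simp add: power2_eq_square)
    then show ?thesis using pos by simp
  qed
  show st: "cs_nrm M (cs_star M m) = cs_nrm M m"
    using le[OF m] le[OF M_star[OF m]] M_star_star[OF m] by simp
  show "cs_nrm M (cs_mult M (cs_star M m) m) = (cs_nrm M m)\<^sup>2"
    using sq[OF m] nrm_mult[OF M_star[OF m] m] st by (simp add: power2_eq_square)
qed

text \<open>The norm is defined by the first component alone; isometry of the star carries the bound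
  over to the second.\<close>

lemma nrm_apply_snd:
  assumes m: "m \<in> cs_carrier M" and x: "x \<in> C"
  shows "nm (snd m x) \<le> cs_nrm M m * nm x"
  using nrm_apply[OF M_star[OF m], of "adj x"] m x by (simp add: M_apply M_memD(6) nrm_star)

lemma nrm_emb:
  assumes a: "a \<in> C"
  shows "cs_nrm M (mult_emb A a) = nm a"
proof (rule antisym)
  show "cs_nrm M (mult_emb A a) \<le> nm a"
  proof (rule nrm_least)
    fix x assume x: "x \<in> C" "nm x \<le> 1"
    then have "nm (a \<odot> x) \<le> nm a * 1"
      using nm_mult[OF a x(1)] mult_left_mono[OF x(2) nm_nonneg[OF a]] by simp
    then show "nm (fst (mult_emb A a) x) \<le> nm a" using x by (simp add: M_apply)
  qed
  have "nm a * nm a = nm (fst (mult_emb A a) (adj a))"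
    using a nm_cstar[of "adj a"] by (simp add: M_apply power2_eq_square)
  also have "\<dots> \<le> cs_nrm M (mult_emb A a) * nm a" using nrm_apply[OF M_emb[OF a], of "adj a"] a by simp
  finally show "nm a \<le> cs_nrm M (mult_emb A a)"
    using nm_nonneg[OF a] nrm_nonneg[OF M_emb[OF a]] by (cases "nm a = 0") (auto simp: mult_le_cancel_right)
qed

lemma bdd_linear_limit:
  assumes T: "\<And>k. bdd_linear_on A (T k)" "\<And>k x. x \<in> C \<Longrightarrow> nm (T k x) \<le> c * nm x"
    and L: "L \<in> extensional C" "\<And>x. x \<in> C \<Longrightarrow> conv (\<lambda>k. T k x) (L x)"
  shows "bdd_linear_on A L"
proof (rule bdd_linearI[OF L(1), where K = c])
  have T': "x \<in> C \<Longrightarrow> T k x \<in> C" "x \<in> C \<Longrightarrow> y \<in> C \<Longrightarrow> T k (x \<oplus> y) = T k x \<oplus> T k y"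
    "x \<in> C \<Longrightarrow> T k (smult d x) = smult d (T k x)" for d k x y
    using T(1)[of k] by (auto simp: bdd_linear_on_def)
  fix x assume x: "x \<in> C"
  show "L x \<in> C" using L(2)[OF x] by (simp add: conv_def)
  show "L (x \<oplus> y) = L x \<oplus> L y" if y: "y \<in> C" for y
    using conv_add[OF L(2)[OF x] L(2)[OF y]] L(2)[of "x \<oplus> y"] x y
    by (intro conv_unique[of "\<lambda>k. T k (x \<oplus> y)"]) (simp_all add: T')
  show "L (smult d x) = smult d (L x)" for d
    using conv_smult[OF L(2)[OF x]] L(2)[of "smult d x"] x
    by (intro conv_unique[of "\<lambda>k. T k (smult d x)"]) (simp_all add: T')
  show "nm (L x) \<le> c * nm x" by (rule conv_bound[OF L(2)[OF x] T(2)[OF x]])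
qed

text \<open>Completeness of A gives pointwise limits of both components. Linearity and the
  centralizer identity pass to the limits, and the uniform bound c makes them bounded.\<close>

lemma M_strictly_complete:
  assumes S: "\<And>k. S k \<in> cs_carrier M" "\<And>k. cs_nrm M (S k) \<le> c"
    and Cf: "\<And>a \<epsilon>. a \<in> C \<Longrightarrow> 0 < \<epsilon> \<Longrightarrow> \<exists>N. \<forall>i\<ge>N. \<forall>j\<ge>N. nm (fst (S i) a \<ominus> fst (S j) a) < \<epsilon>"
    and Cs: "\<And>a \<epsilon>. a \<in> C \<Longrightarrow> 0 < \<epsilon> \<Longrightarrow> \<exists>N. \<forall>i\<ge>N. \<forall>j\<ge>N. nm (snd (S i) a \<ominus> snd (S j) a) < \<epsilon>"
  obtains s where "s \<in> cs_carrier M" "\<And>a. a \<in> C \<Longrightarrow> conv (\<lambda>k. fst (S k) a) (fst s a)"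
    "\<And>a. a \<in> C \<Longrightarrow> conv (\<lambda>k. snd (S k) a) (snd s a)"
proof -
  have ex: "\<forall>a\<in>C. \<exists>l. conv (\<lambda>k. fst (S k) a) l" "\<forall>a\<in>C. \<exists>l. conv (\<lambda>k. snd (S k) a) l"
    using complete[of "\<lambda>k. fst (S k) a" for a, OF M_memD(5)[OF S(1)] Cf]
      complete[of "\<lambda>k. snd (S k) a" for a, OF M_memD(6)[OF S(1)] Cs]
    by (auto simp: conv_def M_memD(5,6)[OF S(1)] Bex_def)
  obtain L R where L: "\<And>a. a \<in> C \<Longrightarrow> conv (\<lambda>k. fst (S k) a) (L a)"
    and R: "\<And>a. a \<in> C \<Longrightarrow> conv (\<lambda>k. snd (S k) a) (R a)"
    using bchoice[OF ex(1)] bchoice[OF ex(2)] by blast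
  define s where "s = (restrict L C, restrict R C)"
  have s: "\<And>a. a \<in> C \<Longrightarrow> conv (\<lambda>k. fst (S k) a) (fst s a)"
    "\<And>a. a \<in> C \<Longrightarrow> conv (\<lambda>k. snd (S k) a) (snd s a)"
    using L R by (simp_all add: s_def)
  have ext: "fst s \<in> extensional C" "snd s \<in> extensional C"
    unfolding s_def fst_conv snd_conv by (rule restrict_extensional)+
  have bound: "cs_nrm M (S k) * nm x \<le> c * nm x" if "x \<in> C" for k x
    using S(2) that by (intro mult_right_mono) auto
  have "s \<in> cs_carrier M"
  proof (rule double_centralizerI)
    show "bdd_linear_on A (fst s)"
    proof (rule bdd_linear_limit[OF M_memD(1)[OF S(1)] _ _ s(1)])
      fix k x assume x: "x \<in> C"
      show "nm (fst (S k) x) \<le> c * nm x" by (rule order_trans[OF nrm_apply[OF S(1) x] bound[OF x]])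
    qed (rule ext)
    show "bdd_linear_on A (snd s)"
    proof (rule bdd_linear_limit[OF M_memD(2)[OF S(1)] _ _ s(2)])
      fix k x assume x: "x \<in> C"
      show "nm (snd (S k) x) \<le> c * nm x" by (rule order_trans[OF nrm_apply_snd[OF S(1) x] bound[OF x]])
    qed (rule ext)
    fix x y assume xy: "x \<in> C" "y \<in> C"
    show "x \<odot> fst s y = snd s x \<odot> y"
      using conv_mult_left[OF s(1)[OF xy(2)] xy(1)] conv_mult_right[OF s(2)[OF xy(1)] xy(2)]
      by (intro conv_unique[of "\<lambda>k. x \<odot> fst (S k) y"]) (simp_all add: M_memD(11)[OF S(1) xy])
  qed
  then show ?thesis using s that by blast
qed

end

section \<open>Separable subalgebras\<close>

lemma countable_dense_complex:
  obtains Q :: "complex set" where "countable Q" "\<And>c \<epsilon>. 0 < \<epsilon> \<Longrightarrow> \<exists>r\<in>Q. cmod (c - r) < \<epsilon>"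
proof
  let ?Q = "(\<lambda>(a, b). Complex a b) ` (\<rat> \<times> \<rat>)"
  show "countable ?Q" by (intro countable_image countable_SIGMA countable_rat)
  fix c :: complex and \<epsilon> :: real assume \<epsilon>: "0 < \<epsilon>"
  have rat: "\<exists>a\<in>\<rat>. \<bar>x - a\<bar> < \<epsilon> / 2" for x :: real
  proof -
    obtain a where "a \<in> \<rat>" "x - \<epsilon>/2 < a" "a < x + \<epsilon>/2"
      using Rats_dense_in_real[of "x - \<epsilon>/2" "x + \<epsilon>/2"] \<epsilon> by auto
    then show ?thesis by (intro bexI[of _ a]) linarith+
  qed
  obtain a b where ab: "a \<in> \<rat>" "\<bar>Re c - a\<bar> < \<epsilon> / 2" "b \<in> \<rat>" "\<bar>Im c - b\<bar> < \<epsilon> / 2"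
    using rat[of "Re c"] rat[of "Im c"] by blast
  then have "cmod (c - Complex a b) < \<epsilon>"
    using cmod_le[of "c - Complex a b"] by simp
  then show "\<exists>r\<in>?Q. cmod (c - r) < \<epsilon>" using ab(1,3) by auto
qed

context cstar_seminorm
begin

definition ncl :: "'b set \<Rightarrow> 'b set" where
  "ncl D = {x. \<forall>\<epsilon>>0. \<exists>d\<in>D. n (x - d) < \<epsilon>}"

lemma subset_ncl: "D \<subseteq> ncl D"
  unfolding ncl_def by (auto intro!: bexI)

lemma ncl_limit:
  assumes "\<And>\<epsilon>. 0 < \<epsilon> \<Longrightarrow> \<exists>y\<in>ncl D. n (x - y) < \<epsilon>"
  shows "x \<in> ncl D"
  unfolding ncl_def
proof (intro CollectI allI impI)
  fix \<epsilon> :: real assume "0 < \<epsilon>"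
  then have \<epsilon>: "0 < \<epsilon> / 2" by simp
  obtain y where y: "y \<in> ncl D" "n (x - y) < \<epsilon> / 2" using assms[OF \<epsilon>] by blast
  obtain d where d: "d \<in> D" "n (y - d) < \<epsilon> / 2" using y(1) \<epsilon> unfolding ncl_def by blast
  have "n (x - d) < \<epsilon>" using n_add[of "x - y" "y - d"] y(2) d(2) by simp
  then show "\<exists>d\<in>D. n (x - d) < \<epsilon>" using d by blast
qed

text \<open>Iterating the operations, with scalars from a countable dense set, keeps the set
  countable. Continuity of the operations then makes its closure a subalgebra over all complex
  scalars.\<close>

lemma separable_generated:
  assumes D: "countable D"
  obtains D' where "countable D'" "D \<subseteq> D'" "0 \<in> D'"
    "\<And>x y. x \<in> ncl D' \<Longrightarrow> y \<in> ncl D' \<Longrightarrow> x + y \<in> ncl D'"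
    "\<And>x y. x \<in> ncl D' \<Longrightarrow> y \<in> ncl D' \<Longrightarrow> x * y \<in> ncl D'"
    "\<And>x. x \<in> ncl D' \<Longrightarrow> st x \<in> ncl D'"
    "\<And>x c. x \<in> ncl D' \<Longrightarrow> sc c * x \<in> ncl D'"
proof -
  obtain Q :: "complex set" where Q: "countable Q" "\<And>c \<epsilon>. 0 < \<epsilon> \<Longrightarrow> \<exists>r\<in>Q. cmod (c - r) < \<epsilon>"
    using countable_dense_complex by blast
  define step where "step G = G \<union> (\<lambda>(x, y). x + y) ` (G \<times> G) \<union> (\<lambda>(x, y). x * y) ` (G \<times> G)
      \<union> st ` G \<union> (\<lambda>(c, x). sc c * x) ` (Q \<times> G)" for G
  define G where "G i = (step ^^ i) (insert 0 D)" for i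
  define D' where "D' = (\<Union>i. G i)"
  have "countable (G i)" for i
    by (induction i) (auto simp: G_def step_def D Q(1) intro!: countable_image countable_SIGMA)
  then have cnt: "countable D'" unfolding D'_def by (intro countable_UN) auto
  have G_Suc: "G (Suc i) = step (G i)" for i by (simp add: G_def)
  have mono: "G i \<subseteq> G j" if "i \<le> j" for i j
    using that by (rule lift_Suc_mono_le[rotated]) (auto simp: G_Suc step_def)
  have both: "\<exists>i. x \<in> G i \<and> y \<in> G i" if "x \<in> D'" "y \<in> D'" for x y
  proof -
    obtain i j where "x \<in> G i" "y \<in> G j" using \<open>x \<in> D'\<close> \<open>y \<in> D'\<close> unfolding D'_def by blast
    then show ?thesis using mono[of i "max i j"] mono[of j "max i j"] by (intro exI[of _ "max i j"]) auto
  qed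
  have stepI: "z \<in> D'" if "z \<in> step (G i)" for z i using that unfolding D'_def G_Suc[symmetric] by blast
  have step_closed: "x \<in> H \<Longrightarrow> y \<in> H \<Longrightarrow> x + y \<in> step H" "x \<in> H \<Longrightarrow> y \<in> H \<Longrightarrow> x * y \<in> step H"
    "x \<in> H \<Longrightarrow> st x \<in> step H" "c \<in> Q \<Longrightarrow> x \<in> H \<Longrightarrow> sc c * x \<in> step H" for x y c H
    unfolding step_def by force+
  have add: "x + y \<in> D'" and mult: "x * y \<in> D'" if xy: "x \<in> D'" "y \<in> D'" for x y
  proof -
    obtain i where "x \<in> G i" "y \<in> G i" using both[OF xy] by blast
    then show "x + y \<in> D'" "x * y \<in> D'" by (rule stepI[OF step_closed(1)] stepI[OF step_closed(2)])+
  qed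
  have star: "st x \<in> D'" and scal: "c \<in> Q \<Longrightarrow> sc c * x \<in> D'" if x: "x \<in> D'" for x c
  proof -
    obtain i where i: "x \<in> G i" using both[OF x x] by blast
    show "st x \<in> D'" by (rule stepI[OF step_closed(3)[OF i]])
    show "sc c * x \<in> D'" if "c \<in> Q" by (rule stepI[OF step_closed(4)[OF that i]])
  qed
  have appr: "\<exists>d\<in>D'. n (x - d) < \<epsilon>" if "x \<in> ncl D'" "0 < \<epsilon>" for x \<epsilon>
    using that unfolding ncl_def by blast
  have clI: "x \<in> ncl D'" if "\<And>\<epsilon>. 0 < \<epsilon> \<Longrightarrow> \<exists>d\<in>D'. n (x - d) < \<epsilon>" for x
    using that unfolding ncl_def by blast
  show ?thesis
  proof (rule that[OF cnt])
    show "D \<subseteq> D'" "0 \<in> D'" unfolding D'_def by (auto simp: G_def intro!: exI[of _ 0])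
  next
    fix x y assume xy: "x \<in> ncl D'" "y \<in> ncl D'"
    show "x + y \<in> ncl D'"
    proof (rule clI)
      fix \<epsilon> :: real assume "0 < \<epsilon>"
      then have \<epsilon>: "0 < \<epsilon> / 2" by simp
      obtain d d' where d: "d \<in> D'" "n (x - d) < \<epsilon> / 2" "d' \<in> D'" "n (y - d') < \<epsilon> / 2"
        using appr[OF xy(1) \<epsilon>] appr[OF xy(2) \<epsilon>] by blast
      have "n ((x + y) - (d + d')) < \<epsilon>"
        using n_add[of "x - d" "y - d'"] d by (simp add: algebra_simps)
      then show "\<exists>d\<in>D'. n (x + y - d) < \<epsilon>" using add d by blast
    qed
    show "x * y \<in> ncl D'"
    proof (rule clI)
      fix \<epsilon> :: real assume \<epsilon>: "0 < \<epsilon>"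
      \<comment> \<open>The cap 1 bounds the norm of the approximant by n y + 1. The resulting error
        is at most \<open>\<delta> * (1 + n x + n y)\<close>, and the 2 in the denominator leaves
        strict room below \<open>\<epsilon>\<close>.\<close>
      define \<delta> where "\<delta> = min 1 (\<epsilon> / (2 + n x + n y))"
      have pos: "0 < 2 + n x + n y" by (simp add: add_pos_nonneg)
      have \<delta>: "0 < \<delta>" "\<delta> \<le> 1" "\<delta> * (2 + n x + n y) \<le> \<epsilon>"
        using \<epsilon> pos by (simp_all add: \<delta>_def min_le_iff_disj pos_le_divide_eq[symmetric])
      obtain d d' where d: "d \<in> D'" "n (x - d) < \<delta>" "d' \<in> D'" "n (y - d') < \<delta>"
        using appr[OF xy(1) \<delta>(1)] appr[OF xy(2) \<delta>(1)] by blast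
      have d': "n d' \<le> n y + \<delta>" using n_diff[of y "y - d'"] d(4) by simp
      have "x * y - d * d' = x * (y - d') + (x - d) * d'" by (simp add: algebra_simps)
      then have "n (x * y - d * d') \<le> n (x * (y - d')) + n ((x - d) * d')" by (simp only: n_add)
      also have "\<dots> \<le> n x * \<delta> + \<delta> * (n y + \<delta>)"
        using d d' by (intro add_mono n_mult_mono) auto
      also have "\<dots> \<le> \<delta> * (1 + n x + n y)" using \<delta> by (simp add: algebra_simps mult_left_le)
      also have "\<dots> < \<delta> * (2 + n x + n y)" using \<delta> by simp
      finally show "\<exists>d\<in>D'. n (x * y - d) < \<epsilon>" using mult d \<delta>(3) by (intro bexI[of _ "d * d'"]) auto
    qed
  next
    fix x assume x: "x \<in> ncl D'"
    show "st x \<in> ncl D'"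
    proof (rule clI)
      fix \<epsilon> :: real assume \<epsilon>: "0 < \<epsilon>"
      obtain d where d: "d \<in> D'" "n (x - d) < \<epsilon>" using appr[OF x \<epsilon>] by blast
      then have "n (st x - st d) < \<epsilon>" by (simp flip: st_diff)
      then show "\<exists>d\<in>D'. n (st x - d) < \<epsilon>" using star d by blast
    qed
    fix c
    show "sc c * x \<in> ncl D'"
    proof (rule clI)
      fix \<epsilon> :: real assume \<epsilon>: "0 < \<epsilon>"
      define \<delta> where "\<delta> = min 1 (\<epsilon> / (2 + n x + cmod c))"
      have pos: "0 < 2 + n x + cmod c" by (simp add: add_pos_nonneg)
      have \<delta>: "0 < \<delta>" "\<delta> \<le> 1" "\<delta> * (2 + n x + cmod c) \<le> \<epsilon>"
        using \<epsilon> pos by (simp_all add: \<delta>_def min_le_iff_disj pos_le_divide_eq[symmetric])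
      obtain d where d: "d \<in> D'" "n (x - d) < \<delta>" using appr[OF x \<delta>(1)] by blast
      obtain r where r: "r \<in> Q" "cmod (c - r) < \<delta>" using Q(2)[OF \<delta>(1)] by blast
      have d': "n d \<le> n x + \<delta>" using n_diff[of x "x - d"] d(2) by simp
      have "sc c = sc (c - r) + sc r" by (simp add: sc_add[symmetric])
      then have "sc c * x - sc r * d = sc c * (x - d) + sc (c - r) * d" by (simp add: algebra_simps)
      then have "n (sc c * x - sc r * d) \<le> cmod c * n (x - d) + cmod (c - r) * n d"
        using n_add[of "sc c * (x - d)" "sc (c - r) * d"] by simp
      also have "\<dots> \<le> cmod c * \<delta> + \<delta> * (n x + \<delta>)"
        using d d' r \<delta> by (intro add_mono mult_mono) auto
      also have "\<dots> \<le> \<delta> * (1 + n x + cmod c)" using \<delta> by (simp add: algebra_simps mult_left_le)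
      also have "\<dots> < \<delta> * (2 + n x + cmod c)" using \<delta> by simp
      finally show "\<exists>d\<in>D'. n (sc c * x - d) < \<epsilon>" using scal d r \<delta>(3) by (intro bexI[of _ "sc r * d"]) auto
    qed
  qed
qed

end

section \<open>Multiplier algebras as a ring type\<close>

text \<open>An element of this type chooses a multiplier for every C*-algebra on the type \<open>'a\<close> at
  once. The pointwise operations make it a unital ring, so that ring identities in a single
  multiplier algebra, whose carrier is only a set, can be computed in a type class.\<close>

typedef 'a mfam = "{F :: 'a cstar \<Rightarrow> 'a mult.
    \<forall>A. if is_cstar A then F A \<in> cs_carrier (mult_alg A) else F A = undefined}"
  morphisms coord Abs_mfam
  using cstar_alg.M_zero[OF cstar_alg.intro]
  by (intro exI[of _ "\<lambda>A. if is_cstar A then cs_zero (mult_alg A) else undefined"]) auto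

definition fam :: "('a cstar \<Rightarrow> 'a mult) \<Rightarrow> 'a mfam" where
  "fam F = Abs_mfam (\<lambda>A. if is_cstar A then F A else undefined)"

lemma coord_mem [simp]: "is_cstar A \<Longrightarrow> coord x A \<in> cs_carrier (mult_alg A)"
  using coord[of x] by (auto split: if_splits)

lemma coord_fam:
  assumes "\<And>A. is_cstar A \<Longrightarrow> F A \<in> cs_carrier (mult_alg A)" "is_cstar A"
  shows "coord (fam F) A = F A"
  unfolding fam_def using assms by (subst Abs_mfam_inverse) auto

text \<open>The fixed value \<open>undefined\<close> at records that are not C*-algebras lets the
  remaining coordinates decide equality.\<close>

lemma mfam_eqI:
  assumes "\<And>A. is_cstar A \<Longrightarrow> coord x A = coord y A"
  shows "x = y"
proof -
  have "coord x A = coord y A" for A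
    using assms[of A] coord[of x] coord[of y] by (cases "is_cstar A") auto
  then show ?thesis by (simp add: coord_inject[symmetric] fun_eq_iff)
qed

instantiation mfam :: (type) "{ring, monoid_mult}"
begin

definition "0 = fam (\<lambda>A. cs_zero (mult_alg A))"
definition "1 = fam (\<lambda>A. cstar_alg.one A)"
definition "x + y = fam (\<lambda>A. cs_add (mult_alg A) (coord x A) (coord y A))"
definition "x * y = fam (\<lambda>A. cs_mult (mult_alg A) (coord x A) (coord y A))"
definition "- x = fam (\<lambda>A. cs_smult (mult_alg A) (-1) (coord x A))"
definition "x - y = fam (\<lambda>A. cs_minus (mult_alg A) (coord x A) (coord y A))"

lemma coord_ops:
  assumes A: "is_cstar A"
  shows "coord 0 A = cs_zero (mult_alg A)" "coord 1 A = cstar_alg.one A"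
    "coord (x + y) A = cs_add (mult_alg A) (coord x A) (coord y A)"
    "coord (x * y) A = cs_mult (mult_alg A) (coord x A) (coord y A)"
    "coord (- x) A = cs_smult (mult_alg A) (-1) (coord x A)"
    "coord (x - y) A = cs_minus (mult_alg A) (coord x A) (coord y A)"
  unfolding zero_mfam_def one_mfam_def plus_mfam_def times_mfam_def uminus_mfam_def minus_mfam_def
  by (rule coord_fam[OF _ A]; simp add: cstar_alg.M_zero cstar_alg.M_one cstar_alg.M_add
      cstar_alg.M_mult cstar_alg.M_smult cstar_alg.M_minus cstar_alg.intro)+

instance
proof
  fix x y z :: "'a mfam"
  show "x + y + z = x + (y + z)"
    by (rule mfam_eqI) (simp add: coord_ops cstar_alg.M_add_assoc cstar_alg.intro)
  show "x + y = y + x"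
    by (rule mfam_eqI) (simp add: coord_ops cstar_alg.M_add_commute cstar_alg.intro)
  show "0 + x = x"
    by (rule mfam_eqI) (simp add: coord_ops cstar_alg.M_add_zero cstar_alg.intro)
  show "- x + x = 0"
    by (rule mfam_eqI) (simp add: coord_ops cstar_alg.M_add_neg cstar_alg.intro)
  show "x - y = x + - y"
    by (rule mfam_eqI) (simp add: coord_ops cs_minus_def)
  show "x * y * z = x * (y * z)"
    by (rule mfam_eqI) (simp add: coord_ops cstar_alg.M_mult_assoc cstar_alg.intro)
  show "(x + y) * z = x * z + y * z"
    by (rule mfam_eqI) (simp add: coord_ops cstar_alg.M_add_mult cstar_alg.intro)
  show "x * (y + z) = x * y + x * z"
    by (rule mfam_eqI) (simp add: coord_ops cstar_alg.M_mult_add cstar_alg.intro)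
  show "1 * x = x" "x * 1 = x"
    by (rule mfam_eqI; simp add: coord_ops cstar_alg.M_one_mult cstar_alg.M_mult_one cstar_alg.intro)+
qed

end

definition mst :: "'a mfam \<Rightarrow> 'a mfam" where
  "mst x = fam (\<lambda>A. cs_star (mult_alg A) (coord x A))"

definition msc :: "complex \<Rightarrow> 'a mfam" where
  "msc c = fam (\<lambda>A. cs_smult (mult_alg A) c (cstar_alg.one A))"

lemma coord_mst: "is_cstar A \<Longrightarrow> coord (mst x) A = cs_star (mult_alg A) (coord x A)"
  unfolding mst_def by (rule coord_fam) (simp_all add: cstar_alg.M_star cstar_alg.intro)

lemma coord_msc: "is_cstar A \<Longrightarrow> coord (msc c) A = cs_smult (mult_alg A) c (cstar_alg.one A)"
  unfolding msc_def by (rule coord_fam) (simp_all add: cstar_alg.M_smult cstar_alg.M_one cstar_alg.intro)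

lemma coord_msc_mult: "is_cstar A \<Longrightarrow> coord (msc c * x) A = cs_smult (mult_alg A) c (coord x A)"
  by (simp add: coord_ops coord_msc cstar_alg.M_scalar_mult cstar_alg.intro)

lemmas coord_simps = coord_ops coord_mst

section \<open>A single multiplier algebra as a coordinate of the ring type\<close>

context cstar_alg
begin

lemma cstar_algI: "is_cstar A' \<Longrightarrow> cstar_alg A'" by (rule cstar_alg.intro)

lemmas coords [simp] = coord_simps[OF is_cstar] coord_mem[OF is_cstar]

lemma coord_scalar [simp]: "cs_mult M (coord (msc c) A) (coord x A) = cs_smult M c (coord x A)"
  using coord_msc_mult[OF is_cstar, of c x] by simp

definition nA :: "'a mfam \<Rightarrow> real" where
  "nA x = cs_nrm M (coord x A)"

text \<open>\<open>nA\<close> ignores all coordinates other than A. Demanding zero there makes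
  \<open>nA\<close> faithful on \<open>JA\<close>, and the set is still an ideal because zero
  absorbs whatever a factor has at the other coordinates.\<close>

definition JA :: "'a mfam set" where
  "JA = {x. (\<exists>a\<in>C. coord x A = mult_emb A a) \<and>
     (\<forall>A'. is_cstar A' \<longrightarrow> A' \<noteq> A \<longrightarrow> coord x A' = cs_zero (mult_alg A'))}"

definition lift :: "'a mult \<Rightarrow> 'a mfam" where
  "lift m = fam (\<lambda>A'. if A' = A then m else cs_zero (mult_alg A'))"

lemma coord_lift:
  assumes "m \<in> cs_carrier M"
  shows "coord (lift m) A = m"
    and coord_lift_other: "is_cstar A' \<Longrightarrow> A' \<noteq> A \<Longrightarrow> coord (lift m) A' = cs_zero (mult_alg A')"
  unfolding lift_def
  by (subst coord_fam; use assms is_cstar in \<open>auto simp: cstar_alg.M_zero[OF cstar_algI]\<close>)+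

lemma lift_emb_JA: "a \<in> C \<Longrightarrow> lift (mult_emb A a) \<in> JA"
  by (auto simp: JA_def coord_lift coord_lift_other)

lemma JA_E:
  assumes "x \<in> JA"
  obtains a where "a \<in> C" "coord x A = mult_emb A a"
  using assms by (auto simp: JA_def)

lemma JA_zero: "x \<in> JA \<Longrightarrow> is_cstar A' \<Longrightarrow> A' \<noteq> A \<Longrightarrow> coord x A' = cs_zero (mult_alg A')"
  by (auto simp: JA_def)

lemma JA_I:
  assumes "a \<in> C" "coord x A = mult_emb A a"
    "\<And>A'. is_cstar A' \<Longrightarrow> A' \<noteq> A \<Longrightarrow> coord x A' = cs_zero (mult_alg A')"
  shows "x \<in> JA"
  using assms by (auto simp: JA_def)

lemma M_zero_absorb:
  assumes "m \<in> cs_carrier M"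
  shows "cs_mult M m (cs_zero M) = cs_zero M" "cs_mult M (cs_zero M) m = cs_zero M"
    "cs_star M (cs_zero M) = cs_zero M"
  using M_mult_emb[OF assms zero_closed] M_emb_mult[OF assms zero_closed] M_emb_adj[OF zero_closed]
    M_memD(9)[OF assms zero_closed, of 0] M_memD(10)[OF assms zero_closed, of 0] M_memD(5,6)[OF assms zero_closed]
  by (simp_all add: M_emb_zero)

text \<open>Turns the strict Cauchy conditions of \<open>corona_frame\<close> into pointwise ones
  for the two components, since products with embedded elements are again embedded and the embedding
  is isometric.\<close>

lemma nA_diff_lim:
  "nA (x * lift (mult_emb A a) - y * lift (mult_emb A a)) = nm (fst (coord x A) a \<ominus> fst (coord y A) a)"
  "nA (lift (mult_emb A a) * x - lift (mult_emb A a) * y) = nm (snd (coord x A) a \<ominus> snd (coord y A) a)"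
  if "a \<in> C"
  using that by (simp_all add: nA_def coord_lift M_mult_emb M_emb_mult M_emb_minus[symmetric] nrm_emb M_memD(5,6))

lemma cstar_seminorm_mfam: "cstar_seminorm mst msc nA"
proof
  fix x y :: "'a mfam" and c d :: complex
  show "mst (mst x) = x"
    by (rule mfam_eqI) (simp add: coord_simps cstar_alg.M_star_star cstar_algI)
  show "mst (x + y) = mst x + mst y"
    by (rule mfam_eqI) (simp add: coord_simps cstar_alg.M_star_add cstar_algI)
  show "mst (x * y) = mst y * mst x"
    by (rule mfam_eqI) (simp add: coord_simps cstar_alg.M_star_mult cstar_algI)
  show "msc (c + d) = (msc c + msc d :: 'a mfam)"
    by (rule mfam_eqI) (simp add: coord_ops coord_msc cstar_alg.M_scalar_add cstar_algI)
  show "msc (c * d) = (msc c * msc d :: 'a mfam)"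
    by (rule mfam_eqI) (simp add: coord_ops coord_msc cstar_alg.M_scalar_scalar cstar_algI)
  show "msc 1 = (1 :: 'a mfam)"
    by (rule mfam_eqI) (simp add: coord_ops coord_msc cstar_alg.M_scalar_1 cstar_algI)
  show "msc c * x = x * msc c"
    by (rule mfam_eqI) (simp add: coord_ops coord_msc cstar_alg.M_scalar_mult cstar_alg.M_mult_scalar cstar_algI)
  show "mst (msc c) = (msc (cnj c) :: 'a mfam)"
    by (rule mfam_eqI) (simp add: coord_mst coord_msc cstar_alg.M_scalar_star cstar_algI)
  show "nA (x + y) \<le> nA x + nA y" by (simp add: nA_def nrm_add)
  show "nA (x * y) \<le> nA x * nA y" by (simp add: nA_def nrm_mult)
  show "nA (msc c * x) = cmod c * nA x" by (simp add: nA_def nrm_smult)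
  show "nA (mst x * x) = (nA x)\<^sup>2" by (simp add: nA_def nrm_cstar)
qed

lemma corona_frame_mfam: "corona_frame mst msc nA JA"
proof (intro corona_frame.intro cstar_seminorm_mfam corona_frame_axioms.intro)
  show "0 \<in> JA"
    by (rule JA_I[of zero]) (simp_all add: M_emb_zero coord_ops)
next
  fix x y assume xy: "x \<in> JA" "y \<in> JA"
  obtain a b where ab: "a \<in> C" "coord x A = mult_emb A a" "b \<in> C" "coord y A = mult_emb A b"
    using JA_E[OF xy(1)] JA_E[OF xy(2)] by metis
  show "x + y \<in> JA"
    by (rule JA_I[of "a \<oplus> b"])
      (simp_all add: ab M_emb_add coord_ops JA_zero[OF xy(1)] JA_zero[OF xy(2)]
        cstar_alg.M_add_zero cstar_alg.M_zero cstar_algI)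
next
  fix x y assume x: "x \<in> JA"
  obtain a where a: "a \<in> C" "coord x A = mult_emb A a" using JA_E[OF x] .
  show "y * x \<in> JA"
    by (rule JA_I[of "fst (coord y A) a"])
      (simp_all add: a M_mult_emb M_memD(5) coord_ops JA_zero[OF x] cstar_alg.M_zero_absorb cstar_algI)
  show "x * y \<in> JA"
    by (rule JA_I[of "snd (coord y A) a"])
      (simp_all add: a M_emb_mult M_memD(6) coord_ops JA_zero[OF x] cstar_alg.M_zero_absorb cstar_algI)
  show "mst x \<in> JA"
    by (rule JA_I[of "adj a"])
      (simp_all add: a M_emb_adj coord_mst JA_zero[OF x] cstar_alg.M_zero_absorb(3)[OF cstar_algI cstar_alg.M_zero] cstar_algI)
  show "x = 0" if "nA x = 0"
  proof (rule mfam_eqI)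
    fix A' :: "'a cstar" assume A': "is_cstar A'"
    have "a = zero" using that a by (simp add: nA_def nrm_emb nm_eq_0)
    then show "coord x A' = coord 0 A'"
      using a(2) JA_zero[OF x A'] A' by (cases "A' = A") (simp_all add: M_emb_zero coord_ops)
  qed
next
  fix x c assume *: "\<And>a. a \<in> JA \<Longrightarrow> nA a \<le> 1 \<Longrightarrow> nA (x * a) \<le> c"
  show "nA x \<le> c"
    unfolding nA_def
  proof (rule nrm_least)
    fix a assume a: "a \<in> C" "nm a \<le> 1"
    have "nA (x * lift (mult_emb A a)) \<le> c"
      by (rule *) (use a in \<open>simp_all add: lift_emb_JA nA_def coord_lift nrm_emb\<close>)
    then show "nm (fst (coord x A) a) \<le> c"
      using a by (simp add: nA_def coord_lift M_mult_emb nrm_emb M_memD(5))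
  qed
next
  fix S :: "nat \<Rightarrow> 'a mfam" and c
  assume b: "\<And>k. nA (S k) \<le> c"
    and l: "\<And>a \<epsilon>. a \<in> JA \<Longrightarrow> 0 < \<epsilon> \<Longrightarrow> \<exists>N. \<forall>i\<ge>N. \<forall>j\<ge>N. nA (S i * a - S j * a) < \<epsilon>"
    and r: "\<And>a \<epsilon>. a \<in> JA \<Longrightarrow> 0 < \<epsilon> \<Longrightarrow> \<exists>N. \<forall>i\<ge>N. \<forall>j\<ge>N. nA (a * S i - a * S j) < \<epsilon>"
  obtain s where s: "s \<in> cs_carrier M"
    "\<And>a. a \<in> C \<Longrightarrow> conv (\<lambda>k. fst (coord (S k) A) a) (fst s a)"
    "\<And>a. a \<in> C \<Longrightarrow> conv (\<lambda>k. snd (coord (S k) A) a) (snd s a)"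
  proof (rule M_strictly_complete[of "\<lambda>k. coord (S k) A" c])
    show "\<exists>N. \<forall>i\<ge>N. \<forall>j\<ge>N. nm (fst (coord (S i) A) a \<ominus> fst (coord (S j) A) a) < \<epsilon>"
      if "a \<in> C" "0 < \<epsilon>" for a \<epsilon>
      using l[OF lift_emb_JA[OF that(1)] that(2)] by (simp only: nA_diff_lim[OF that(1)])
    show "\<exists>N. \<forall>i\<ge>N. \<forall>j\<ge>N. nm (snd (coord (S i) A) a \<ominus> snd (coord (S j) A) a) < \<epsilon>"
      if "a \<in> C" "0 < \<epsilon>" for a \<epsilon>
      using r[OF lift_emb_JA[OF that(1)] that(2)] by (simp only: nA_diff_lim[OF that(1)])
  qed (use b in \<open>simp_all add: nA_def\<close>)
  have "(\<lambda>k. nA (S k * x - lift s * x)) \<longlonglongrightarrow> 0 \<and> (\<lambda>k. nA (x * S k - x * lift s)) \<longlonglongrightarrow> 0"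
    if x: "x \<in> JA" for x
  proof -
    obtain a where a: "a \<in> C" "coord x A = mult_emb A a" using JA_E[OF x] .
    then show ?thesis using s(2,3)[OF a(1)] s(1)
      by (simp add: nA_def coord_lift M_mult_emb M_emb_mult M_emb_minus[symmetric] nrm_emb M_memD(5,6) conv_def)
  qed
  then show "\<exists>s. \<forall>a\<in>JA. (\<lambda>k. nA (S k * a - s * a)) \<longlonglongrightarrow> 0 \<and> (\<lambda>k. nA (a * S k - a * s)) \<longlonglongrightarrow> 0"
    by blast
qed

sublocale mfam: corona_frame mst msc nA JA
  by (rule corona_frame_mfam)

text \<open>The subalgebra is generated in the ring type and then projected to the coordinate at A,
  which carries the ring operations to those of \<open>M\<close>.\<close>

lemma separable_coord:
  assumes "countable D"
  obtains B where "separable_subalg M B" "\<And>d. d \<in> D \<Longrightarrow> coord d A \<in> B"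
proof -
  obtain D' where D': "countable D'" "D \<subseteq> D'" "0 \<in> D'"
    "\<And>x y. x \<in> mfam.ncl D' \<Longrightarrow> y \<in> mfam.ncl D' \<Longrightarrow> x + y \<in> mfam.ncl D'"
    "\<And>x y. x \<in> mfam.ncl D' \<Longrightarrow> y \<in> mfam.ncl D' \<Longrightarrow> x * y \<in> mfam.ncl D'"
    "\<And>x. x \<in> mfam.ncl D' \<Longrightarrow> mst x \<in> mfam.ncl D'"
    "\<And>x c. x \<in> mfam.ncl D' \<Longrightarrow> msc c * x \<in> mfam.ncl D'"
    using mfam.separable_generated[OF assms] by blast
  define B where "B = (\<lambda>x. coord x A) ` mfam.ncl D'"
  have sub: "D' \<subseteq> mfam.ncl D'" by (rule mfam.subset_ncl)
  have BI: "x \<in> mfam.ncl D' \<Longrightarrow> coord x A \<in> B" for x by (auto simp: B_def)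
  have BE: "\<exists>x\<in>mfam.ncl D'. m = coord x A" if "m \<in> B" for m using that by (auto simp: B_def)
  have "separable_subalg M B"
    unfolding separable_subalg_def
  proof (intro conjI ballI allI impI)
    show "B \<subseteq> cs_carrier M" by (auto simp: B_def)
    show "cs_zero M \<in> B" using BI[of 0] sub D'(3) by auto
    fix x assume "x \<in> B"
    then obtain x' where x': "x' \<in> mfam.ncl D'" "x = coord x' A" using BE by blast
    show "cs_smult M c x \<in> B" for c using BI[OF D'(7)[OF x'(1), of c]] x' by simp
    show "cs_star M x \<in> B" using BI[OF D'(6)[OF x'(1)]] x' by simp
    fix y assume "y \<in> B"
    then obtain y' where y': "y' \<in> mfam.ncl D'" "y = coord y' A" using BE by blast
    show "cs_add M x y \<in> B" using BI[OF D'(4)[OF x'(1) y'(1)]] x' y' by simp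
    show "cs_mult M x y \<in> B" using BI[OF D'(5)[OF x'(1) y'(1)]] x' y' by simp
  next
    fix X l assume *: "(\<forall>k. X k \<in> B) \<and> l \<in> cs_carrier M \<and> (\<lambda>k. cs_nrm M (cs_minus M (X k) l)) \<longlonglongrightarrow> 0"
    have "\<forall>k. \<exists>x\<in>mfam.ncl D'. X k = coord x A" using * BE by blast
    then obtain Y where Y: "\<And>k. Y k \<in> mfam.ncl D'" "\<And>k. X k = coord (Y k) A" by metis
    \<comment> \<open>The approximants \<open>Y k\<close> may be nonzero at other coordinates where
      \<open>lift l\<close> is zero. This is harmless, as \<open>nA\<close> measures the coordinate
      at A only.\<close>
    have "lift l \<in> mfam.ncl D'"
    proof (rule mfam.ncl_limit)
      fix \<epsilon> :: real assume "0 < \<epsilon>"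
      then have "\<forall>\<^sub>F k in sequentially. cs_nrm M (cs_minus M (X k) l) < \<epsilon>"
        using * by (intro order_tendstoD(2)) auto
      then obtain k where "cs_nrm M (cs_minus M (X k) l) < \<epsilon>" by (auto simp: eventually_sequentially)
      then have "nA (Y k - lift l) < \<epsilon>" using * by (simp add: nA_def coord_lift Y)
      then show "\<exists>y\<in>mfam.ncl D'. nA (lift l - y) < \<epsilon>"
        using Y(1) mfam.n_diff_commute by metis
    qed
    from BI[OF this] show "l \<in> B" using * by (simp add: coord_lift)
  next
    show "\<exists>E. countable E \<and> E \<subseteq> B \<and> (\<forall>b\<in>B. \<forall>e>0. \<exists>d\<in>E. cs_nrm M (cs_minus M b d) < e)"
    proof (intro exI[of _ "(\<lambda>x. coord x A) ` D'"] conjI ballI allI impI)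
      show "countable ((\<lambda>x. coord x A) ` D')" using D'(1) by simp
      show "(\<lambda>x. coord x A) ` D' \<subseteq> B" using sub by (auto simp: B_def)
      fix b and e :: real assume "b \<in> B" and e: "0 < e"
      then obtain x where x: "x \<in> mfam.ncl D'" "b = coord x A" using BE by blast
      then obtain d where "d \<in> D'" "nA (x - d) < e" using e unfolding mfam.ncl_def by blast
      then show "\<exists>d\<in>(\<lambda>x. coord x A) ` D'. cs_nrm M (cs_minus M b d) < e"
        using x by (auto simp: nA_def)
    qed
  qed
  moreover have "coord d A \<in> B" if "d \<in> D" for d using that D'(2) sub BI by blast
  ultimately show ?thesis using that by blast
qed

lemma lift_eqI:
  assumes "m \<in> cs_carrier M" "coord x A = m"
    "\<And>A'. is_cstar A' \<Longrightarrow> A' \<noteq> A \<Longrightarrow> coord x A' = cs_zero (mult_alg A')"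
  shows "x = lift m"
proof (rule mfam_eqI)
  fix A' :: "'a cstar" assume "is_cstar A'"
  then show "coord x A' = coord (lift m) A'"
    using assms by (cases "A' = A") (simp_all add: coord_lift coord_lift_other)
qed

lemma projection_unit_lift:
  assumes e: "approx_unit A e" "\<And>k. cs_projection A (e k)"
  shows "projection_unit mst msc nA JA (\<lambda>k. lift (mult_emb A (e k)))"
proof (intro projection_unit.intro corona_frame_mfam projection_unit_axioms.intro)
  have p: "e k \<in> C" "adj (e k) = e k" "e k \<odot> e k = e k" for k
    using e(2)[of k] by (auto simp: cs_projection_def)
  have J: "lift (mult_emb A (e k)) \<in> JA" for k by (rule lift_emb_JA[OF p(1)])
  then show "lift (mult_emb A (e k)) \<in> JA" for k .
  fix k
  show "mst (lift (mult_emb A (e k))) = lift (mult_emb A (e k))"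
    by (rule lift_eqI) (simp_all add: p coord_lift M_emb_adj[symmetric]
      JA_zero[OF mfam.J_st[OF J]])
  show "lift (mult_emb A (e k)) * lift (mult_emb A (e k)) = lift (mult_emb A (e k))"
    by (rule lift_eqI) (simp_all add: p coord_lift M_emb_emb[symmetric]
      JA_zero[OF mfam.J_left[OF J]])
  have "cs_le A (e k) (e (Suc k))" using e(1) by (simp add: approx_unit_def)
  then obtain y where y: "y \<in> C" "e (Suc k) \<ominus> e k = adj y \<odot> y"
    by (auto simp: cs_le_def cs_positive_def)
  have "mst (lift (mult_emb A y)) * lift (mult_emb A y) = lift (mult_emb A (adj y \<odot> y))"
    by (rule lift_eqI) (simp_all add: y(1) coord_lift M_emb_emb M_emb_adj
      JA_zero[OF mfam.J_left[OF lift_emb_JA[OF y(1)]]])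
  moreover have "lift (mult_emb A (e (Suc k))) - lift (mult_emb A (e k)) = lift (mult_emb A (e (Suc k) \<ominus> e k))"
    by (rule lift_eqI) (simp_all add: p coord_lift M_emb_minus JA_zero[OF mfam.J_diff[OF J J]])
  ultimately show "\<exists>y. mst y * y = lift (mult_emb A (e (Suc k))) - lift (mult_emb A (e k))"
    using y(2) by auto
next
  have p: "e k \<in> C" for k using e(2)[of k] by (auto simp: cs_projection_def)
  fix x assume "x \<in> JA"
  then obtain a where a: "a \<in> C" "coord x A = mult_emb A a" using JA_E by blast
  then show "(\<lambda>k. nA (lift (mult_emb A (e k)) * x - x)) \<longlonglongrightarrow> 0"
    using e(1) by (simp add: nA_def coord_lift p M_emb_emb[symmetric] M_emb_minus[symmetric] nrm_emb approx_unit_def)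
qed

lemma q_corona: "mfam.q x = corona_nrm A (coord x A)"
proof -
  have "{nA (x - a) | a. a \<in> JA} = {cs_nrm M (cs_minus M (coord x A) (mult_emb A a)) | a. a \<in> C}"
  proof (intro equalityI subsetI)
    fix t assume "t \<in> {nA (x - a) | a. a \<in> JA}"
    then obtain y where y: "y \<in> JA" "t = nA (x - y)" by blast
    obtain a where "a \<in> C" "coord y A = mult_emb A a" using JA_E[OF y(1)] .
    then show "t \<in> {cs_nrm M (cs_minus M (coord x A) (mult_emb A a)) | a. a \<in> C}"
      using y by (auto simp: nA_def)
  next
    fix t assume "t \<in> {cs_nrm M (cs_minus M (coord x A) (mult_emb A a)) | a. a \<in> C}"
    then obtain a where a: "a \<in> C" "t = cs_nrm M (cs_minus M (coord x A) (mult_emb A a))" by blast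
    then have "t = nA (x - lift (mult_emb A a))" by (simp add: nA_def coord_lift)
    then show "t \<in> {nA (x - a) | a. a \<in> JA}" using lift_emb_JA[OF a(1)] by blast
  qed
  then show ?thesis by (simp add: mfam.q_def corona_nrm_def)
qed

lemma coord_ev:
  assumes "spoly_consts P \<subseteq> cs_carrier M"
  shows "coord (mfam.ev b (map_spoly lift P)) A = spoly_eval M (\<lambda>k. coord (b k) A) P"
  using assms
proof (induction P)
  case (PScal z P)
  then show ?case using coord_scalar[of z "mfam.ev b (map_spoly lift P)"] by simp
qed (simp_all add: coord_lift)

end

section \<open>Transfer from the abstract frame to the corona\<close>

theorem theorem1p0:
  fixes A :: "'a cstar"
  assumes "is_cstar A"
    and "sigma_unital A"
    and "\<forall>B. separable_subalg (mult_alg A) B \<longrightarrow>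
           (\<exists>e. approx_unit A e \<and> (\<forall>k. cs_projection A (e k)) \<and>
                (\<forall>b\<in>B. (\<lambda>k. cs_nrm (mult_alg A)
                     (cs_minus (mult_alg A) (cs_mult (mult_alg A) (mult_emb A (e k)) b)
                                            (cs_mult (mult_alg A) b (mult_emb A (e k))))) \<longlonglongrightarrow> 0))"
  shows "corona_ctbl_qf_saturated A"
proof -
  interpret cstar_alg A by unfold_locales (rule assms(1))
  \<comment> \<open>The hypothesis concerns separable subalgebras while \<open>saturation\<close>
    works with countable sets; \<open>separable_coord\<close> encloses the coordinates of such a set
    in a separable subalgebra.\<close>
  have units: "\<exists>e. projection_unit mst msc nA JA e \<and> (\<forall>d\<in>D. (\<lambda>k. nA (e k * d - d * e k)) \<longlonglongrightarrow> 0)"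
    if D: "countable D" for D
  proof -
    obtain B where B: "separable_subalg M B" "\<And>d. d \<in> D \<Longrightarrow> coord d A \<in> B"
      using separable_coord[OF D] by blast
    obtain e where e: "approx_unit A e" "\<And>k. cs_projection A (e k)"
      "\<And>b. b \<in> B \<Longrightarrow> (\<lambda>k. cs_nrm M (cs_minus M (cs_mult M (mult_emb A (e k)) b) (cs_mult M b (mult_emb A (e k))))) \<longlonglongrightarrow> 0"
      using assms(3) B(1) by blast
    have p: "e k \<in> C" for k using e(2)[of k] by (auto simp: cs_projection_def)
    have "(\<lambda>k. nA (lift (mult_emb A (e k)) * d - d * lift (mult_emb A (e k)))) \<longlonglongrightarrow> 0" if "d \<in> D" for d
      using e(3)[OF B(2)[OF that]] by (simp add: nA_def coord_lift p)
    then show ?thesis using projection_unit_lift[OF e(1,2)] by blast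
  qed
  show ?thesis
    unfolding corona_ctbl_qf_saturated_def
  proof (intro allI impI iffI)
    fix P :: "nat \<Rightarrow> 'a mult spoly" and K :: "nat \<Rightarrow> real set" and m :: nat
    assume "\<exists>b. (\<forall>k. b k \<in> cs_carrier M \<and> corona_nrm A (b k) \<le> 1) \<and>
        (\<forall>n. corona_nrm A (spoly_eval M b (P n)) \<in> K n)"
    moreover have "x \<in> F \<Longrightarrow> x \<in> thicken F (1 / real m)" for x F
      unfolding thicken_def by (auto intro!: bexI[of _ x])
    ultimately show "\<exists>b. (\<forall>k. b k \<in> cs_carrier M \<and> corona_nrm A (b k) \<le> 1) \<and>
        (\<forall>n\<le>m. corona_nrm A (spoly_eval M b (P n)) \<in> thicken (K n) (1 / real m))"
      by blast
  next
    fix P :: "nat \<Rightarrow> 'a mult spoly" and K :: "nat \<Rightarrow> real set"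
    assume PK: "(\<forall>n. spoly_consts (P n) \<subseteq> cs_carrier M) \<and> (\<forall>n. compact (K n))"
      and approx: "\<forall>m::nat. m \<ge> 1 \<longrightarrow> (\<exists>b. (\<forall>k. b k \<in> cs_carrier M \<and> corona_nrm A (b k) \<le> 1) \<and>
        (\<forall>n\<le>m. corona_nrm A (spoly_eval M b (P n)) \<in> thicken (K n) (1 / real m)))"
    have "\<exists>b. (\<forall>k. mfam.q (b k) \<le> 1) \<and> (\<forall>j. mfam.q (mfam.ev b (map_spoly lift (P j))) \<in> K j)"
    proof (rule mfam.saturation[OF units])
      show "closed (K j)" for j using PK compact_imp_closed by blast
      fix m :: nat
      \<comment> \<open>Stage \<open>Suc m\<close> is used: the hypothesis starts at 1, its
        tolerance is the \<open>1 / real (Suc m)\<close> asked for by \<open>saturation\<close>, and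
        its conditions include those up to m.\<close>
      obtain b where b: "\<And>k. b k \<in> cs_carrier M" "\<And>k. corona_nrm A (b k) \<le> 1"
        "\<And>n. n \<le> Suc m \<Longrightarrow> corona_nrm A (spoly_eval M b (P n)) \<in> thicken (K n) (1 / real (Suc m))"
        using approx[rule_format, of "Suc m"] by auto
      have "mfam.q (mfam.ev (\<lambda>k. lift (b k)) (map_spoly lift (P j))) = corona_nrm A (spoly_eval M b (P j))" for j
        using PK b(1) by (simp add: q_corona coord_ev coord_lift)
      then show "\<exists>b. (\<forall>k. mfam.q (b k) \<le> 1) \<and>
          (\<forall>j\<le>m. \<exists>y\<in>K j. \<bar>mfam.q (mfam.ev b (map_spoly lift (P j))) - y\<bar> \<le> 1 / real (Suc m))"
        using b by (intro exI[of _ "\<lambda>k. lift (b k)"]) (auto simp: q_corona coord_lift thicken_def)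
    qed
    then obtain b where b: "\<And>k. mfam.q (b k) \<le> 1" "\<And>j. mfam.q (mfam.ev b (map_spoly lift (P j))) \<in> K j"
      by blast
    show "\<exists>b. (\<forall>k. b k \<in> cs_carrier M \<and> corona_nrm A (b k) \<le> 1) \<and>
        (\<forall>n. corona_nrm A (spoly_eval M b (P n)) \<in> K n)"
      using b PK by (intro exI[of _ "\<lambda>k. coord (b k) A"]) (simp add: q_corona coord_ev)
  qed
qed

end
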